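(* Assume that the Weakened Minimal Resolution Conjecture (stated in the context) holds. Let $X\subseteq\mathbb{P}^1\times\mathbb{P}^2$ be a finite set of points in sufficiently general position with $N=|X|\ge 12$. Write $N=6q+r=3q'+r'$ with $0\le r\le5$ and $0\le r'\le 2$. Then the virtual of a pair construction for $\mathbf{d}=(N-1,0)$, i.e. the subcomplex of the minimal free resolution of $S/I_X$ consisting of all summands generated in degrees at most $\mathbf{d}+(1,2)=(N,2)$, yields a virtual resolution of $S/I_X$ of the form \[ S\leftarrow G_1\leftarrow G_2\leftarrow G_3\leftarrow 0, \] where \[ G_1=S(-q,-2)^{6-r}\oplus S(-q-1,-2)^{r}\oplus S(-q',-1)^{3-r'}\oplus S(-q'-1,-1)^{r'}\oplus S(-N,0), \] \[ G_2=S(-q',-2)^{9-3r'}\oplus S(-q'-1,-2)^{3r'}\oplus S(-N,-1)^3,\qquad G_3=S(-N,-2)^3 . \] (When $r=0$ the term $S(-q-1,-2)^r$ does not appear; when $r'=0$ the terms $S(-q'-1,-1)^{r'}$ and $S(-q'-1,-2)^{3r'}$ do not appear.)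
   Context: $\Bbbk$ is an algebraically closed field and $S=\Bbbk[x_0,x_1,y_0,y_1,y_2]$ is the Cox ring of $\mathbb{P}^1\times\mathbb{P}^2$ over $\Bbbk$, with $\mathbb{Z}^2$-grading $\deg(x_i)=(1,0)$, $\deg(y_j)=(0,1)$; $B=\langle x_0,x_1\rangle\cap\langle y_0,y_1,y_2\rangle$. $I_X\subseteq S$ is the bihomogeneous vanishing ideal of $X$. The partial order on $\mathbb{Z}^2$ is $(i,j)\ge(i',j')$ iff $i\ge i'$ and $j\ge j'$. Virtual resolutions: $\Gamma_B(M)=\{u\in M\mid B^tu=0\text{ for some }t\in\mathbb{N}\}$. A $\mathbb{Z}^2$-graded complex of free $S$-modules $F_\bullet\colon F_0\leftarrow F_1\leftarrow\cdots$ is a virtual resolution of a finitely generated $\mathbb{Z}^2$-graded $S$-module $M$ if (1) for each $i>0$ there is some $t$ with $B^tH_i(F_\bullet)=0$, and (2) $H_0(F_\bullet)/\Gamma_B(H_0(F_\bullet))\cong M/\Gamma_B(M)$. Hilbert matrices: $H_X(i,j)=\dim_{\Bbbk}(S/I_X)_{(i,j)}$ for $(i,j)\in\mathbb{Z}^2$. $X$ has a generic Hilbert matrix if $H_X(i,j)=\min\{|X|,\,(i+1)\binom{j+2}{2}\}$ for all $i,j\ge0$. For a matrix $H$ indexed by $\mathbb{Z}^2$, $(\Delta^CH)_{i,j}=H_{i,j}-H_{i-1,j}$, $(\Delta^RH)_{i,j}=H_{i,j}-H_{i,j-1}$, and $DH=(\Delta^C)^2(\Delta^R)^3H$. $\beta_{k,(i,j)}$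 denotes the bigraded Betti numbers of $S/I_X$, i.e. the $k$-th module of its minimal free resolution is $\bigoplus_{(i,j)}S(-i,-j)^{\beta_{k,(i,j)}}$. Sufficiently general position: $X$ is in sufficiently general position if (1) $X$ has a generic Hilbert matrix, and (2) for every $(i,j)\ge(0,0)$ with $(i,j)\ne(0,0)$, one has $\beta_{1,(i,j)}>0$ if and only if [$DH_X(i,j)<0$ and $DH_X(i',j')\le0$ for all $(i',j')\le(i,j)$ with $(i',j')\ne(0,0)$]; and whenever this bracketed condition holds, $\beta_{1,(i,j)}=-DH_X(i,j)$. Weakened Minimal Resolution Conjecture: for every integer $N\ge2$ there exists a dense open subset $U\subseteq(\mathbb{P}^1\times\mathbb{P}^2)^N$ such that for every $(P_1,\dots,P_N)\in U$ the set $X=\{P_1,\dots,P_N\}$ satisfies (1) and (2) above. *)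

theory Defs
  imports
    "HOL-Analysis.Analysis"
    "HOL-Algebra.Ideal_Product"
    "HOL-Algebra.QuotRing"
    "HOL-Algebra.Module"
    "HOL-Algebra.Embedded_Algebras"
    "HOL-Library.Poly_Mapping"
begin

section \<open>The Cox ring of the product of a projective line and a projective plane\<close>

text \<open>Polynomials in variables \<open>'v\<close> are finitely supported functions on monomials, and monomials
  are finitely supported exponent functions. The variables of the Cox ring are indexed by
  \<open>2 + 3\<close>: \<open>Inl i\<close> stands for \<open>x\<^sub>i\<close> and \<open>Inr j\<close> for \<open>y\<^sub>j\<close>.\<close>

type_synonym ('v, 'k) mpoly = "('v \<Rightarrow>\<^sub>0 nat) \<Rightarrow>\<^sub>0 'k"

type_synonym 'k cox = "(2 + 3, 'k) mpoly"

definition mvar :: "'v \<Rightarrow> ('v, 'k::comm_ring_1) mpoly"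
  where "mvar v = Poly_Mapping.single (Poly_Mapping.single v 1) 1"

definition mconst :: "'k::comm_ring_1 \<Rightarrow> ('v, 'k) mpoly"
  where "mconst c = Poly_Mapping.single 0 c"

definition eval_mpoly :: "('v \<Rightarrow> 'k::comm_ring_1) \<Rightarrow> ('v, 'k) mpoly \<Rightarrow> 'k"
  where "eval_mpoly a p =
    (\<Sum>m\<in>Poly_Mapping.keys p.
       Poly_Mapping.lookup p m * (\<Prod>v\<in>Poly_Mapping.keys m. a v ^ Poly_Mapping.lookup m v))"

definition cox_ring :: "'k::comm_ring_1 cox ring"
  where "cox_ring = \<lparr>carrier = UNIV, monoid.mult = (*), one = 1, ring.zero = 0, add = (+)\<rparr>"

definition bideg :: "(2 + 3 \<Rightarrow>\<^sub>0 nat) \<Rightarrow> int \<times> int"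
  where "bideg m =
    ((\<Sum>i\<in>UNIV. int (Poly_Mapping.lookup m (Inl i))),
     (\<Sum>j\<in>UNIV. int (Poly_Mapping.lookup m (Inr j))))"

definition cox_comp :: "int \<times> int \<Rightarrow> 'k::comm_ring_1 cox set"
  where "cox_comp d = {p. \<forall>m\<in>Poly_Mapping.keys p. bideg m = d}"

definition irrelevant_ideal :: "'k::comm_ring_1 cox set"
  where "irrelevant_ideal =
    genideal cox_ring (range (\<lambda>i. mvar (Inl i))) \<inter> genideal cox_ring (range (\<lambda>j. mvar (Inr j)))"

definition maximal_ideal :: "'k::comm_ring_1 cox set"
  where "maximal_ideal = genideal cox_ring (range mvar)"

primrec ideal_power :: "('a, 'b) ring_scheme \<Rightarrow> 'a set \<Rightarrow> nat \<Rightarrow> 'a set"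
  where
    "ideal_power R I 0 = carrier R"
  | "ideal_power R I (Suc t) = ideal_prod R I (ideal_power R I t)"


section \<open>Bigraded modules over the Cox ring\<close>

text \<open>HOL-Algebra modules together with their graded pieces. The fields \<open>mult\<close> and \<open>one\<close>, which
  the record type of modules inherits from rings, play no role in the theory of modules.\<close>

record ('a, 'm) gmodule = "('a, 'm) module" +
  gcomp :: "int \<times> int \<Rightarrow> 'm set"

definition cox_module :: "('k::comm_ring_1 cox, 'k cox) gmodule"
  where "cox_module = \<lparr>carrier = UNIV, monoid.mult = (*), one = 1, ring.zero = 0, add = (+),
    smult = (*), gcomp = cox_comp\<rparr>"

definition gsub :: "('a, 'm) gmodule \<Rightarrow> 'm set \<Rightarrow> ('a, 'm) gmodule"
  where "gsub M N = M\<lparr>carrier := N, gcomp := (\<lambda>d. gcomp M d \<inter> N)\<rparr>"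

definition gquot :: "('a, 'm) gmodule \<Rightarrow> 'm set \<Rightarrow> ('a, 'm set) gmodule"
  where "gquot M N = \<lparr>carrier = a_rcosets\<^bsub>M\<^esub> N, monoid.mult = undefined, one = undefined,
    ring.zero = N, add = set_add M,
    smult = (\<lambda>r C. \<Union>u\<in>C. N +>\<^bsub>M\<^esub> (r \<odot>\<^bsub>M\<^esub> u)),
    gcomp = (\<lambda>d. (\<lambda>u. N +>\<^bsub>M\<^esub> u) ` gcomp M d)\<rparr>"

definition gmodule_iso :: "('a, 'm) gmodule \<Rightarrow> ('a, 'n) gmodule \<Rightarrow> bool"
  where "gmodule_iso M N \<longleftrightarrow>
    (\<exists>f \<in> iso (add_monoid M) (add_monoid N).
       (\<forall>r. \<forall>u\<in>carrier M. f (r \<odot>\<^bsub>M\<^esub> u) = r \<odot>\<^bsub>N\<^esub> f u) \<and>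
       (\<forall>d. f ` gcomp M d = gcomp N d))"

definition irrelevant_torsion :: "('k::comm_ring_1 cox, 'm) gmodule \<Rightarrow> 'm set"
  where "irrelevant_torsion M =
    {u \<in> carrier M. \<exists>t. \<forall>b\<in>ideal_power cox_ring irrelevant_ideal t. b \<odot>\<^bsub>M\<^esub> u = \<zero>\<^bsub>M\<^esub>}"


section \<open>Complexes of graded free modules\<close>

text \<open>A complex \<open>F\<^sub>0 \<leftarrow> F\<^sub>1 \<leftarrow> \<dots>\<close> of graded free modules of finite rank is given by homogeneous
  bases: \<open>gens F i\<close> is the index set of the basis of \<open>F\<^sub>i\<close>, the basis element \<open>b\<close> has degree
  \<open>gdeg F i b\<close> (so it spans a summand \<open>S(- gdeg F i b)\<close>), and \<open>dmat F i r c\<close> is the coefficient at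
  the basis element \<open>r\<close> of \<open>F\<^sub>i\<close> in the image of the basis element \<open>c\<close> of \<open>F\<^bsub>i+1\<^esub>\<close>.\<close>

record (overloaded) 'k gcomplex =
  gens :: "nat \<Rightarrow> nat set"
  gdeg :: "nat \<Rightarrow> nat \<Rightarrow> int \<times> int"
  dmat :: "nat \<Rightarrow> nat \<Rightarrow> nat \<Rightarrow> 'k cox"

definition free_gmodule :: "'k::comm_ring_1 gcomplex \<Rightarrow> nat \<Rightarrow> ('k cox, nat \<Rightarrow> 'k cox) gmodule"
  where "free_gmodule F i =
    \<lparr>carrier = {u. \<forall>b. b \<notin> gens F i \<longrightarrow> u b = 0},
     monoid.mult = undefined, one = undefined,
     ring.zero = (\<lambda>b. 0), add = (\<lambda>u v b. u b + v b),
     smult = (\<lambda>r u b. r * u b),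
     gcomp = (\<lambda>d. {u. (\<forall>b. b \<notin> gens F i \<longrightarrow> u b = 0) \<and>
                      (\<forall>b\<in>gens F i. u b \<in> cox_comp (d - gdeg F i b))})\<rparr>"

definition differential ::
    "'k::comm_ring_1 gcomplex \<Rightarrow> nat \<Rightarrow> (nat \<Rightarrow> 'k cox) \<Rightarrow> nat \<Rightarrow> 'k cox"
  where "differential F i u =
    (\<lambda>r. if r \<in> gens F i then \<Sum>c\<in>gens F (Suc i). dmat F i r c * u c else 0)"

definition graded_free_complex :: "'k::comm_ring_1 gcomplex \<Rightarrow> bool"
  where "graded_free_complex F \<longleftrightarrow>
    (\<forall>i. finite (gens F i)) \<and>
    (\<forall>i. \<forall>r\<in>gens F i. \<forall>c\<in>gens F (Suc i).
       dmat F i r c \<in> cox_comp (gdeg F (Suc i) c - gdeg F i r)) \<and>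
    (\<forall>i. \<forall>u\<in>carrier (free_gmodule F (Suc (Suc i))).
       differential F i (differential F (Suc i) u) = (\<lambda>b. 0))"

definition cycles :: "'k::comm_ring_1 gcomplex \<Rightarrow> nat \<Rightarrow> (nat \<Rightarrow> 'k cox) set"
  where "cycles F i = (case i of
      0 \<Rightarrow> carrier (free_gmodule F 0)
    | Suc j \<Rightarrow> {u \<in> carrier (free_gmodule F (Suc j)). differential F j u = (\<lambda>b. 0)})"

definition boundaries :: "'k::comm_ring_1 gcomplex \<Rightarrow> nat \<Rightarrow> (nat \<Rightarrow> 'k cox) set"
  where "boundaries F i = differential F i ` carrier (free_gmodule F (Suc i))"

definition homology ::
    "'k::comm_ring_1 gcomplex \<Rightarrow> nat \<Rightarrow> ('k cox, (nat \<Rightarrow> 'k cox) set) gmodule"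
  where "homology F i = gquot (gsub (free_gmodule F i) (cycles F i)) (boundaries F i)"

text \<open>The multiset of degrees \<open>a\<close> such that \<open>F\<^sub>i\<close> is the direct sum of the modules \<open>S(-a)\<close>.\<close>

definition twists :: "'k::comm_ring_1 gcomplex \<Rightarrow> nat \<Rightarrow> (int \<times> int) multiset"
  where "twists F i = image_mset (gdeg F i) (mset_set (gens F i))"

definition minimal_free_resolution ::
    "'k::comm_ring_1 gcomplex \<Rightarrow> ('k cox, 'm) gmodule \<Rightarrow> bool"
  where "minimal_free_resolution F M \<longleftrightarrow>
    graded_free_complex F \<and>
    (\<forall>i>0. carrier (homology F i) = {\<zero>\<^bsub>homology F i\<^esub>}) \<and>
    gmodule_iso (homology F 0) M \<and>
    (\<forall>i. \<forall>r\<in>gens F i. \<forall>c\<in>gens F (Suc i). dmat F i r c \<in> maximal_ideal)"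

text \<open>Well defined, since minimal free resolutions are unique up to isomorphism.\<close>

definition betti :: "('k::comm_ring_1 cox, 'm) gmodule \<Rightarrow> nat \<Rightarrow> int \<times> int \<Rightarrow> nat"
  where "betti M k d =
    (THE n. \<exists>F :: 'k gcomplex. minimal_free_resolution F M \<and> n = count (twists F k) d)"

definition virtual_resolution ::
    "'k::comm_ring_1 gcomplex \<Rightarrow> ('k cox, 'm) gmodule \<Rightarrow> bool"
  where "virtual_resolution F M \<longleftrightarrow>
    graded_free_complex F \<and>
    (\<forall>i>0. \<exists>t. \<forall>b\<in>ideal_power cox_ring irrelevant_ideal t. \<forall>h\<in>carrier (homology F i).
       b \<odot>\<^bsub>homology F i\<^esub> h = \<zero>\<^bsub>homology F i\<^esub>) \<and>
    gmodule_iso (gquot (homology F 0) (irrelevant_torsion (homology F 0)))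
                (gquot M (irrelevant_torsion M))"

text \<open>All summands generated in degrees at most \<open>d + (1,2)\<close>, in the componentwise order. The
  differential of \<open>F\<close> preserves these summands, because a nonzero entry \<open>dmat F i r c\<close> forces
  \<open>gdeg F i r \<le> gdeg F (Suc i) c\<close>; so restricting its matrices gives the subcomplex.\<close>

definition virtual_of_pair :: "'k::comm_ring_1 gcomplex \<Rightarrow> int \<times> int \<Rightarrow> 'k gcomplex"
  where "virtual_of_pair F d = F\<lparr>gens := (\<lambda>i. {b \<in> gens F i. gdeg F i b \<le> d + (1, 2)})\<rparr>"


section \<open>Points\<close>

typedef (overloaded) ('k, 'n) proj =
  "{L :: ('k::field ^ 'n::finite) set. vec.subspace L \<and> vec.dim L = 1}"
proof -
  obtain i :: 'n where True by simp
  have "axis i (1::'k) \<noteq> 0" by (simp add: axis_eq_0_iff)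
  then have "vec.dim (vec.span {axis i (1::'k)}) = 1"
    using vec.dim_span_eq_card_independent[of "{axis i (1::'k)}"] by simp
  then show ?thesis using vec.subspace_span by blast
qed

type_synonym 'k point = "('k, 2) proj \<times> ('k, 3) proj"

definition coordinates :: "'k::field point \<Rightarrow> (2 + 3 \<Rightarrow> 'k) set"
  where "coordinates P =
    {case_sum (($) u) (($) v) | u v. u \<in> Rep_proj (fst P) - {0} \<and> v \<in> Rep_proj (snd P) - {0}}"

definition vanishing_ideal :: "'k::field point set \<Rightarrow> 'k cox set"
  where "vanishing_ideal X = genideal cox_ring
    {f. (\<exists>d. f \<in> cox_comp d) \<and> (\<forall>P\<in>X. \<forall>a\<in>coordinates P. eval_mpoly a f = 0)}"

definition coordinate_module :: "'k::field point set \<Rightarrow> ('k cox, 'k cox set) gmodule"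
  where "coordinate_module X = gquot cox_module (vanishing_ideal X)"

text \<open>The dimension of the graded piece over (the image of) the field of constants, inside the
  quotient ring.\<close>

definition hilbert_matrix :: "'k::field point set \<Rightarrow> int \<Rightarrow> int \<Rightarrow> int"
  where "hilbert_matrix X i j =
    int (ring.dim (cox_ring Quot vanishing_ideal X)
      (range (\<lambda>c. vanishing_ideal X +>\<^bsub>cox_ring\<^esub> mconst c))
      ((\<lambda>p. vanishing_ideal X +>\<^bsub>cox_ring\<^esub> p) ` cox_comp (i, j)))"

definition diff_C :: "(int \<Rightarrow> int \<Rightarrow> int) \<Rightarrow> int \<Rightarrow> int \<Rightarrow> int"
  where "diff_C H i j = H i j - H (i - 1) j"

definition diff_R :: "(int \<Rightarrow> int \<Rightarrow> int) \<Rightarrow> int \<Rightarrow> int \<Rightarrow> int"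
  where "diff_R H i j = H i j - H i (j - 1)"

definition diff_D :: "(int \<Rightarrow> int \<Rightarrow> int) \<Rightarrow> int \<Rightarrow> int \<Rightarrow> int"
  where "diff_D H = (diff_C ^^ 2) ((diff_R ^^ 3) H)"

definition generic_hilbert_matrix :: "'k::field point set \<Rightarrow> bool"
  where "generic_hilbert_matrix X \<longleftrightarrow>
    (\<forall>i j :: nat. hilbert_matrix X (int i) (int j) =
       int (min (card X) ((i + 1) * ((j + 2) choose 2))))"

definition predicted_generator_degree :: "'k::field point set \<Rightarrow> int \<Rightarrow> int \<Rightarrow> bool"
  where "predicted_generator_degree X i j \<longleftrightarrow>
    diff_D (hilbert_matrix X) i j < 0 \<and>
    (\<forall>i' j'. (i', j') \<le> (i, j) \<and> (i', j') \<noteq> (0, 0) \<longrightarrow> diff_D (hilbert_matrix X) i' j' \<le> 0)"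

definition sufficiently_general_position :: "'k::field point set \<Rightarrow> bool"
  where "sufficiently_general_position X \<longleftrightarrow>
    generic_hilbert_matrix X \<and>
    (\<forall>i j. (i, j) \<ge> (0, 0) \<and> (i, j) \<noteq> (0, 0) \<longrightarrow>
       (betti (coordinate_module X) 1 (i, j) > 0 \<longleftrightarrow> predicted_generator_degree X i j) \<and>
       (predicted_generator_degree X i j \<longrightarrow>
          int (betti (coordinate_module X) 1 (i, j)) = - diff_D (hilbert_matrix X) i j))"


section \<open>The Zariski topology on tuples of points and the conjecture\<close>

text \<open>Tuples of \<open>N\<close> points are extensional functions on \<open>{..<N}\<close>; the variable \<open>(l, v)\<close> is the
  coordinate \<open>v\<close> of the \<open>l\<close>-th point.\<close>

definition multihomogeneous :: "nat \<Rightarrow> (nat \<times> (2 + 3), 'k::field) mpoly \<Rightarrow> bool"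
  where "multihomogeneous N f \<longleftrightarrow>
    (\<exists>d. \<forall>m\<in>Poly_Mapping.keys f. fst ` Poly_Mapping.keys m \<subseteq> {..<N} \<and>
       (\<forall>l<N. ((\<Sum>i\<in>UNIV. Poly_Mapping.lookup m (l, Inl i)),
               (\<Sum>j\<in>UNIV. Poly_Mapping.lookup m (l, Inr j))) = d l))"

definition nonvanishing_locus ::
    "nat \<Rightarrow> (nat \<times> (2 + 3), 'k::field) mpoly \<Rightarrow> (nat \<Rightarrow> 'k point) set"
  where "nonvanishing_locus N f = {P \<in> {..<N} \<rightarrow>\<^sub>E UNIV.
    \<forall>a. (\<forall>l<N. a l \<in> coordinates (P l)) \<longrightarrow> eval_mpoly (\<lambda>(l, v). a l v) f \<noteq> 0}"

definition zariski_topology :: "nat \<Rightarrow> (nat \<Rightarrow> 'k::field point) topology"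
  where "zariski_topology N =
    topology_generated_by {nonvanishing_locus N f | f. multihomogeneous N f}"

definition weakened_MRC :: "'k::alg_closed_field itself \<Rightarrow> bool"
  where "weakened_MRC _ \<longleftrightarrow>
    (\<forall>N\<ge>2. \<exists>U :: (nat \<Rightarrow> 'k point) set.
       openin (zariski_topology N) U \<and>
       zariski_topology N closure_of U = topspace (zariski_topology N) \<and>
       (\<forall>P\<in>U. sufficiently_general_position (P ` {..<N})))"

end

theory Submission
  imports Defs "HOL-Library.Function_Algebras"
begin

text \<open>
  Everything is reduced to exactness of \<open>F/JF\<close> for ideals \<open>J\<close> generated by regular sequences of linear
  forms. Since \<open>\<Bbbk>\<close> is infinite, there are linear forms in the \<open>x\<close>- and in the \<open>y\<close>-variables that vanish
  at no point of \<open>X\<close>; these are nonzerodivisors on \<open>S/I\<^sub>X\<close>.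

  Adding a second \<open>x\<close>-form shows that \<open>F/\<langle>x\<rangle>F\<close> is exact in homological degrees \<open>\<ge> 2\<close>. It splits
  by \<open>x\<close>-degree into minimal complexes over \<open>\<Bbbk>[y]\<close>, so every generator of \<open>F\<^sub>k\<close>, \<open>k \<ge> 2\<close>, lies over
  one of \<open>F\<^bsub>k-1\<^esub>\<close> of the same \<open>x\<close>-degree and smaller \<open>y\<close>-degree. With the degrees of the generators of
  \<open>I\<^sub>X\<close> known from general position and the alternating sum of Betti numbers known from the Hilbert
  matrix, this determines all summands of \<open>y\<close>-degree at most 2. Their \<open>x\<close>-degrees turn out to be at
  most \<open>N\<close>, so the virtual resolution of the pair consists of all summands of \<open>y\<close>-degree at most 2.

  In \<open>x\<close>-degrees \<open>\<ge> N - 1\<close> the Hilbert function of \<open>S/I\<^sub>X\<close> is constantly \<open>N\<close>, so the \<open>y\<close>-form acts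
  surjectively on \<open>S/I\<^sub>X\<close>, and \<open>F/\<langle>y\<rangle>F\<close> is exact in \<open>y\<close>-degrees \<open>\<ge> 3\<close>. Hence generators of
  \<open>y\<close>-degree \<open>\<ge> 3\<close> can be eliminated from preimages under the differential: the truncation is exact in
  \<open>x\<close>-degrees \<open>\<ge> N - 1\<close>. Its homology is therefore killed by the \<open>N\<close>-th power of the irrelevant
  ideal, and it resolves \<open>S/I\<^sub>X\<close> up to torsion.
\<close>

section \<open>Monomial ideals and linear forms\<close>

text \<open>Exactness modulo an ideal is recorded one bidegree at a time, because the y-form acts
  surjectively on S/I_X only in x-degree at least N - 1, and there only from y-degree 1 on. Each of
  the two further y-variables costs one more unit of y-degree; this is the origin of the bound 3,
  which matches the cut at y-degree 2. The linear forms are kept in the shape "variable plus a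
  remainder free of it", so that regularity follows by comparing top coefficients.

  Numerics alone do not settle the Betti numbers: the Hilbert matrix gives only the difference of
  the second and third Betti numbers in degree (N,2). A summand common to both is excluded by
  showing that the three syzygies of degree (N,1) already account for everything there. The
  condition N >= 12 guarantees 0 < q, q + 1 < q' and q' + 1 < N, so the jumps of the three rows of
  the Hilbert matrix occur at different places.\<close>

abbreviation lookup where "lookup \<equiv> Poly_Mapping.lookup"
abbreviation keys where "keys \<equiv> Poly_Mapping.keys"
abbreviation single where "single \<equiv> Poly_Mapping.single"

lemma keys_multE:
  assumes "m \<in> keys (f * g)"
  obtains a b where "m = a + b" "a \<in> keys f" "b \<in> keys g"
  using keys_mult[of f g] assms by auto

lemma poly_sum_single: "(\<Sum>m\<in>keys p. single m (lookup p m)) = p"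
proof (rule poly_mapping_eqI)
  fix k
  have "(\<Sum>m\<in>keys p. lookup (single m (lookup p m)) k) = (\<Sum>m\<in>keys p. if m = k then lookup p m else 0)"
    by (rule sum.cong) (auto simp: lookup_single when_def)
  then show "lookup (\<Sum>m\<in>keys p. single m (lookup p m)) k = lookup p k"
    by (simp add: lookup_sum in_keys_iff)
qed

lemma lookup_single_times:
  fixes m :: "'a::cancel_comm_monoid_add"
  shows "lookup (single m c * p) (m + n) = c * lookup p n"
proof -
  have "single m c * p = (\<Sum>k\<in>keys p. single (m + k) (c * lookup p k))"
    by (subst poly_sum_single[of p, symmetric]) (simp add: sum_distrib_left mult_single)
  then have "lookup (single m c * p) (m + n)
      = (\<Sum>k\<in>keys p. if k = n then c * lookup p k else 0)"
    by (auto simp: lookup_sum lookup_single when_def intro!: sum.cong)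
  then show ?thesis by (simp add: in_keys_iff)
qed

lemma lookup_mconst_times [simp]: "lookup (mconst c * p) m = c * lookup p m"
  using lookup_single_times[of 0 c p m] by (simp add: mconst_def)

text \<open>The ideal generated by the variables in \<open>W\<close>, given by its monomials so that
  membership and homogeneous components can be read off from exponents.\<close>

definition mono_ideal :: "'v set \<Rightarrow> ('v, 'k::comm_ring_1) mpoly set"
  where "mono_ideal W = {p. \<forall>m\<in>keys p. \<exists>w\<in>W. lookup m w > 0}"

text \<open>Ideals over the type class, where sums and products need no carrier. The passage to
  ideals of the record \<open>cox_ring\<close> is made by \<open>is_ideal_imp_ideal\<close> and
  \<open>ideal_imp_is_ideal\<close>.\<close>

definition is_ideal :: "'r::comm_ring_1 set \<Rightarrow> bool"
  where "is_ideal J \<longleftrightarrow> 0 \<in> J \<and> (\<forall>p\<in>J. \<forall>q\<in>J. p + q \<in> J) \<and> (\<forall>p\<in>J. \<forall>r. r * p \<in> J)"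

lemma is_ideal_sum: "is_ideal J \<Longrightarrow> (\<And>i. i \<in> A \<Longrightarrow> f i \<in> J) \<Longrightarrow> sum f A \<in> J"
  by (induction A rule: infinite_finite_induct) (auto simp: is_ideal_def)

lemma is_ideal_add: "is_ideal J \<Longrightarrow> p \<in> J \<Longrightarrow> q \<in> J \<Longrightarrow> p + q \<in> J"
  by (auto simp: is_ideal_def)

lemma is_ideal_mult: "is_ideal J \<Longrightarrow> p \<in> J \<Longrightarrow> r * p \<in> J"
  by (auto simp: is_ideal_def)

lemma is_ideal_0: "is_ideal J \<Longrightarrow> 0 \<in> J"
  by (auto simp: is_ideal_def)

lemma is_ideal_minus: "is_ideal J \<Longrightarrow> p \<in> J \<Longrightarrow> - p \<in> J"
  using is_ideal_mult[of J p "-1"] by simp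

lemma is_ideal_diff: "is_ideal J \<Longrightarrow> p \<in> J \<Longrightarrow> q \<in> J \<Longrightarrow> p - q \<in> J"
  using is_ideal_add[of J p "-q"] is_ideal_minus by fastforce

lemma is_ideal_mono_ideal: "is_ideal (mono_ideal W :: ('a, 'k::comm_ring_1) mpoly set)"
  unfolding is_ideal_def mono_ideal_def
proof (intro conjI ballI allI; clarsimp)
  fix p q :: "('a, 'k) mpoly" and m
  assume "\<forall>m\<in>keys p. \<exists>w\<in>W. lookup m w > 0" "\<forall>m\<in>keys q. \<exists>w\<in>W. lookup m w > 0" "m \<in> keys (p + q)"
  then show "\<exists>w\<in>W. lookup m w > 0" using keys_add[of p q] by blast
next
  fix p r :: "('a, 'k) mpoly" and m
  assume *: "\<forall>m\<in>keys p. \<exists>w\<in>W. lookup m w > 0" "m \<in> keys (r * p)"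
  then obtain a b where "m = a + b" "b \<in> keys p" by (elim keys_multE)
  moreover from this obtain w where "w \<in> W" "lookup b w > 0" using * by blast
  ultimately show "\<exists>w\<in>W. lookup m w > 0" by (auto simp: lookup_add)
qed

lemma mono_ideal_empty [simp]: "mono_ideal {} = {0}"
  by (auto simp: mono_ideal_def)

lemma mono_ideal_mono: "V \<subseteq> W \<Longrightarrow> mono_ideal V \<subseteq> mono_ideal W"
  by (fastforce simp: mono_ideal_def)

lemma keys_mvar [simp]: "keys (mvar v :: ('v, 'k::comm_ring_1) mpoly) = {single v 1}"
  by (simp add: mvar_def)

lemma mvar_times_mono_ideal: "w \<in> W \<Longrightarrow> mvar w * p \<in> mono_ideal W"
  by (subst mult.commute, rule is_ideal_mult[OF is_ideal_mono_ideal])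
    (auto simp: mono_ideal_def intro!: bexI[of _ w])

text \<open>The monomials divisible by \<open>w\<close> are divided by \<open>w\<close> to form
  \<open>h'\<close>; each remaining monomial must contain a variable of \<open>W\<close>.\<close>

lemma mono_ideal_insertE:
  assumes "h \<in> mono_ideal (insert w W)"
  obtains h' where "h - mvar w * h' \<in> mono_ideal W"
proof -
  define A where "A = {m \<in> keys h. lookup m w > 0}"
  define h' where "h' = (\<Sum>m\<in>A. single (m - single w 1) (lookup h m))"
  have eq: "single w 1 + (m - single w 1) = m" if "m \<in> A" for m
    using that by (intro poly_mapping_eqI) (auto simp: A_def lookup_add lookup_minus lookup_single when_def)
  have "mvar w * h' = (\<Sum>m\<in>A. single m (lookup h m))"
    unfolding h'_def mvar_def sum_distrib_left
    by (rule sum.cong) (use eq in \<open>auto simp: mult_single\<close>)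
  moreover have "h = (\<Sum>m\<in>keys h - A. single m (lookup h m)) + (\<Sum>m\<in>A. single m (lookup h m))"
    by (subst (1) poly_sum_single[of h, symmetric], rule sum.subset_diff) (auto simp: A_def)
  ultimately have "h - mvar w * h' = (\<Sum>m\<in>keys h - A. single m (lookup h m))"
    by (metis add_diff_cancel_right')
  moreover have "single m (lookup h m) \<in> mono_ideal W" if "m \<in> keys h - A" for m
    using that assms by (auto simp: mono_ideal_def A_def)
  ultimately have "h - mvar w * h' \<in> mono_ideal W"
    using is_ideal_sum[OF is_ideal_mono_ideal] by metis
  then show ?thesis by (rule that)
qed

lemma mono_ideal_cancel_mvar:
  assumes "mvar w * g \<in> mono_ideal W" "w \<notin> W"
  shows "g \<in> mono_ideal W"
  unfolding mono_ideal_def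
proof clarsimp
  fix m assume "m \<in> keys g"
  then have "single w 1 + m \<in> keys (mvar w * g)"
    by (simp add: in_keys_iff mvar_def lookup_single_times)
  then obtain v where "v \<in> W" "lookup (single w 1 + m) v > 0"
    using assms(1) unfolding mono_ideal_def by blast
  moreover have "v \<noteq> w" using \<open>v \<in> W\<close> assms(2) by auto
  ultimately show "\<exists>w\<in>W. lookup m w > 0" by (auto simp: lookup_add lookup_single when_def)
qed

text \<open>The top coefficients of \<open>h\<close> with respect to \<open>v\<close> survive in the product.\<close>

lemma mono_ideal_cancel_monic:
  assumes "(mvar v + r) * h \<in> mono_ideal W" "v \<notin> W" and r: "\<And>n. n \<in> keys r \<Longrightarrow> lookup n v = 0"
  shows "h \<in> mono_ideal W"
proof (rule ccontr)
  define A where "A = {m \<in> keys h. \<forall>w\<in>W. lookup m w = 0}"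
  assume "h \<notin> mono_ideal W"
  then have "A \<noteq> {}" by (auto simp: A_def mono_ideal_def)
  moreover have "finite A" by (simp add: A_def)
  ultimately obtain m where m: "m \<in> A" and max: "\<And>b. b \<in> A \<Longrightarrow> lookup b v \<le> lookup m v"
    using Max_in[of "(\<lambda>m. lookup m v) ` A"] Max_ge[of "(\<lambda>m. lookup m v) ` A"]
    by (smt (verit) finite_imageI image_iff image_is_empty)
  define n where "n = single v 1 + m"
  have nW: "lookup n w = 0" if "w \<in> W" for w
    using that m assms(2) by (auto simp: n_def A_def lookup_add lookup_single when_def)
  \<comment> \<open>A contribution of \<open>r\<close> would come from a monomial of
    \<open>A\<close> whose exponent of \<open>v\<close> is one larger than the maximal one.\<close>
  have "lookup (r * h) n = 0"
  proof (rule ccontr)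
    assume "\<not> ?thesis"
    then have "n \<in> keys (r * h)" by (simp add: in_keys_iff)
    then obtain a b where ab: "n = a + b" "a \<in> keys r" "b \<in> keys h" by (rule keys_multE)
    have "lookup b w = 0" if "w \<in> W" for w
      using nW[OF that] by (simp add: ab lookup_add)
    then have "b \<in> A" by (simp add: A_def ab)
    moreover have "lookup b v = lookup n v" using r[OF ab(2)] by (simp add: ab lookup_add)
    ultimately show False using max[of b] by (simp add: n_def lookup_add)
  qed
  then have "lookup ((mvar v + r) * h) n = lookup h m"
    by (simp add: distrib_right lookup_add mvar_def n_def lookup_single_times)
  then have "n \<in> keys ((mvar v + r) * h)" using m by (simp add: A_def in_keys_iff)
  then obtain w where "w \<in> W" "lookup n w > 0" using assms(1) by (auto simp: mono_ideal_def)
  then show False using nW by simp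
qed

section \<open>Nonzerodivisors modulo an ideal, and adjoining one generator to it\<close>

definition addgen :: "'r::comm_ring_1 set \<Rightarrow> 'r \<Rightarrow> 'r set"
  where "addgen J s = {p. \<exists>g. p - s * g \<in> J}"

definition nzd :: "'r::comm_ring_1 set \<Rightarrow> 'r \<Rightarrow> bool"
  where "nzd J s \<longleftrightarrow> (\<forall>g. s * g \<in> J \<longrightarrow> g \<in> J)"

lemma is_ideal_addgen:
  assumes "is_ideal J"
  shows "is_ideal (addgen J s)"
  unfolding is_ideal_def addgen_def
proof (intro conjI ballI allI; clarsimp)
  show "\<exists>g. - (s * g) \<in> J" using is_ideal_0[OF assms] by (intro exI[of _ 0]) simp
next
  fix p q g h assume "p - s * g \<in> J" "q - s * h \<in> J"
  then have "(p - s * g) + (q - s * h) \<in> J" by (rule is_ideal_add[OF assms])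
  then show "\<exists>g. p + q - s * g \<in> J" by (intro exI[of _ "g + h"]) (simp add: algebra_simps)
next
  fix p r g assume "p - s * g \<in> J"
  then have "r * (p - s * g) \<in> J" by (rule is_ideal_mult[OF assms])
  then show "\<exists>g. r * p - s * g \<in> J" by (intro exI[of _ "r * g"]) (simp add: algebra_simps)
qed

text \<open>If \<open>mvar w * g\<close> equals \<open>(mvar v + r) * h\<close> modulo
  \<open>W\<close>, then that product vanishes modulo \<open>W\<close> together with
  \<open>w\<close>. There the linear form is still regular, so \<open>h\<close> is a multiple of
  \<open>mvar w\<close> modulo \<open>W\<close>, and \<open>mvar w\<close> can be cancelled from
  both sides.\<close>

lemma nzd_addgen_mono_ideal:
  assumes "w \<notin> W" "v \<noteq> w" "v \<notin> W" "\<And>n. n \<in> keys r \<Longrightarrow> lookup n v = 0"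
  shows "nzd (addgen (mono_ideal W) (mvar v + r)) (mvar w)"
  unfolding nzd_def addgen_def
proof (intro allI impI; clarsimp)
  fix g h assume gh: "mvar w * g - (mvar v + r) * h \<in> mono_ideal W"
  have "(mvar v + r) * h = mvar w * g - (mvar w * g - (mvar v + r) * h)" by simp
  also have "\<dots> \<in> mono_ideal (insert w W)"
    by (rule is_ideal_diff[OF is_ideal_mono_ideal mvar_times_mono_ideal])
      (use gh mono_ideal_mono[of W "insert w W"] in auto)
  finally have "(mvar v + r) * h \<in> mono_ideal (insert w W)" .
  then have "h \<in> mono_ideal (insert w W)"
    by (rule mono_ideal_cancel_monic) (use assms in auto)
  then obtain h' where h': "h - mvar w * h' \<in> mono_ideal W" by (rule mono_ideal_insertE)
  have "(mvar w * g - (mvar v + r) * h) + (mvar v + r) * (h - mvar w * h') \<in> mono_ideal W"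
    using gh h' by (intro is_ideal_add is_ideal_mult is_ideal_mono_ideal) auto
  then have "mvar w * (g - (mvar v + r) * h') \<in> mono_ideal W" by (simp add: algebra_simps)
  then show "\<exists>h. g - (mvar v + r) * h \<in> mono_ideal W"
    using assms(1) by (auto intro: mono_ideal_cancel_mvar)
qed

text \<open>Adjoining the variable before or after \<open>s\<close> gives the same ideal, so
  iterated quotients keep the form covered by \<open>nzd_addgen_mono_ideal\<close>.\<close>

lemma addgen_addgen_mono_ideal:
  "addgen (addgen (mono_ideal W) s) (mvar w) = addgen (mono_ideal (insert w W)) s"
proof (intro Set.set_eqI iffI)
  fix p assume "p \<in> addgen (addgen (mono_ideal W) s) (mvar w)"
  then obtain g h where gh: "p - mvar w * g - s * h \<in> mono_ideal W" by (auto simp: addgen_def)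
  have "(p - mvar w * g - s * h) + mvar w * g \<in> mono_ideal (insert w W)"
    using gh mono_ideal_mono[of W "insert w W"]
    by (intro is_ideal_add is_ideal_mono_ideal mvar_times_mono_ideal) auto
  then show "p \<in> addgen (mono_ideal (insert w W)) s" by (auto simp: addgen_def)
next
  fix p assume "p \<in> addgen (mono_ideal (insert w W)) s"
  then obtain h where "p - s * h \<in> mono_ideal (insert w W)" by (auto simp: addgen_def)
  then obtain g where "p - s * h - mvar w * g \<in> mono_ideal W" by (rule mono_ideal_insertE)
  then have "p - mvar w * g - s * h \<in> mono_ideal W" by (simp add: algebra_simps)
  then show "p \<in> addgen (addgen (mono_ideal W) s) (mvar w)" by (auto simp: addgen_def)
qed

text \<open>Once the remainder \<open>r\<close> lies in the ideal of \<open>W\<close>, the linear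
  form acts as its leading variable. This turns the last quotient into one by a plain monomial
  ideal.\<close>

lemma addgen_mono_ideal_mvar:
  fixes r :: "('v, 'k::comm_ring_1) mpoly"
  assumes "r \<in> mono_ideal W"
  shows "addgen (mono_ideal W) (mvar v + r) = mono_ideal (insert v W)"
proof (intro Set.set_eqI iffI)
  note [intro] = is_ideal_mono_ideal is_ideal_add is_ideal_mult is_ideal_diff
  fix p :: "('v, 'k) mpoly" assume "p \<in> addgen (mono_ideal W) (mvar v + r)"
  then obtain g where "p - (mvar v + r) * g \<in> mono_ideal W" by (auto simp: addgen_def)
  then have "p - (mvar v + r) * g + g * r \<in> mono_ideal W" using assms by blast
  then have "p - mvar v * g \<in> mono_ideal (insert v W)"
    using mono_ideal_mono[of W "insert v W"] by (auto simp: algebra_simps)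
  then have "(p - mvar v * g) + mvar v * g \<in> mono_ideal (insert v W)"
    by (intro is_ideal_add is_ideal_mono_ideal mvar_times_mono_ideal) auto
  then show "p \<in> mono_ideal (insert v W)" by simp
next
  fix p :: "('v, 'k) mpoly" assume "p \<in> mono_ideal (insert v W)"
  then obtain g where "p - mvar v * g \<in> mono_ideal W" by (rule mono_ideal_insertE)
  then have "p - mvar v * g - g * r \<in> mono_ideal W"
    using assms is_ideal_mono_ideal is_ideal_diff is_ideal_mult by blast
  then show "p \<in> addgen (mono_ideal W) (mvar v + r)"
    by (auto simp: addgen_def algebra_simps intro!: exI[of _ g])
qed

section \<open>Homogeneous components\<close>

lemma bideg_add: "bideg (m + n) = bideg m + bideg n"
  by (simp add: bideg_def lookup_add sum.distrib)

lemma bideg_0 [simp]: "bideg 0 = 0"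
  by (simp add: bideg_def zero_prod_def)

lemma bideg_nonneg: "0 \<le> bideg m"
  by (auto simp: bideg_def less_eq_prod_def zero_prod_def intro: sum_nonneg)

lemma bideg_x [simp]: "bideg (single (Inl i) (Suc 0)) = (1, 0)"
proof -
  have "int (lookup (single (Inl i :: 2 + 3) (Suc 0)) (Inl i')) = (if i' = i then 1 else 0)" for i'
    by (auto simp: lookup_single when_def)
  then show ?thesis by (simp add: bideg_def) (simp add: lookup_single)
qed

lemma bideg_y [simp]: "bideg (single (Inr j) (Suc 0)) = (0, 1)"
proof -
  have "int (lookup (single (Inr j :: 2 + 3) (Suc 0)) (Inr j')) = (if j' = j then 1 else 0)" for j'
    by (auto simp: lookup_single when_def)
  then show ?thesis by (simp add: bideg_def) (simp add: lookup_single)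
qed

lemma mem_cox_comp: "p \<in> cox_comp d \<longleftrightarrow> (\<forall>m. lookup p m \<noteq> 0 \<longrightarrow> bideg m = d)"
  by (auto simp: cox_comp_def in_keys_iff)

lemma cox_comp_0 [simp]: "0 \<in> cox_comp d"
  by (simp add: cox_comp_def)

lemma cox_comp_add: "p \<in> cox_comp d \<Longrightarrow> q \<in> cox_comp d \<Longrightarrow> p + q \<in> cox_comp d"
  by (auto simp: mem_cox_comp lookup_add) (metis add_0)

lemma cox_comp_diff: "p \<in> cox_comp d \<Longrightarrow> q \<in> cox_comp d \<Longrightarrow> p - q \<in> cox_comp d"
  by (auto simp: mem_cox_comp lookup_minus) (metis diff_0_right)

lemma cox_comp_sum: "(\<And>i. i \<in> A \<Longrightarrow> f i \<in> cox_comp d) \<Longrightarrow> sum f A \<in> cox_comp d"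
  by (induction A rule: infinite_finite_induct) (auto simp: cox_comp_add)

lemma cox_comp_mult: "p \<in> cox_comp d \<Longrightarrow> q \<in> cox_comp e \<Longrightarrow> p * q \<in> cox_comp (d + e)"
  by (auto simp: cox_comp_def bideg_add elim!: keys_multE)

lemma cox_comp_mconst [simp]: "mconst c \<in> cox_comp 0"
  by (auto simp: cox_comp_def mconst_def)

lemma cox_comp_1 [simp]: "1 \<in> cox_comp 0"
  by (auto simp: cox_comp_def)

lemma cox_comp_mconst_mult: "p \<in> cox_comp d \<Longrightarrow> mconst c * p \<in> cox_comp d"
  using cox_comp_mult[OF cox_comp_mconst] by simp

lemma cox_comp_x [simp]: "mvar (Inl i) \<in> cox_comp (1, 0)"
  by (simp add: cox_comp_def)

lemma cox_comp_y [simp]: "mvar (Inr i) \<in> cox_comp (0, 1)"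
  by (simp add: cox_comp_def)

lemma cox_comp_eq_0: "p \<in> cox_comp d \<Longrightarrow> \<not> 0 \<le> d \<Longrightarrow> p = 0"
  using bideg_nonneg by (intro poly_mapping_eqI) (auto simp: mem_cox_comp)

definition hc :: "int \<times> int \<Rightarrow> 'k::comm_ring_1 cox \<Rightarrow> 'k cox"
  where "hc d p = (\<Sum>m | m \<in> keys p \<and> bideg m = d. single m (lookup p m))"

lemma lookup_hc: "lookup (hc d p) m = (if bideg m = d then lookup p m else 0)"
proof -
  have "lookup (hc d p) m = (\<Sum>k | k \<in> keys p \<and> bideg k = d. if k = m then lookup p k else 0)"
    by (auto simp: hc_def lookup_sum lookup_single when_def intro: sum.cong)
  then show ?thesis by (auto simp: in_keys_iff)
qed

lemma hc_in_cox_comp [simp]: "hc d p \<in> cox_comp d"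
  by (auto simp: mem_cox_comp lookup_hc)

lemma hc_0 [simp]: "hc d 0 = 0"
  by (simp add: hc_def)

lemma hc_add: "hc d (p + q) = hc d p + hc d q"
  by (rule poly_mapping_eqI) (simp add: lookup_hc lookup_add)

lemma hc_diff: "hc d (p - q) = hc d p - hc d q"
  by (rule poly_mapping_eqI) (simp add: lookup_hc lookup_minus)

lemma hc_sum: "hc d (sum f A) = (\<Sum>i\<in>A. hc d (f i))"
  by (induction A rule: infinite_finite_induct) (auto simp: hc_add)

lemma hc_homogeneous: "p \<in> cox_comp e \<Longrightarrow> hc d p = (if d = e then p else 0)"
  by (rule poly_mapping_eqI) (auto simp: lookup_hc mem_cox_comp)

lemma hc_id [simp]: "p \<in> cox_comp d \<Longrightarrow> hc d p = p"
  by (simp add: hc_homogeneous)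

text \<open>Without its component of degree \<open>d - e\<close>, the factor \<open>p\<close> has no
  monomial that a homogeneous \<open>s\<close> of degree \<open>e\<close> could move into degree
  \<open>d\<close>.\<close>

lemma hc_mult:
  assumes "s \<in> cox_comp e"
  shows "hc d (s * p) = s * hc (d - e) p"
proof -
  have "s * (p - hc (d - e) p) = s * p - s * hc (d - e) p" by (simp add: algebra_simps)
  moreover have "hc d (s * (p - hc (d - e) p)) = 0"
  proof (rule poly_mapping_eqI, rule ccontr)
    fix m
    assume "lookup (hc d (s * (p - hc (d - e) p))) m \<noteq> lookup 0 m"
    then have m: "bideg m = d" "m \<in> keys (s * (p - hc (d - e) p))"
      by (auto simp: lookup_hc in_keys_iff split: if_splits)
    then obtain a b where ab: "m = a + b" "a \<in> keys s" "b \<in> keys (p - hc (d - e) p)"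
      by (elim keys_multE)
    then have "bideg a = e" "bideg b \<noteq> d - e"
      using assms by (auto simp: cox_comp_def in_keys_iff lookup_minus lookup_hc)
    then show False using m(1) ab(1) by (auto simp: bideg_add)
  qed
  moreover have "s * hc (d - e) p \<in> cox_comp d"
    using cox_comp_mult[OF assms hc_in_cox_comp[of "d - e" p]] by simp
  ultimately show ?thesis using hc_diff[of d "s * p" "s * hc (d - e) p"] by simp
qed

lemma sum_hc:
  assumes "finite D" "bideg ` keys p \<subseteq> D"
  shows "(\<Sum>d\<in>D. hc d p) = p"
proof (rule poly_mapping_eqI)
  fix m
  have "lookup (\<Sum>d\<in>D. hc d p) m = (\<Sum>d\<in>D. if d = bideg m then lookup p m else 0)"
    by (auto simp: lookup_sum lookup_hc intro: sum.cong)
  also have "\<dots> = lookup p m"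
    using assms by (auto simp: in_keys_iff image_subset_iff)
  finally show "lookup (\<Sum>d\<in>D. hc d p) m = lookup p m" .
qed

lemma hc_mono_ideal: "p \<in> mono_ideal W \<Longrightarrow> hc d p \<in> mono_ideal W"
  by (auto simp: mono_ideal_def in_keys_iff lookup_hc split: if_splits)

lemma hc_addgen:
  assumes "\<And>p d. p \<in> J \<Longrightarrow> hc d p \<in> J" "s \<in> cox_comp e" "p \<in> addgen J s"
  shows "hc d p \<in> addgen J s"
proof -
  obtain g where "p - s * g \<in> J" using assms(3) by (auto simp: addgen_def)
  then have "hc d (p - s * g) \<in> J" using assms by blast
  then show ?thesis by (auto simp: hc_diff hc_mult[OF assms(2)] addgen_def)
qed

lemma cox_comp_mono_ideal_x:
  assumes "p \<in> cox_comp d" "fst d > 0"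
  shows "p \<in> mono_ideal (range Inl)"
  unfolding mono_ideal_def
proof clarsimp
  fix m assume "m \<in> keys p"
  then have "(\<Sum>i\<in>UNIV. int (lookup m (Inl i))) > 0" using assms by (auto simp: cox_comp_def bideg_def)
  then show "\<exists>i. 0 < lookup m (Inl i)"
    by (rule contrapos_pp) auto
qed

lemma cox_comp_mono_ideal_y:
  assumes "p \<in> cox_comp d" "snd d > 0"
  shows "p \<in> mono_ideal (range Inr)"
  unfolding mono_ideal_def
proof clarsimp
  fix m assume "m \<in> keys p"
  then have "(\<Sum>i\<in>UNIV. int (lookup m (Inr i))) > 0" using assms by (auto simp: cox_comp_def bideg_def)
  then show "\<exists>i. 0 < lookup m (Inr i)"
    by (rule contrapos_pp) auto
qed

text \<open>In y-degree 0 a congruence modulo the y-variables is an equality; the truncation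
  argument ends with this.\<close>

lemma mono_ideal_y_eq_0:
  assumes "p \<in> cox_comp d" "snd d = 0" "p \<in> mono_ideal (range Inr)"
  shows "p = 0"
proof (rule ccontr)
  assume "p \<noteq> 0"
  then obtain m where m: "m \<in> keys p" by (metis keys_eq_empty ex_in_conv poly_mapping_eqI in_keys_iff lookup_zero)
  then obtain i where i: "lookup m (Inr i) > 0" using assms(3) by (auto simp: mono_ideal_def)
  have "(\<Sum>i\<in>UNIV. int (lookup m (Inr i))) = 0" using m assms by (auto simp: cox_comp_def bideg_def)
  then show False using i by (subst (asm) sum_nonneg_eq_0_iff) auto
qed

lemma bideg_eq_0: "bideg m = 0 \<Longrightarrow> m = 0"
proof (rule poly_mapping_eqI)
  fix v assume "bideg m = 0"
  then have "(\<Sum>i\<in>UNIV. int (lookup m (Inl i))) = 0" "(\<Sum>i\<in>UNIV. int (lookup m (Inr i))) = 0"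
    by (auto simp: bideg_def zero_prod_def)
  then have "\<And>i. lookup m (Inl i) = 0" "\<And>i. lookup m (Inr i) = 0"
    by (auto simp: sum_nonneg_eq_0_iff)
  then show "lookup m v = lookup 0 v" by (cases v) auto
qed

lemma cox_comp_degree_0: "p \<in> cox_comp 0 \<Longrightarrow> p = mconst (lookup p 0)"
  by (rule poly_mapping_eqI) (auto simp: mem_cox_comp mconst_def lookup_single when_def bideg_eq_0)

section \<open>Ideals of the Cox ring\<close>

lemma cox_ring_simps [simp]:
  "carrier cox_ring = UNIV" "mult cox_ring = (*)" "one cox_ring = 1"
  "ring.zero cox_ring = 0" "add cox_ring = (+)"
  by (simp_all add: cox_ring_def)

lemma cring_cox_ring: "cring (cox_ring :: 'k::comm_ring_1 cox ring)"
proof (rule cringI)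
  show "abelian_group (cox_ring :: 'k cox ring)"
    by (rule abelian_groupI) (auto simp: add.assoc add.commute intro: exI[of _ "- _"] add.right_inverse)
  show "Group.comm_monoid (cox_ring :: 'k cox ring)"
    by (rule comm_monoidI) (auto simp: mult.assoc mult.commute)
qed (auto simp: distrib_right)

interpretation cox: cring "cox_ring :: 'k::comm_ring_1 cox ring"
  by (rule cring_cox_ring)

lemma is_ideal_imp_ideal:
  assumes "is_ideal (J :: 'k::comm_ring_1 cox set)"
  shows "ideal J cox_ring"
proof (rule idealI)
  show "subgroup J (add_monoid cox_ring)"
  proof (rule cox.add.subgroupI)
    show "J \<noteq> {}" using is_ideal_0[OF assms] by auto
    fix a assume a: "a \<in> J"
    have "\<ominus>\<^bsub>cox_ring\<^esub> a = - a"
      by (rule cox.minus_equality) auto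
    then show "\<ominus>\<^bsub>cox_ring\<^esub> a \<in> J"
      using is_ideal_minus[OF assms a] by metis
  qed (auto intro: is_ideal_add[OF assms])
next
  fix a x assume "a \<in> J"
  then show "x \<otimes>\<^bsub>cox_ring\<^esub> a \<in> J" "a \<otimes>\<^bsub>cox_ring\<^esub> x \<in> J"
    using is_ideal_mult[OF assms, of a x] by (simp_all add: mult.commute)
qed (rule cox.ring_axioms)

lemma ideal_imp_is_ideal:
  assumes "ideal J (cox_ring :: 'k::comm_ring_1 cox ring)"
  shows "is_ideal J"
proof -
  interpret ideal J cox_ring by (rule assms)
  show ?thesis using a_closed zero_closed I_l_closed by (auto simp: is_ideal_def)
qed

lemma is_ideal_genideal: "is_ideal (genideal (cox_ring :: 'k::comm_ring_1 cox ring) A)"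
  by (intro ideal_imp_is_ideal cox.genideal_ideal) auto

lemma genideal_subset:
  "is_ideal J \<Longrightarrow> A \<subseteq> J \<Longrightarrow> genideal (cox_ring :: 'k::comm_ring_1 cox ring) A \<subseteq> J"
  by (intro cox.genideal_minimal is_ideal_imp_ideal)

lemma mem_genideal: "a \<in> A \<Longrightarrow> a \<in> genideal (cox_ring :: 'k::comm_ring_1 cox ring) A"
  using cox.genideal_self[of A] by auto

lemma mono_ideal_lookup_0:
  assumes "p \<in> mono_ideal W"
  shows "lookup p 0 = 0"
proof (rule ccontr)
  assume "lookup p 0 \<noteq> 0"
  then have "0 \<in> keys p" by (simp add: in_keys_iff)
  then show False using assms by (auto simp: mono_ideal_def)
qed

lemma maximal_ideal_lookup_0:
  assumes "p \<in> maximal_ideal"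
  shows "lookup p 0 = 0"
proof -
  have "mvar v \<in> (mono_ideal UNIV :: 'a cox set)" for v
    using mvar_times_mono_ideal[OF UNIV_I, of v 1] unfolding mult_1_right .
  then have "range mvar \<subseteq> (mono_ideal UNIV :: 'a cox set)" by (rule image_subsetI)
  then have "p \<in> mono_ideal UNIV"
    using subsetD[OF genideal_subset[OF is_ideal_mono_ideal]] assms unfolding maximal_ideal_def by blast
  then show ?thesis by (rule mono_ideal_lookup_0)
qed

text \<open>Minus its constant term, \<open>p\<close> lies in the ideal of all variables, and so
  does that remainder times \<open>q\<close>.\<close>

lemma lookup_mult_0: "lookup (p * q :: 'k::comm_ring_1 cox) 0 = lookup p 0 * lookup q 0"
proof -
  have "p - mconst (lookup p 0) \<in> mono_ideal UNIV"
    unfolding mono_ideal_def mem_Collect_eq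
  proof
    fix m assume "m \<in> keys (p - mconst (lookup p 0))"
    then have "m \<noteq> 0" by (auto simp: in_keys_iff lookup_minus mconst_def)
    then obtain v where "lookup m v \<noteq> 0" using poly_mapping_eqI[of m 0] by auto
    then show "\<exists>w\<in>UNIV. 0 < lookup m w" by auto
  qed
  then have "q * (p - mconst (lookup p 0)) \<in> mono_ideal UNIV"
    by (intro is_ideal_mult is_ideal_mono_ideal)
  moreover have "q * (p - mconst (lookup p 0)) = p * q - mconst (lookup p 0) * q"
    by (simp add: right_diff_distrib mult.commute)
  ultimately have "lookup (p * q - mconst (lookup p 0) * q) 0 = 0"
    by (metis mono_ideal_lookup_0)
  then show ?thesis by (simp add: lookup_minus)
qed

section \<open>Complexes of graded free modules\<close>

abbreviation elems :: "'k::field gcomplex \<Rightarrow> nat \<Rightarrow> (nat \<Rightarrow> 'k cox) set"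
  where "elems F i \<equiv> carrier (free_gmodule F i)"

abbreviation elems_deg :: "'k::field gcomplex \<Rightarrow> nat \<Rightarrow> int \<times> int \<Rightarrow> (nat \<Rightarrow> 'k cox) set"
  where "elems_deg F i \<equiv> gcomp (free_gmodule F i)"

definition smf :: "'r::comm_ring_1 \<Rightarrow> (nat \<Rightarrow> 'r) \<Rightarrow> nat \<Rightarrow> 'r"
  where "smf s u = (\<lambda>b. s * u b)"

definition bas :: "nat \<Rightarrow> nat \<Rightarrow> 'k::comm_ring_1 cox"
  where "bas c = (\<lambda>b. if b = c then 1 else 0)"

lemma smf_apply [simp]: "smf s u b = s * u b"
  by (simp add: smf_def)

lemma sum_fun_apply [simp]: "(sum f A) b = (\<Sum>i\<in>A. f i b)"
  by (induction A rule: infinite_finite_induct) (simp_all add: zero_fun_def)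

lemma mem_elems: "u \<in> elems F i \<longleftrightarrow> (\<forall>b. b \<notin> gens F i \<longrightarrow> u b = 0)"
  by (simp add: free_gmodule_def)

lemma mem_elems_deg:
  "u \<in> elems_deg F i d \<longleftrightarrow> u \<in> elems F i \<and> (\<forall>b. u b \<in> cox_comp (d - gdeg F i b))"
  by (auto simp: free_gmodule_def)

lemma elems_deg_elems: "u \<in> elems_deg F i d \<Longrightarrow> u \<in> elems F i"
  by (simp add: mem_elems_deg)

lemma elems_degD: "u \<in> elems_deg F i d \<Longrightarrow> u b \<in> cox_comp (d - gdeg F i b)"
  by (simp add: mem_elems_deg)

lemma elems_add: "u \<in> elems F i \<Longrightarrow> v \<in> elems F i \<Longrightarrow> u + v \<in> elems F i"
  by (simp add: mem_elems)

lemma elems_diff: "u \<in> elems F i \<Longrightarrow> v \<in> elems F i \<Longrightarrow> u - v \<in> elems F i"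
  by (simp add: mem_elems)

lemma elems_smf: "u \<in> elems F i \<Longrightarrow> smf s u \<in> elems F i"
  by (simp add: mem_elems)

lemma elems_deg_add: "u \<in> elems_deg F i d \<Longrightarrow> v \<in> elems_deg F i d \<Longrightarrow> u + v \<in> elems_deg F i d"
  by (simp add: mem_elems_deg elems_add cox_comp_add)

lemma elems_deg_0: "0 \<in> elems_deg F i d"
  by (simp add: mem_elems_deg mem_elems)

lemma elems_deg_diff: "u \<in> elems_deg F i d \<Longrightarrow> v \<in> elems_deg F i d \<Longrightarrow> u - v \<in> elems_deg F i d"
  by (simp add: mem_elems_deg elems_diff cox_comp_diff)

lemma elems_deg_sum: "(\<And>a. a \<in> A \<Longrightarrow> f a \<in> elems_deg F i d) \<Longrightarrow> sum f A \<in> elems_deg F i d"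
  by (auto simp: mem_elems_deg mem_elems intro!: cox_comp_sum)

lemma elems_deg_smf:
  assumes "s \<in> cox_comp e" "u \<in> elems_deg F i (d - e)"
  shows "smf s u \<in> elems_deg F i d"
proof -
  have "s * u b \<in> cox_comp (d - gdeg F i b)" for b
    using cox_comp_mult[OF assms(1) elems_degD[OF assms(2), of b]] by (simp add: algebra_simps)
  then show ?thesis using assms(2) by (simp add: mem_elems_deg elems_smf)
qed

lemma bas_elems_deg: "c \<in> gens F i \<Longrightarrow> bas c \<in> elems_deg F i (gdeg F i c)"
  by (auto simp: mem_elems_deg mem_elems bas_def)

lemma differential_add: "differential F i (u + v) = differential F i u + differential F i v"
  by (rule ext) (simp add: differential_def sum.distrib distrib_left)

lemma differential_diff: "differential F i (u - v) = differential F i u - differential F i v"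
  by (rule ext) (simp add: differential_def sum_subtractf right_diff_distrib)

lemma differential_smf: "differential F i (smf s u) = smf s (differential F i u)"
  by (rule ext) (simp add: differential_def sum_distrib_left mult.left_commute)

lemma differential_0: "differential F i 0 = 0"
  by (rule ext) (simp add: differential_def)

lemma differential_sum: "differential F i (sum f A) = (\<Sum>a\<in>A. differential F i (f a))"
proof
  fix r
  show "differential F i (sum f A) r = (\<Sum>a\<in>A. differential F i (f a)) r"
    by (simp add: differential_def sum_distrib_left) (auto intro: sum.swap)
qed

lemma differential_elems [simp]: "differential F i u \<in> elems F i"
  by (auto simp: mem_elems differential_def)

lemma differential_ideal:
  assumes "is_ideal J" "\<And>c. u c \<in> J"
  shows "differential F i u r \<in> J"
  using assms by (auto simp: differential_def is_ideal_0 intro!: is_ideal_sum is_ideal_mult)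

definition hcf :: "'k::field gcomplex \<Rightarrow> nat \<Rightarrow> int \<times> int \<Rightarrow> (nat \<Rightarrow> 'k cox) \<Rightarrow> nat \<Rightarrow> 'k cox"
  where "hcf F i d u = (\<lambda>b. hc (d - gdeg F i b) (u b))"

lemma hcf_elems_deg: "u \<in> elems F i \<Longrightarrow> hcf F i d u \<in> elems_deg F i d"
  by (auto simp: mem_elems_deg mem_elems hcf_def)

lemma hcf_id: "u \<in> elems_deg F i d \<Longrightarrow> hcf F i d u = u"
  by (rule ext) (simp add: hcf_def elems_degD)

text \<open>Exactness of \<open>F/JF\<close> in homological degree \<open>k\<close> and internal degree \<open>d\<close>.\<close>

definition exact_mod :: "'k::field gcomplex \<Rightarrow> 'k cox set \<Rightarrow> nat \<Rightarrow> int \<times> int \<Rightarrow> bool"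
  where "exact_mod F J k d \<longleftrightarrow>
    (\<forall>v\<in>elems_deg F k d. (\<forall>k'. k = Suc k' \<longrightarrow> (\<forall>r. differential F k' v r \<in> J)) \<longrightarrow>
       (\<exists>w\<in>elems_deg F (Suc k) d. \<forall>r. v r - differential F k w r \<in> J))"

locale graded_cx =
  fixes F :: "'k::field gcomplex"
  assumes graded: "graded_free_complex F"
begin

lemma finite_gens [simp]: "finite (gens F i)"
  using graded by (simp add: graded_free_complex_def)

lemma dmat_deg:
  "r \<in> gens F i \<Longrightarrow> c \<in> gens F (Suc i) \<Longrightarrow> dmat F i r c \<in> cox_comp (gdeg F (Suc i) c - gdeg F i r)"
  using graded by (simp add: graded_free_complex_def)

lemma differential_differential:
  "u \<in> elems F (Suc (Suc i)) \<Longrightarrow> differential F i (differential F (Suc i) u) = 0"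
  using graded by (simp add: graded_free_complex_def zero_fun_def)

lemma differential_deg:
  assumes "u \<in> elems_deg F (Suc i) d"
  shows "differential F i u \<in> elems_deg F i d"
  unfolding mem_elems_deg
proof (intro conjI differential_elems allI)
  fix r
  have "dmat F i r c * u c \<in> cox_comp (d - gdeg F i r)" if "r \<in> gens F i" "c \<in> gens F (Suc i)" for c
    using cox_comp_mult[OF dmat_deg[OF that] elems_degD[OF assms, of c]] by simp
  then show "differential F i u r \<in> cox_comp (d - gdeg F i r)"
    by (auto simp: differential_def intro: cox_comp_sum)
qed

lemma differential_hcf: "differential F i (hcf F (Suc i) d u) = hcf F i d (differential F i u)"
proof
  fix r
  have "dmat F i r c * hc (d - gdeg F (Suc i) c) (u c) = hc (d - gdeg F i r) (dmat F i r c * u c)"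
    if "r \<in> gens F i" "c \<in> gens F (Suc i)" for c
    using hc_mult[OF dmat_deg[OF that], of "d - gdeg F i r"] by simp
  then show "differential F i (hcf F (Suc i) d u) r = hcf F i d (differential F i u) r"
    by (simp add: differential_def hcf_def hc_sum)
qed

lemma differential_bas:
  "c \<in> gens F (Suc i) \<Longrightarrow> differential F i (bas c) r = (if r \<in> gens F i then dmat F i r c else 0)"
  by (simp add: differential_def bas_def if_distrib cong: if_cong)

text \<open>The multipliers witnessing membership in \<open>addgen J s\<close> need be neither
  homogeneous nor supported on the generators; this is repaired by passing to components of the
  right degree.\<close>

lemma elems_deg_addgen_lift:
  assumes "v \<in> elems_deg F k d" "\<And>r. v r \<in> addgen J s" "s \<in> cox_comp e" "is_ideal J"
    "\<And>p d. p \<in> J \<Longrightarrow> hc d p \<in> J"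
  obtains u where "u \<in> elems_deg F k (d - e)" "\<And>r. v r - s * u r \<in> J"
proof -
  obtain g where g: "\<And>r. v r - s * g r \<in> J" using assms(2) unfolding addgen_def by (simp) metis
  define u where "u r = (if r \<in> gens F k then hc (d - e - gdeg F k r) (g r) else 0)" for r
  show ?thesis
  proof (rule that)
    show "u \<in> elems_deg F k (d - e)" by (auto simp: mem_elems_deg mem_elems u_def)
    fix r
    show "v r - s * u r \<in> J"
    proof (cases "r \<in> gens F k")
      case True
      have "hc (d - gdeg F k r) (v r - s * g r) \<in> J" using assms(5) g by blast
      then show ?thesis using True elems_degD[OF assms(1), of r]
        by (simp add: hc_diff hc_mult[OF assms(3)] u_def algebra_simps)
    next
      case False
      then show ?thesis using assms(1) is_ideal_0[OF assms(4)] by (simp add: mem_elems_deg mem_elems u_def)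
    qed
  qed
qed

text \<open>A cycle \<open>v\<close> modulo J + (s) has differential \<open>s * u\<close> modulo J.
  If \<open>u\<close> is the differential of \<open>z\<close>, then v - s z is a cycle modulo J and
  exactness modulo J applies. Whether \<open>u\<close> is a boundary is left to the premise
  \<open>aux\<close>, because this is answered differently when \<open>u\<close> lies in
  F_0.\<close>

lemma exact_mod_addgenI:
  assumes J: "is_ideal J" "\<And>p d. p \<in> J \<Longrightarrow> hc d p \<in> J" and s: "s \<in> cox_comp e"
    and ex: "exact_mod F J k d"
    and aux: "\<And>k' u v. k = Suc k' \<Longrightarrow> u \<in> elems_deg F k' (d - e) \<Longrightarrow> v \<in> elems_deg F k d \<Longrightarrow>
      (\<And>r. differential F k' v r - s * u r \<in> J) \<Longrightarrow>
      \<exists>z\<in>elems_deg F k (d - e). \<forall>r. u r - differential F k' z r \<in> J"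
  shows "exact_mod F (addgen J s) k d"
  unfolding exact_mod_def
proof (intro ballI impI)
  fix v assume v: "v \<in> elems_deg F k d"
    and dv: "\<forall>k'. k = Suc k' \<longrightarrow> (\<forall>r. differential F k' v r \<in> addgen J s)"
  obtain z where z: "z \<in> elems_deg F k (d - e)"
    and dz: "\<And>k' r. k = Suc k' \<Longrightarrow> differential F k' (v - smf s z) r \<in> J"
  proof (cases k)
    case 0
    then show ?thesis using that[of 0] by (simp add: elems_deg_0)
  next
    case (Suc k')
    have dvd: "differential F k' v \<in> elems_deg F k' d" using v Suc by (simp add: differential_deg)
    obtain u where u: "u \<in> elems_deg F k' (d - e)" "\<And>r. differential F k' v r - s * u r \<in> J"
      using elems_deg_addgen_lift[OF dvd _ s J] dv Suc by metis
    obtain z where z: "z \<in> elems_deg F k (d - e)" "\<And>r. u r - differential F k' z r \<in> J"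
      using aux[OF Suc u(1) v u(2)] by auto
    have "differential F k' (v - smf s z) r \<in> J" for r
      using is_ideal_add[OF J(1) u(2)[of r] is_ideal_mult[OF J(1) z(2)[of r], of s]]
      by (simp add: differential_diff differential_smf algebra_simps)
    then show ?thesis using that[of z] z Suc by auto
  qed
  have "v - smf s z \<in> elems_deg F k d" using v z s by (intro elems_deg_diff elems_deg_smf)
  then obtain w where w: "w \<in> elems_deg F (Suc k) d" "\<And>r. (v - smf s z) r - differential F k w r \<in> J"
    using ex dz unfolding exact_mod_def by blast
  have "v r - differential F k w r \<in> addgen J s" for r
    using w(2)[of r] by (auto simp: addgen_def algebra_simps intro!: exI[of _ "z r"])
  then show "\<exists>w\<in>elems_deg F (Suc k) d. \<forall>r. v r - differential F k w r \<in> addgen J s"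
    using w(1) by auto
qed

text \<open>Applying the differential to d v = s u gives s d u = 0 modulo J. Cancelling
  \<open>s\<close> makes \<open>u\<close> a cycle, so exactness one step lower, in degree
  \<open>d - e\<close>, provides \<open>z\<close>.\<close>

lemma exact_mod_addgen:
  assumes J: "is_ideal J" "\<And>p d. p \<in> J \<Longrightarrow> hc d p \<in> J" and s: "s \<in> cox_comp e" "nzd J s"
    and ex: "exact_mod F J k d" "\<And>k'. k = Suc k' \<Longrightarrow> exact_mod F J k' (d - e)"
  shows "exact_mod F (addgen J s) k d"
proof (rule exact_mod_addgenI[OF J s(1) ex(1)])
  fix k' u v assume k: "k = Suc k'" and u: "u \<in> elems_deg F k' (d - e)"
    and v: "v \<in> elems_deg F k d" and uv: "\<And>r. differential F k' v r - s * u r \<in> J"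
  have "differential F k'' u r \<in> J" if k': "k' = Suc k''" for k'' r
  proof -
    have "differential F k'' (differential F k' v - smf s u) r \<in> J"
      by (rule differential_ideal[OF J(1)]) (use uv in auto)
    moreover have "differential F k'' (differential F k' v) = 0"
      using differential_differential[of v k''] v k k' by (auto simp: mem_elems_deg)
    ultimately have "- (s * differential F k'' u r) \<in> J"
      by (simp add: differential_diff differential_smf)
    then have "s * differential F k'' u r \<in> J" using is_ideal_minus[OF J(1)] by fastforce
    then show ?thesis using s(2) by (auto simp: nzd_def)
  qed
  then show "\<exists>z\<in>elems_deg F k (d - e). \<forall>r. u r - differential F k' z r \<in> J"
    using ex(2)[OF k] u k unfolding exact_mod_def by blast
qed

end

section \<open>Minimal resolutions of cyclic modules\<close>

text \<open>A minimal resolution of S/I normalised to F_0 = S, with basis element \<open>b0\<close>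
  in degree 0. Minimality says that matrix entries have no constant term. For proper homogeneous I
  every minimal resolution has this form, by \<open>minimal_free_resolution_min_res\<close>.\<close>

locale min_res = graded_cx F for F :: "'k::field gcomplex" +
  fixes I :: "'k cox set" and b0 :: nat
  assumes ideal_I: "is_ideal I" and hc_I: "p \<in> I \<Longrightarrow> hc d p \<in> I" and proper: "1 \<notin> I"
    and gens_0: "gens F 0 = {b0}" and gdeg_0: "gdeg F 0 b0 = 0"
    and boundaries_0: "boundaries F 0 = {u \<in> elems F 0. u b0 \<in> I}"
    and exact: "u \<in> elems F (Suc k) \<Longrightarrow> differential F k u = 0 \<Longrightarrow> u \<in> boundaries F (Suc k)"
    and minimal: "r \<in> gens F i \<Longrightarrow> c \<in> gens F (Suc i) \<Longrightarrow> lookup (dmat F i r c) 0 = 0"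
begin

lemma differential_lookup_0: "lookup (differential F i u r) 0 = 0"
  by (auto simp: differential_def lookup_sum lookup_mult_0 minimal intro!: sum.neutral)

lemma boundaries_deg:
  assumes "u \<in> elems_deg F k d" "u \<in> boundaries F k"
  obtains w where "w \<in> elems_deg F (Suc k) d" "u = differential F k w"
proof -
  obtain w where "w \<in> elems F (Suc k)" "u = differential F k w" using assms(2) by (auto simp: boundaries_def)
  then show ?thesis using that[of "hcf F (Suc k) d w"] hcf_id[OF assms(1)]
    by (simp add: differential_hcf hcf_elems_deg)
qed

lemma exact_deg:
  assumes "u \<in> elems_deg F (Suc k) d" "differential F k u = 0"
  obtains w where "w \<in> elems_deg F (Suc (Suc k)) d" "u = differential F (Suc k) w"
  using boundaries_deg[OF assms(1)] exact assms by (auto simp: mem_elems_deg)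

lemma exact_deg_0:
  assumes "u \<in> elems_deg F 0 d" "u b0 \<in> I"
  obtains w where "w \<in> elems_deg F 1 d" "u = differential F 0 w"
  using boundaries_deg[OF assms(1)] assms by (auto simp: mem_elems_deg boundaries_0)

lemma differential_0_in_I: "w \<in> elems F 1 \<Longrightarrow> differential F 0 w b0 \<in> I"
  using boundaries_0 by (auto simp: boundaries_def)

lemma exact_mod_zero: "exact_mod F {0} (Suc k) d"
  unfolding exact_mod_def
proof (intro ballI impI)
  fix v assume v: "v \<in> elems_deg F (Suc k) d"
    and "\<forall>k'. Suc k = Suc k' \<longrightarrow> (\<forall>r. differential F k' v r \<in> {0})"
  then have "differential F k v = 0" by auto
  from exact_deg[OF v this]
  show "\<exists>w\<in>elems_deg F (Suc (Suc k)) d. \<forall>r. v r - differential F (Suc k) w r \<in> {0}"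
    by (metis singleton_iff right_minus_eq)
qed

text \<open>In homological degree 1 the general step does not apply, because H_0 = S/I is nonzero;
  instead \<open>s\<close> is cancelled on S/I, which makes \<open>u\<close> a boundary. In terms of
  Tor this is the vanishing of Tor_k(S/I, S/s) for k >= 1.\<close>

lemma exact_mod_nzd:
  assumes s: "s \<in> cox_comp e" "nzd {0} s" "nzd I s"
  shows "exact_mod F (addgen {0} s) (Suc k) d"
proof (cases k)
  case (Suc k')
  show ?thesis
    by (rule exact_mod_addgen[OF _ _ s(1,2)]) (auto simp: is_ideal_def Suc exact_mod_zero)
next
  case 0
  show ?thesis
  proof (rule exact_mod_addgenI[OF _ _ s(1) exact_mod_zero])
    fix k' u v
    assume k': "Suc k = Suc k'" and u: "u \<in> elems_deg F k' (d - e)" and v: "v \<in> elems_deg F (Suc k) d"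
      and uv: "\<And>r. differential F k' v r - s * u r \<in> {0}"
    have "s * u b0 \<in> I" using uv[of b0] differential_0_in_I[of v] v k' 0 by (auto simp: mem_elems_deg)
    then have "u b0 \<in> I" using s(3) by (auto simp: nzd_def)
    then obtain w where "w \<in> elems_deg F 1 (d - e)" "u = differential F 0 w"
      using exact_deg_0 u k' 0 by blast
    then show "\<exists>z\<in>elems_deg F (Suc k) (d - e). \<forall>r. u r - differential F k' z r \<in> {0}"
      using k' 0 by auto
  qed (auto simp: is_ideal_def)
qed

text \<open>By Nakayama's lemma, the image of a basis element is nonzero modulo every ideal modulo which
  the complex is exact.\<close>

lemma column_nonzero:
  assumes "exact_mod F J (Suc k) (gdeg F (Suc k) c)" "c \<in> gens F (Suc k)" "\<And>p. p \<in> J \<Longrightarrow> lookup p 0 = 0"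
    "is_ideal J"
  obtains r where "r \<in> gens F k" "dmat F k r c \<notin> J"
proof (rule ccontr)
  assume "\<not> thesis"
  then have "\<forall>r. differential F k (bas c) r \<in> J"
    using that assms(2) is_ideal_0[OF assms(4)] by (auto simp: differential_bas)
  then obtain w where "bas c c - differential F (Suc k) w c \<in> J"
    using assms(1) bas_elems_deg[OF assms(2)] unfolding exact_mod_def by blast
  from assms(3)[OF this] show False by (simp add: lookup_minus differential_lookup_0 bas_def)
qed

lemma dmat_nonzero_le:
  assumes "r \<in> gens F k" "c \<in> gens F (Suc k)" "dmat F k r c \<noteq> 0"
  shows "gdeg F k r \<le> gdeg F (Suc k) c" "gdeg F k r \<noteq> gdeg F (Suc k) c"
proof -
  note d = dmat_deg[OF assms(1,2)]
  have "0 \<le> gdeg F (Suc k) c - gdeg F k r" using cox_comp_eq_0[OF d] assms(3) by auto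
  then show "gdeg F k r \<le> gdeg F (Suc k) c" by (auto simp: less_eq_prod_def)
  \<comment> \<open>An entry between equal degrees is a constant, hence 0 by minimality.\<close>
  show "gdeg F k r \<noteq> gdeg F (Suc k) c"
  proof
    assume "gdeg F k r = gdeg F (Suc k) c"
    then have "dmat F k r c = mconst 0" using cox_comp_degree_0[of "dmat F k r c"] d minimal[OF assms(1,2)] by simp
    then show False using assms(3) by (simp add: mconst_def)
  qed
qed

lemma gdeg_pred:
  assumes "c \<in> gens F (Suc k)"
  obtains r where "r \<in> gens F k" "gdeg F k r \<le> gdeg F (Suc k) c" "gdeg F k r \<noteq> gdeg F (Suc k) c"
  by (rule column_nonzero[OF exact_mod_zero assms]) (use dmat_nonzero_le assms in \<open>auto simp: is_ideal_def\<close>)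

lemma gdeg_nonneg: "c \<in> gens F k \<Longrightarrow> 0 \<le> gdeg F k c"
proof (induction k arbitrary: c)
  case 0
  then show ?case by (simp add: gens_0 gdeg_0)
next
  case (Suc k)
  obtain r where "r \<in> gens F k" "gdeg F k r \<le> gdeg F (Suc k) c" by (rule gdeg_pred[OF Suc.prems])
  then show ?case using Suc.IH order_trans by blast
qed

lemma gdeg_1_nonzero: "c \<in> gens F 1 \<Longrightarrow> gdeg F 1 c \<noteq> 0"
  using gdeg_pred[of c 0] by (metis One_nat_def gdeg_0 gens_0 singletonD)

text \<open>The form is regular on S/I and leaves F exact in homological degrees at least 1. The
  remaining variable is only known to be regular on S modulo the form, so its quotient is exact one
  degree later. Both together generate the ideal of all x-variables, 1 and 2 being the two elements
  of the type \<open>2\<close>.\<close>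

lemma exact_mod_x:
  assumes "nzd I (mvar (Inl 1) + mconst c * mvar (Inl 2))"
  shows "exact_mod F (mono_ideal (range Inl)) (Suc (Suc k)) d"
proof -
  let ?r = "mconst c * mvar (Inl 2) :: 'k cox"
  let ?s = "mvar (Inl 1) + ?r"
  have keys: "n \<in> keys ?r \<Longrightarrow> lookup n (Inl 1) = 0" for n
    by (auto simp: mconst_def mvar_def mult_single lookup_single split: if_splits)
  have s: "?s \<in> cox_comp (1, 0)" by (intro cox_comp_add cox_comp_mconst_mult cox_comp_x)
  have r: "?r \<in> mono_ideal {Inl 2}"
    by (intro is_ideal_mult is_ideal_mono_ideal) (auto simp: mono_ideal_def)
  have s0: "nzd {0} ?s"
    unfolding nzd_def using mono_ideal_cancel_monic[of "Inl 1" ?r _ "{}"] keys by simp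
  have ex1: "exact_mod F (addgen {0} ?s) (Suc k') d'" for k' d'
    by (rule exact_mod_nzd[OF s s0 assms])
  have "exact_mod F (addgen (addgen (mono_ideal {}) ?s) (mvar (Inl 2))) (Suc (Suc k)) d"
  proof (rule exact_mod_addgen)
    show "nzd (addgen (mono_ideal {}) ?s) (mvar (Inl 2))"
      by (rule nzd_addgen_mono_ideal) (use keys in auto)
    show "mvar (Inl 2) \<in> cox_comp (1, 0)" by simp
    show "hc d p \<in> addgen (mono_ideal {}) ?s" if "p \<in> addgen (mono_ideal {}) ?s" for p d
      by (rule hc_addgen[OF _ s that]) (rule hc_mono_ideal)
    show "is_ideal (addgen (mono_ideal {}) ?s)" by (intro is_ideal_addgen is_ideal_mono_ideal)
  qed (use ex1 in auto)
  then have "exact_mod F (addgen (mono_ideal {Inl 2}) ?s) (Suc (Suc k)) d"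
    by (simp only: addgen_addgen_mono_ideal)
  then show ?thesis using addgen_mono_ideal_mvar[OF r, of "Inl 1"]
    by (simp add: UNIV_2)
qed

text \<open>Modulo the x-variables the column of \<open>c\<close> still has a nonzero entry. Such an
  entry has x-degree 0, so only the y-degree changes, and by minimality it drops strictly.\<close>

lemma gdeg_strand:
  assumes "nzd I (mvar (Inl 1) + mconst t * mvar (Inl 2))" "c \<in> gens F (Suc (Suc k))"
  obtains r where "r \<in> gens F (Suc k)" "fst (gdeg F (Suc k) r) = fst (gdeg F (Suc (Suc k)) c)"
    "snd (gdeg F (Suc k) r) < snd (gdeg F (Suc (Suc k)) c)"
proof -
  obtain r where r: "r \<in> gens F (Suc k)" "dmat F (Suc k) r c \<notin> mono_ideal (range Inl)"
    by (rule column_nonzero[OF exact_mod_x[OF assms(1)] assms(2)])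
      (auto simp: mono_ideal_lookup_0 is_ideal_mono_ideal)
  then have "dmat F (Suc k) r c \<noteq> 0" using is_ideal_0[OF is_ideal_mono_ideal] by metis
  note le = dmat_nonzero_le[OF r(1) assms(2) this]
  have "\<not> fst (gdeg F (Suc (Suc k)) c - gdeg F (Suc k) r) > 0"
    using cox_comp_mono_ideal_x[OF dmat_deg[OF r(1) assms(2)]] r(2) by auto
  then show ?thesis using that[OF r(1)] le by (auto simp: less_eq_prod_def prod_eq_iff)
qed

text \<open>The premise \<open>surj\<close> says that S/(I + (s)) vanishes in degrees (a, b) with b
  >= 1. There the quotient by \<open>s\<close> is exact in homological degree 0 as well, so the
  other two variables can be added without losing homological degrees. Each of them needs exactness
  in y-degrees b and b - 1, whence b >= 3.\<close>

lemma exact_mod_y: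
  assumes nzd: "nzd I (mvar (Inr 1) + (mconst c * mvar (Inr 2) + mconst c' * mvar (Inr 3)))" (is "nzd I ?s")
    and surj: "\<And>b p. b \<ge> 1 \<Longrightarrow> p \<in> cox_comp (a, b) \<Longrightarrow> \<exists>g\<in>cox_comp (a, b - 1).
      p - (mvar (Inr 1) + (mconst c * mvar (Inr 2) + mconst c' * mvar (Inr 3))) * g \<in> I"
    and "b \<ge> 3"
  shows "exact_mod F (mono_ideal (range Inr)) k (a, b)"
proof -
  let ?r = "mconst c * mvar (Inr 2) + mconst c' * mvar (Inr 3) :: 'k cox"
  have keys: "n \<in> keys ?r \<Longrightarrow> lookup n (Inr 1) = 0" for n
    using subsetD[OF keys_add[of "mconst c * mvar (Inr 2) :: 'k cox" "mconst c' * mvar (Inr 3)"], of n]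
    by (auto simp: mconst_def mvar_def mult_single lookup_single split: if_splits)
  have s: "?s \<in> cox_comp (0, 1)" by (intro cox_comp_add cox_comp_mconst_mult cox_comp_y)
  have r: "?r \<in> mono_ideal {Inr 3, Inr 2}"
    by (intro is_ideal_add is_ideal_mult is_ideal_mono_ideal) (auto simp: mono_ideal_def)
  have s0: "nzd {0} ?s"
    unfolding nzd_def using mono_ideal_cancel_monic[of "Inr 1" ?r _ "{}"] keys by simp
  define J where "J W = addgen (mono_ideal W) ?s" for W
  have hcJ: "p \<in> J W \<Longrightarrow> hc d p \<in> J W" for p d W
    unfolding J_def by (rule hc_addgen[OF _ s]) (rule hc_mono_ideal)
  have idJ: "is_ideal (J W)" for W unfolding J_def by (intro is_ideal_addgen is_ideal_mono_ideal)
  have nzdJ: "nzd (J W) (mvar w)" if "w \<notin> W" "Inr 1 \<notin> W" "w \<noteq> Inr 1" for w W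
    unfolding J_def by (rule nzd_addgen_mono_ideal) (use that keys in auto)
  have insJ: "addgen (J W) (mvar w) = J (insert w W)" for w W
    unfolding J_def by (rule addgen_addgen_mono_ideal)
  have ex0: "exact_mod F (J {}) (Suc k') d'" for k' d'
    using exact_mod_nzd[OF s s0 nzd] by (simp add: J_def)
  have ex1: "exact_mod F (J {}) k' (a, b)" if b: "b \<ge> 1" for k' b
  proof (cases k')
    case 0
    show ?thesis unfolding exact_mod_def
    proof (intro ballI impI)
      fix v assume v: "v \<in> elems_deg F k' (a, b)"
      then have vb: "v b0 \<in> cox_comp (a, b)" using elems_degD[of v F 0 "(a, b)" b0] 0 by (simp add: gdeg_0)
      then obtain g where g: "g \<in> cox_comp (a, b - 1)" "v b0 - ?s * g \<in> I" using surj[OF b] by blast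
      define u where "u r = (if r = b0 then v b0 - ?s * g else 0)" for r
      have "?s * g \<in> cox_comp (a, b)" using cox_comp_mult[OF s g(1)] by simp
      then have "u \<in> elems_deg F 0 (a, b)"
        using vb by (auto simp: u_def mem_elems_deg mem_elems gens_0 gdeg_0 cox_comp_diff)
      moreover have "u b0 \<in> I" using g by (simp add: u_def)
      ultimately obtain w where w: "w \<in> elems_deg F 1 (a, b)" "u = differential F 0 w" by (rule exact_deg_0)
      have "v r - differential F 0 w r \<in> J {}" for r
      proof (cases "r = b0")
        case True
        then have "v r - differential F 0 w r - ?s * g = 0"
          unfolding w(2)[symmetric] u_def by simp
        then show ?thesis unfolding J_def addgen_def mono_ideal_empty by blast
      next
        case False
        then have "v r = 0" "differential F 0 w r = 0"
          using v 0 by (auto simp: mem_elems_deg mem_elems gens_0 differential_def)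
        then show ?thesis using is_ideal_0[OF idJ] by simp
      qed
      then show "\<exists>w\<in>elems_deg F (Suc k') (a, b). \<forall>r. v r - differential F k' w r \<in> J {}"
        using w(1) 0 by auto
    qed
  qed (simp add: ex0)
  have ex2: "exact_mod F (J {Inr 2}) k' (a, b)" if "b \<ge> 2" for k' b
    unfolding insJ[symmetric]
  proof (rule exact_mod_addgen[where e = "(0, 1)"])
    show "exact_mod F (J {}) k' (a, b)" using that by (intro ex1) simp
    show "exact_mod F (J {}) k'' ((a, b) - (0, 1))" for k'' using that by (simp add: ex1)
    show "nzd (J {}) (mvar (Inr 2))" by (rule nzdJ) auto
  qed (simp_all add: idJ hcJ)
  have "exact_mod F (J {Inr 3, Inr 2}) k (a, b)"
    unfolding insJ[symmetric, of "Inr 3"]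
  proof (rule exact_mod_addgen[where e = "(0, 1)"])
    show "exact_mod F (J {Inr 2}) k (a, b)" using \<open>b \<ge> 3\<close> by (intro ex2) simp
    show "exact_mod F (J {Inr 2}) k'' ((a, b) - (0, 1))" for k'' using \<open>b \<ge> 3\<close> by (simp add: ex2)
    show "nzd (J {Inr 2}) (mvar (Inr 3))" by (rule nzdJ) auto
  qed (simp_all add: idJ hcJ)
  moreover have "J {Inr 3, Inr 2} = mono_ideal (range Inr)"
    unfolding J_def addgen_mono_ideal_mvar[OF r] by (simp add: UNIV_3 insert_commute)
  ultimately show ?thesis by simp
qed

end

section \<open>Finite-dimensional subspaces\<close>

text \<open>The ambient spaces are infinite-dimensional, and \<open>dim\<close> is 0 on subspaces
  without a finite basis, so the dimension formulas carry this condition.\<close>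

definition fin_dim :: "('b set \<Rightarrow> 'b set) \<Rightarrow> 'b set \<Rightarrow> bool"
  where "fin_dim sp V \<longleftrightarrow> (\<exists>B. finite B \<and> V \<subseteq> sp B)"

lemma fin_dim_subset: "fin_dim sp W \<Longrightarrow> V \<subseteq> W \<Longrightarrow> fin_dim sp V"
  by (auto simp: fin_dim_def)

context vector_space_pair
begin

lemma independent_finite: "fin_dim vs1.span V \<Longrightarrow> vs1.independent B \<Longrightarrow> B \<subseteq> V \<Longrightarrow> finite B"
  unfolding fin_dim_def using vs1.independent_span_bound by (meson order_trans)

lemma subspace_eqI_dim:
  assumes "fin_dim vs1.span W" "vs1.subspace V" "V \<subseteq> W" "vs1.dim W \<le> vs1.dim V"
  shows "V = W"
proof -
  obtain B where B: "B \<subseteq> V" "vs1.independent B" "V \<subseteq> vs1.span B" "card B = vs1.dim V" by (rule vs1.basis_exists)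
  obtain C where C: "B \<subseteq> C" "C \<subseteq> W" "vs1.independent C" "W \<subseteq> vs1.span C"
    using vs1.maximal_independent_subset_extend[of B W] B assms(3) by blast
  have "card C \<le> card B" using vs1.basis_card_eq_dim[OF C(2,4,3)] B(4) assms(4) by simp
  then have "C = B" using card_seteq[OF independent_finite[OF assms(1) C(3,2)] C(1)] by simp
  then show ?thesis using C(4) vs1.span_minimal[OF B(1) assms(2)] assms(3) by auto
qed

text \<open>The coordinates of \<open>x\<close> with respect to \<open>B\<close> are supported both
  in \<open>C\<close> and in its complement.\<close>

lemma span_Int_complement:
  assumes "vs1.independent B" "C \<subseteq> B" "x \<in> vs1.span C" "x \<in> vs1.span (B - C)"
  shows "x = 0"
proof -
  have "vs1.representation B x = vs1.representation C x" "vs1.representation B x = vs1.representation (B - C) x"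
    using vs1.representation_extend[OF assms(1) assms(3,2)]
      vs1.representation_extend[OF assms(1) assms(4) Diff_subset] .
  then have "vs1.representation C x b = 0" for b
    using vs1.representation_ne_zero[of C x b] vs1.representation_ne_zero[of "B - C" x b] by auto
  moreover have "(\<Sum>b | vs1.representation C x b \<noteq> 0. s1 (vs1.representation C x b) b) = x"
    by (rule vs1.sum_nonzero_representation_eq) (use assms vs1.independent_mono in auto)
  ultimately show ?thesis by simp
qed

text \<open>A basis of the kernel is extended to one of \<open>V\<close>; the added vectors map to a
  basis of the image. Finite dimension of \<open>V\<close> is concluded rather than assumed, since
  later inductions build spaces up from kernel and image.\<close>

lemma rank_nullity:
  assumes lin: "Vector_Spaces.linear s1 s2 f" and V: "vs1.subspace V"
    and fd: "fin_dim vs1.span {v \<in> V. f v = 0}" "fin_dim vs2.span (f ` V)"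
  shows "fin_dim vs1.span V" "vs1.dim V = vs1.dim {v \<in> V. f v = 0} + vs2.dim (f ` V)"
proof -
  interpret f: Vector_Spaces.linear s1 s2 f by (rule lin)
  let ?K = "{v \<in> V. f v = 0}"
  obtain C where C: "C \<subseteq> ?K" "vs1.independent C" "?K \<subseteq> vs1.span C" "card C = vs1.dim ?K"
    by (rule vs1.basis_exists)
  obtain B where B: "C \<subseteq> B" "B \<subseteq> V" "vs1.independent B" "V \<subseteq> vs1.span B"
    using vs1.maximal_independent_subset_extend[of C V] C by blast
  have "x = 0" if "x \<in> vs1.span (B - C)" "f x = 0" for x
  proof (rule span_Int_complement[OF B(3,1) _ that(1)])
    have "x \<in> V" using that(1) vs1.span_minimal[of "B - C" V] V B(2) by blast
    then show "x \<in> vs1.span C" using C(3) that(2) by blast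
  qed
  then have inj: "inj_on f (vs1.span (B - C))"
    using f.inj_on_iff_eq_0[of "vs1.span (B - C)"] by (simp add: vs1.subspace_span)
  have ind: "vs2.independent (f ` (B - C))"
    by (rule f.independent_injective_image[OF _ inj]) (use B(3) vs1.independent_mono in blast)
  have inj': "inj_on f (B - C)" using inj vs1.span_superset inj_on_subset by metis
  have sub: "f ` (B - C) \<subseteq> f ` V" using B(2) by auto
  have "finite (f ` (B - C))"
    using fd(2) sub vs2.independent_span_bound[OF _ ind] unfolding fin_dim_def by (meson order_trans)
  then have fin: "finite (B - C)" using inj' by (simp add: finite_image_iff)
  have finC: "finite C" by (rule independent_finite[OF fd(1) C(2,1)])
  have finB: "finite B" using fin finC B(1) by (metis finite_Diff2)
  then show "fin_dim vs1.span V" using B(4) by (auto simp: fin_dim_def)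
  have "f ` V \<subseteq> vs2.span (f ` B)" using B(4) f.span_image[of B] by auto
  also have "f ` B \<subseteq> insert 0 (f ` (B - C))" using C(1) by auto
  then have "vs2.span (f ` B) \<subseteq> vs2.span (f ` (B - C))"
    using vs2.span_mono by (metis vs2.span_insert_0)
  finally have "vs2.dim (f ` V) = card (B - C)"
    using vs2.basis_card_eq_dim[OF sub _ ind] card_image[OF inj'] by simp
  moreover have "vs1.dim V = card B" using vs1.basis_card_eq_dim[OF B(2,4,3)] by simp
  moreover have "card B = card C + card (B - C)"
    using B(1) finB finC by (simp add: card_Diff_subset card_mono)
  ultimately show "vs1.dim V = vs1.dim ?K + vs2.dim (f ` V)" using C(4) by simp
qed

end

section \<open>Polynomials and module elements as vector spaces over the field\<close>

lemma mconst_add: "mconst (a + b) = mconst a + mconst b"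
  by (simp add: mconst_def single_add)

lemma mconst_mult: "mconst (a * b) = mconst a * mconst b"
  by (simp add: mconst_def mult_single)

lemma mconst_1 [simp]: "mconst 1 = 1"
  by (simp add: mconst_def)

lemma mconst_0 [simp]: "mconst 0 = 0"
  by (simp add: mconst_def)

lemma mconst_uminus: "mconst (- a) = - mconst a"
  by (simp add: mconst_def single_uminus)

interpretation vc: vector_space "\<lambda>(c::'k::field) (p::'k cox). mconst c * p"
  by unfold_locales (auto simp: distrib_left distrib_right mconst_add mconst_mult mult.assoc)

lemmas [simp del] = vc.scale_scale

definition scf :: "'k::field \<Rightarrow> (nat \<Rightarrow> 'k cox) \<Rightarrow> nat \<Rightarrow> 'k cox"
  where "scf c = smf (mconst c)"

interpretation vf: vector_space scf
  by unfold_locales (auto simp: scf_def fun_eq_iff distrib_left distrib_right mconst_add mconst_mult mult.assoc)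

lemmas [simp del] = vf.scale_scale

interpretation ck: vector_space_pair "\<lambda>(c::'k::field) (p::'k cox). mconst c * p" "(*) :: 'k::field \<Rightarrow> 'k \<Rightarrow> 'k" ..
interpretation fc: vector_space_pair scf "\<lambda>(c::'k::field) (p::'k cox). mconst c * p" ..
interpretation ff: vector_space_pair scf scf ..

lemma vk_dim: "fin_dim vector_space_over_itself.span (V :: 'k::field set)" "vector_space_over_itself.dim (UNIV :: 'k set) = 1"
proof -
  have span: "x \<in> vector_space_over_itself.span {1}" for x :: 'k
    using vector_space_over_itself.span_scale[OF vector_space_over_itself.span_base[of 1 "{1}"], of x] by simp
  then show "fin_dim vector_space_over_itself.span V" unfolding fin_dim_def by (intro exI[of _ "{1}"]) auto
  show "vector_space_over_itself.dim (UNIV :: 'k set) = 1" by simp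
qed

text \<open>Induction on the set of monomials: the coefficient at the new monomial is a linear form
  onto the field, with the previous space as its kernel.\<close>

lemma dim_keys_subset:
  fixes A :: "(2 + 3 \<Rightarrow>\<^sub>0 nat) set"
  assumes "finite A"
  shows "fin_dim vc.span {p :: 'k::field cox. keys p \<subseteq> A} \<and> vc.dim {p :: 'k cox. keys p \<subseteq> A} = card A"
  using assms
proof (induction A)
  case empty
  have *: "{p :: 'k cox. keys p \<subseteq> {}} = vc.span {}" by auto
  show ?case unfolding * vc.dim_span vc.dim_eq_card_independent[OF vc.independent_empty]
    by (auto simp: fin_dim_def intro!: exI[of _ "{}"])
next
  case (insert m A)
  let ?V = "{p :: 'k cox. keys p \<subseteq> insert m A}"
  let ?f = "\<lambda>p :: 'k cox. lookup p m"
  have lin: "Vector_Spaces.linear (\<lambda>c p. mconst c * p) (*) ?f"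
    by unfold_locales (auto simp: lookup_add)
  have sub: "vc.subspace ?V"
  proof (rule vc.subspaceI)
    show "x + y \<in> ?V" if "x \<in> ?V" "y \<in> ?V" for x y using that keys_add[of x y] by auto
    show "mconst c * x \<in> ?V" if "x \<in> ?V" for c x using that by (auto simp: in_keys_iff)
  qed auto
  have ker: "{p \<in> ?V. ?f p = 0} = {p. keys p \<subseteq> A}" using insert.hyps by (auto simp: in_keys_iff)
  have "c \<in> ?f ` ?V" for c
    by (rule image_eqI[of _ _ "single m c"]) auto
  then have im: "?f ` ?V = UNIV" by auto
  have fd: "fin_dim vc.span {p \<in> ?V. ?f p = 0}" "fin_dim vector_space_over_itself.span (?f ` ?V)" unfolding ker
    using insert.IH by (auto simp: vk_dim)
  from ck.rank_nullity[OF lin sub fd] show ?case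
    using insert unfolding ker im vk_dim by simp
qed

section \<open>Counting monomials of a given bidegree\<close>

definition mono_count :: "int \<times> int \<Rightarrow> nat"
  where "mono_count d = card {m :: 2 + 3 \<Rightarrow>\<^sub>0 nat. bideg m = d}"

lemma mono_count_neg:
  assumes "\<not> 0 \<le> d"
  shows "mono_count d = 0"
proof -
  have "{m :: 2 + 3 \<Rightarrow>\<^sub>0 nat. bideg m = d} = {}" using assms bideg_nonneg by auto
  then show ?thesis by (simp add: mono_count_def)
qed

lemma bideg_eq: "bideg m = (int (lookup m (Inl 1)) + int (lookup m (Inl 2)),
    int (lookup m (Inr 1)) + int (lookup m (Inr 2)) + int (lookup m (Inr 3)))"
  by (simp add: bideg_def sum_2 sum_3)

lemma exponents_eqI:
  fixes m n :: "2 + 3 \<Rightarrow>\<^sub>0 nat"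
  assumes "lookup m (Inl 1) = lookup n (Inl 1)" "lookup m (Inl 2) = lookup n (Inl 2)"
    "lookup m (Inr 1) = lookup n (Inr 1)" "lookup m (Inr 2) = lookup n (Inr 2)"
    "lookup m (Inr 3) = lookup n (Inr 3)"
  shows "m = n"
proof (rule poly_mapping_eqI)
  fix v
  have "lookup m (Inl i) = lookup n (Inl i)" for i using exhaust_2[of i] assms by auto
  moreover have "lookup m (Inr j) = lookup n (Inr j)" for j using exhaust_3[of j] assms by auto
  ultimately show "lookup m v = lookup n v" by (cases v) auto
qed

text \<open>In a fixed bidegree, the exponents of one x-variable and two y-variables determine the
  other two.\<close>

lemma bij_betw_monomials:
  "bij_betw (\<lambda>m. (lookup m (Inl 1), lookup m (Inr 1), lookup m (Inr 2)))
    {m :: 2 + 3 \<Rightarrow>\<^sub>0 nat. bideg m = (int i, int j)} ({..i} \<times> (SIGMA b:{..j}. {..j - b}))"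
  (is "bij_betw ?f ?M ?T")
proof (rule bij_betw_imageI)
  show "inj_on ?f ?M"
  proof (rule inj_onI)
    fix m n assume "m \<in> ?M" "n \<in> ?M" and f: "?f m = ?f n"
    then have "int (lookup m (Inl 1)) + int (lookup m (Inl 2)) = int (lookup n (Inl 1)) + int (lookup n (Inl 2))"
      "int (lookup m (Inr 1)) + int (lookup m (Inr 2)) + int (lookup m (Inr 3))
        = int (lookup n (Inr 1)) + int (lookup n (Inr 2)) + int (lookup n (Inr 3))"
      unfolding bideg_eq by simp_all
    then show "m = n" using f by (intro exponents_eqI) simp_all
  qed
  show "?f ` ?M = ?T"
  proof (rule equalityI; rule subsetI)
    fix x assume "x \<in> ?f ` ?M"
    then obtain m where m: "bideg m = (int i, int j)" "x = ?f m" by blast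
    from m(1) have "lookup m (Inl 1) + lookup m (Inl 2) = i"
      "lookup m (Inr 1) + lookup m (Inr 2) + lookup m (Inr 3) = j"
      unfolding bideg_eq prod.inject of_nat_add[symmetric] of_nat_eq_iff by blast+
    then show "x \<in> ?T" unfolding m(2) by simp
  next
    fix x assume "x \<in> ?T"
    then obtain a b c where x: "x = (a, b, c)" "a \<le> i" "b \<le> j" "c \<le> j - b" by auto
    define m :: "2 + 3 \<Rightarrow>\<^sub>0 nat" where "m = single (Inl 1) a + single (Inl 2) (i - a)
      + single (Inr 1) b + single (Inr 2) c + single (Inr 3) (j - b - c)"
    have m: "lookup m (Inl 1) = a" "lookup m (Inl 2) = i - a"
      "lookup m (Inr 1) = b" "lookup m (Inr 2) = c" "lookup m (Inr 3) = j - b - c"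
      by (simp_all add: m_def lookup_add lookup_single when_def)
    have "bideg m = (int i, int j)" unfolding bideg_eq m using x by simp
    then show "x \<in> ?f ` ?M" using m x by (intro image_eqI[of _ _ m]) simp_all
  qed
qed

lemma finite_monomials: "finite {m :: 2 + 3 \<Rightarrow>\<^sub>0 nat. bideg m = d}"
proof (cases "0 \<le> d")
  case True
  then obtain i j where d: "d = (int i, int j)"
    by (cases d) (auto simp: less_eq_prod_def dest!: zero_le_imp_eq_int)
  show ?thesis using bij_betw_finite[OF bij_betw_monomials[of i j]] by (simp add: d)
next
  case False
  then have "{m :: 2 + 3 \<Rightarrow>\<^sub>0 nat. bideg m = d} = {}" using bideg_nonneg by auto
  then show ?thesis by simp
qed

lemma mono_count: "mono_count (int i, int j) = (i + 1) * (\<Sum>b\<le>j. j - b + 1)"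
proof -
  have "mono_count (int i, int j) = card ({..i} \<times> (SIGMA b:{..j}. {..j - b}))"
    unfolding mono_count_def by (rule bij_betw_same_card[OF bij_betw_monomials])
  then show ?thesis by (simp add: card_cartesian_product)
qed

lemma cox_comp_keys: "cox_comp d = {p. keys p \<subseteq> {m. bideg m = d}}"
  by (auto simp: cox_comp_def)

lemma cox_comp_fin_dim: "fin_dim vc.span (cox_comp d :: 'k::field cox set)"
  and cox_comp_dim: "vc.dim (cox_comp d :: 'k::field cox set) = mono_count d"
  using dim_keys_subset[OF finite_monomials[of d]] by (auto simp: mono_count_def cox_comp_keys)

lemma cox_comp_subspace: "vc.subspace (cox_comp d :: 'k::field cox set)"
  by (rule vc.subspaceI) (auto simp: cox_comp_add cox_comp_mconst_mult)

context graded_cx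
begin

lemma elems_deg_subspace: "vf.subspace (elems_deg F i d)"
proof (rule vf.subspaceI)
  show "scf c u \<in> elems_deg F i d" if "u \<in> elems_deg F i d" for c u
    using elems_deg_smf[of "mconst c" 0 u] that by (simp add: scf_def)
qed (auto intro: elems_deg_0 elems_deg_add)

text \<open>Stated for subsets \<open>A\<close> of the generators, both for the induction and
  because spans of the generators of a single degree are measured later.\<close>

lemma elems_deg_dim_aux:
  fixes d
  assumes "finite A" "A \<subseteq> gens F i"
  defines "V \<equiv> \<lambda>A. {u \<in> elems_deg F i d. \<forall>b. b \<notin> A \<longrightarrow> u b = 0}"
  shows "fin_dim vf.span (V A) \<and> vf.dim (V A) = (\<Sum>b\<in>A. mono_count (d - gdeg F i b))"
  using assms(1,2)
proof (induction A)
  case empty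
  have V: "V {} = {0}" using elems_deg_0[of F i d] by (auto simp: V_def fun_eq_iff)
  have "V {} = vf.span {}" unfolding V vf.span_empty ..
  then have "vf.dim (V {}) = card ({} :: (nat \<Rightarrow> 'k cox) set)" "fin_dim vf.span (V {})"
    using vf.dim_span_eq_card_independent[OF vf.independent_empty] unfolding fin_dim_def by auto
  then show ?case by simp
next
  case (insert c A)
  let ?f = "\<lambda>u :: nat \<Rightarrow> 'k cox. u c"
  have lin: "Vector_Spaces.linear scf (\<lambda>c p. mconst c * p) ?f"
    by unfold_locales (auto simp: scf_def)
  have sub: "vf.subspace (V (insert c A))"
    using elems_deg_subspace[of i d] by (auto simp: V_def vf.subspace_def scf_def)
  have ker: "{u \<in> V (insert c A). ?f u = 0} = V A" using insert.hyps by (auto simp: V_def)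
  have im: "?f ` V (insert c A) = cox_comp (d - gdeg F i c)"
  proof (intro equalityI subsetI)
    fix p :: "'k cox" assume p: "p \<in> cox_comp (d - gdeg F i c)"
    have "smf p (bas c) \<in> elems_deg F i d"
      by (rule elems_deg_smf[OF p]) (use bas_elems_deg[of c F i] insert.prems in simp)
    then have "smf p (bas c) \<in> V (insert c A)" by (simp add: V_def bas_def)
    then show "p \<in> ?f ` V (insert c A)" by (rule image_eqI[rotated]) (simp add: bas_def)
  qed (auto simp: V_def elems_degD)
  have fd: "fin_dim vf.span {u \<in> V (insert c A). ?f u = 0}" "fin_dim vc.span (?f ` V (insert c A))"
    unfolding ker im using insert.IH insert.prems by (simp_all only: insert_subset cox_comp_fin_dim simp_thms)
  from fc.rank_nullity[OF lin sub fd] show ?case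
    using insert unfolding ker im cox_comp_dim by simp
qed

lemma elems_deg_fin_dim: "fin_dim vf.span (elems_deg F i d)"
  and elems_deg_dim: "vf.dim (elems_deg F i d) = (\<Sum>b\<in>gens F i. mono_count (d - gdeg F i b))"
proof -
  have "{u \<in> elems_deg F i d. \<forall>b. b \<notin> gens F i \<longrightarrow> u b = 0} = elems_deg F i d"
    by (auto simp: mem_elems_deg mem_elems)
  then show "fin_dim vf.span (elems_deg F i d)" "vf.dim (elems_deg F i d) = (\<Sum>b\<in>gens F i. mono_count (d - gdeg F i b))"
    using elems_deg_dim_aux[OF finite_gens order_refl, of i d] by auto
qed

lemma differential_linear:
  "Vector_Spaces.linear scf scf (differential F i)"
  by unfold_locales (auto simp: scf_def differential_add differential_smf)

text \<open>The index is that of the differential; the cycles themselves lie in homological degree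
  \<open>Suc i\<close>.\<close>

definition cycles_deg :: "nat \<Rightarrow> int \<times> int \<Rightarrow> (nat \<Rightarrow> 'k cox) set"
  where "cycles_deg i d = {u \<in> elems_deg F (Suc i) d. differential F i u = 0}"

lemma dim_cycles_deg:
  "vf.dim (elems_deg F (Suc i) d) = vf.dim (cycles_deg i d) + vf.dim (differential F i ` elems_deg F (Suc i) d)"
  unfolding cycles_deg_def
proof (rule ff.rank_nullity(2)[OF differential_linear elems_deg_subspace])
  show "fin_dim vf.span {v \<in> elems_deg F (Suc i) d. differential F i v = 0}"
    by (rule fin_dim_subset[OF elems_deg_fin_dim[of "Suc i" d]]) auto
  show "fin_dim vf.span (differential F i ` elems_deg F (Suc i) d)"
    by (rule fin_dim_subset[OF elems_deg_fin_dim[of i d]]) (auto simp: differential_deg)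
qed

end

section \<open>Evaluation and vanishing ideals\<close>

text \<open>The product runs over all variables rather than over \<open>keys m\<close>, which makes
  the value multiplicative in \<open>m\<close> without comparing supports.\<close>

definition monom_eval :: "('v::finite \<Rightarrow> 'k::comm_ring_1) \<Rightarrow> ('v \<Rightarrow>\<^sub>0 nat) \<Rightarrow> 'k"
  where "monom_eval a m = (\<Prod>v\<in>UNIV. a v ^ lookup m v)"

lemma monom_eval_add: "monom_eval a (m + n) = monom_eval a m * monom_eval a n"
  by (simp add: monom_eval_def lookup_add power_add prod.distrib)

lemma monom_eval_keys: "(\<Prod>v\<in>keys m. a v ^ lookup m v) = monom_eval a m"
  unfolding monom_eval_def by (rule prod.mono_neutral_left) (auto simp: in_keys_iff)

lemma eval_mpoly_superset:
  assumes "finite A" "keys p \<subseteq> A"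
  shows "eval_mpoly a p = (\<Sum>m\<in>A. lookup p m * monom_eval a m)"
  unfolding eval_mpoly_def monom_eval_keys
  by (rule sum.mono_neutral_left) (use assms in \<open>auto simp: in_keys_iff\<close>)

lemma eval_mpoly_0 [simp]: "eval_mpoly a 0 = 0"
  by (simp add: eval_mpoly_def)

lemma eval_mpoly_add: "eval_mpoly a (p + q) = eval_mpoly a p + eval_mpoly (a :: 'v::finite \<Rightarrow> _) q"
  using keys_add[of p q]
  by (simp add: eval_mpoly_superset[of "keys p \<union> keys q"] lookup_add distrib_right sum.distrib)

lemma eval_mpoly_sum: "eval_mpoly (a :: 'v::finite \<Rightarrow> _) (sum f A) = (\<Sum>i\<in>A. eval_mpoly a (f i))"
  by (induction A rule: infinite_finite_induct) (auto simp: eval_mpoly_add)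

lemma eval_mpoly_single: "eval_mpoly (a :: 'v::finite \<Rightarrow> _) (single m c) = c * monom_eval a m"
  using eval_mpoly_superset[of "{m}" "single m c" a] by simp

lemma eval_mpoly_mult: "eval_mpoly (a :: 'v::finite \<Rightarrow> 'k::comm_ring_1) (p * q) = eval_mpoly a p * eval_mpoly a q"
proof -
  have "p * q = (\<Sum>m\<in>keys p. \<Sum>n\<in>keys q. single m (lookup p m) * single n (lookup q n))"
    by (simp only: sum_product[symmetric] poly_sum_single)
  then have "eval_mpoly a (p * q) = (\<Sum>m\<in>keys p. \<Sum>n\<in>keys q. (lookup p m * monom_eval a m) * (lookup q n * monom_eval a n))"
    by (simp add: eval_mpoly_sum mult_single eval_mpoly_single monom_eval_add ac_simps)
  then show ?thesis by (simp add: eval_mpoly_superset[of "keys p" p] eval_mpoly_superset[of "keys q" q] sum_product)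
qed

lemma eval_mpoly_mvar: "eval_mpoly (a :: 'v::finite \<Rightarrow> 'k::comm_ring_1) (mvar v) = a v"
proof -
  have "monom_eval a (single v 1) = (\<Prod>w\<in>UNIV. if w = v then a v else 1)"
    unfolding monom_eval_def by (rule prod.cong) (auto simp: lookup_single when_def)
  then show ?thesis by (simp add: mvar_def eval_mpoly_single)
qed

lemma eval_mpoly_mconst: "eval_mpoly (a :: 'v::finite \<Rightarrow> 'k::comm_ring_1) (mconst c) = c"
  by (simp add: mconst_def eval_mpoly_single monom_eval_def)

lemma eval_mpoly_1: "eval_mpoly (a :: 'v::finite \<Rightarrow> 'k::comm_ring_1) 1 = 1"
  using eval_mpoly_mconst[of a 1] by simp

text \<open>The right-hand side contains the homogeneous generators and is an ideal, because a
  component of \<open>r * f\<close> is a sum of products of components. Conversely, \<open>f\<close>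
  is the sum of its components, and these are generators.\<close>

lemma vanishing_ideal_eq:
  "vanishing_ideal X = {f. \<forall>d. \<forall>P\<in>X. \<forall>a\<in>coordinates P. eval_mpoly a (hc d f) = 0}" (is "_ = ?V")
proof
  have "is_ideal ?V" unfolding is_ideal_def
  proof (intro conjI ballI allI; clarsimp simp: hc_add eval_mpoly_add)
    fix f r :: "'a cox" and d1 d2 P Q a
    assume f: "\<forall>i j. \<forall>P\<in>X. \<forall>a\<in>coordinates P. eval_mpoly a (hc (i, j) f) = 0"
      and P: "(P, Q) \<in> X" "a \<in> coordinates (P, Q)"
    have "eval_mpoly a (hc d f) = 0" for d using f P by (cases d) auto
    moreover have "r * f = (\<Sum>e\<in>bideg ` keys r. hc e r * f)"
      by (simp add: sum_distrib_right[symmetric] sum_hc)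
    ultimately show "eval_mpoly a (hc (d1, d2) (r * f)) = 0"
      by (simp add: hc_sum eval_mpoly_sum hc_mult[OF hc_in_cox_comp] eval_mpoly_mult)
  qed
  then show "vanishing_ideal X \<subseteq> ?V" unfolding vanishing_ideal_def
    by (rule genideal_subset) (auto simp: hc_homogeneous)
next
  show "?V \<subseteq> vanishing_ideal X"
  proof
    fix f assume f: "f \<in> ?V"
    have "hc d f \<in> vanishing_ideal X" for d
      unfolding vanishing_ideal_def using f hc_in_cox_comp[of d f] by (intro mem_genideal CollectI) blast
    then have "(\<Sum>d\<in>bideg ` keys f. hc d f) \<in> vanishing_ideal X"
      unfolding vanishing_ideal_def by (intro is_ideal_sum is_ideal_genideal)
    then show "f \<in> vanishing_ideal X" by (simp add: sum_hc)
  qed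
qed

lemma is_ideal_vanishing_ideal: "is_ideal (vanishing_ideal X)"
  unfolding vanishing_ideal_def by (rule is_ideal_genideal)

lemma hc_hc: "hc d (hc e p) = (if d = e then hc d p else 0)"
  by (rule poly_mapping_eqI) (auto simp: lookup_hc)

lemma hc_vanishing_ideal: "f \<in> vanishing_ideal X \<Longrightarrow> hc d f \<in> vanishing_ideal X"
  by (auto simp: vanishing_ideal_eq hc_hc)

text \<open>Since \<open>s\<close> is homogeneous, each component of \<open>s * g\<close> is
  \<open>s\<close> times a component of \<open>g\<close>; evaluation is multiplicative, so the
  nonzero value of \<open>s\<close> cancels at every point.\<close>

lemma nzd_vanishing_ideal:
  assumes "s \<in> cox_comp e" "\<And>P a. P \<in> X \<Longrightarrow> a \<in> coordinates P \<Longrightarrow> eval_mpoly a s \<noteq> 0"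
  shows "nzd (vanishing_ideal X) s"
  unfolding nzd_def vanishing_ideal_eq mem_Collect_eq
proof (intro allI ballI impI)
  fix g d P a
  assume *: "\<forall>d. \<forall>P\<in>X. \<forall>a\<in>coordinates P. eval_mpoly a (hc d (s * g)) = 0" and P: "P \<in> X" "a \<in> coordinates P"
  have "eval_mpoly a (hc (d + e) (s * g)) = 0" using * P by blast
  moreover have "hc (d + e) (s * g) = s * hc d g" using hc_mult[OF assms(1), of "d + e" g] by simp
  ultimately show "eval_mpoly a (hc d g) = 0" using assms(2)[OF P] by (simp add: eval_mpoly_mult)
qed

lemma Rep_projE:
  fixes L :: "('k::field, 'n::finite) proj"
  obtains w where "w \<in> Rep_proj L" "w \<noteq> 0" "Rep_proj L = range (\<lambda>c. c *s w)"
proof -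
  have L: "vec.subspace (Rep_proj L)" "vec.dim (Rep_proj L) = 1" using Rep_proj[of L] by auto
  obtain B where B: "B \<subseteq> Rep_proj L" "vec.independent B" "Rep_proj L \<subseteq> vec.span B" "card B = 1"
    using vec.basis_exists[of "Rep_proj L"] L(2) by metis
  then obtain w where w: "B = {w}" by (metis card_1_singletonE)
  have "w \<noteq> 0" using B(2) w vec.dependent_zero by auto
  moreover have "Rep_proj L = vec.span {w}" using B(1,3) L(1) w vec.span_minimal by blast
  ultimately show ?thesis using that[of w] B(1) unfolding w vec.span_singleton by simp
qed

lemma coordinates_nonempty: "coordinates P \<noteq> {}"
proof -
  obtain u v where "u \<in> Rep_proj (fst P)" "u \<noteq> 0" "v \<in> Rep_proj (snd P)" "v \<noteq> 0"
    using Rep_projE by metis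
  then show ?thesis by (auto simp: coordinates_def)
qed

lemma one_notin_vanishing_ideal:
  assumes "X \<noteq> {}"
  shows "1 \<notin> vanishing_ideal X"
proof
  assume 1: "1 \<in> vanishing_ideal X"
  obtain P a where "P \<in> X" "a \<in> coordinates P" using assms coordinates_nonempty by blast
  then have "eval_mpoly a (hc 0 1) = 0" using 1 unfolding vanishing_ideal_eq by blast
  then show False by (simp add: eval_mpoly_1)
qed

text \<open>Over a finite field the product of all linear factors plus 1 is a nonconstant polynomial
  without roots.\<close>

lemma infinite_alg_closed: "infinite (UNIV :: 'k::alg_closed_field set)"
proof
  assume fin: "finite (UNIV :: 'k set)"
  define p where "p = (\<Prod>a\<in>(UNIV :: 'k set). [:- a, 1:]) + 1"
  have p: "poly p x = 1" for x
    by (simp add: p_def poly_prod) (rule prod_zero, use fin in auto)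
  have "degree (\<Prod>a\<in>(UNIV :: 'k set). [:- a, 1:]) = card (UNIV :: 'k set)"
    by (subst degree_prod_eq_sum_degree) auto
  moreover have "card (UNIV :: 'k set) > 0" using fin by (simp add: card_gt_0_iff)
  ultimately have "degree p > 0" unfolding p_def by (subst degree_add_eq_left) auto
  then show False using alg_closed_imp_poly_has_root[of p] p by auto
qed

lemma coordinatesE:
  assumes "a \<in> coordinates P"
  obtains u v where "u \<in> Rep_proj (fst P)" "u \<noteq> 0" "v \<in> Rep_proj (snd P)" "v \<noteq> 0"
    "\<forall>i. a (Inl i) = u $ i" "\<forall>j. a (Inr j) = v $ j"
proof -
  from assms obtain u v where "u \<in> Rep_proj (fst P) - {0}" "v \<in> Rep_proj (snd P) - {0}" "a = case_sum (($) u) (($) v)"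
    unfolding coordinates_def by blast
  then show ?thesis by (intro that[of u v]) auto
qed

text \<open>At a fixed point the two values are, up to nonzero scalars, nonzero polynomials in
  \<open>c\<close>: the coefficient vectors (1, c) and (1, c, c^2) trace curves that lie in no
  hyperplane. Finitely many points exclude finitely many \<open>c\<close>, so over an infinite field
  one \<open>c\<close> serves both forms.\<close>

lemma exists_nonvanishing_linear_forms:
  fixes X :: "'k::alg_closed_field point set"
  assumes "finite X"
  obtains c :: 'k where
    "\<And>P a. P \<in> X \<Longrightarrow> a \<in> coordinates P \<Longrightarrow>
       eval_mpoly a (mvar (Inl 1) + mconst c * mvar (Inl 2)) \<noteq> 0"
    "\<And>P a. P \<in> X \<Longrightarrow> a \<in> coordinates P \<Longrightarrow>
       eval_mpoly a (mvar (Inr 1) + (mconst c * mvar (Inr 2) + mconst (c^2) * mvar (Inr 3))) \<noteq> 0"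
proof -
  have "\<forall>P. \<exists>w :: 'k^2. w \<noteq> 0 \<and> Rep_proj (fst (P :: 'k point)) = range (\<lambda>c. c *s w)"
    using Rep_projE by metis
  then obtain w :: "'k point \<Rightarrow> 'k^2" where w: "\<And>P. w P \<noteq> 0" "\<And>P. Rep_proj (fst P) = range (\<lambda>c. c *s w P)"
    by metis
  have "\<forall>P. \<exists>w :: 'k^3. w \<noteq> 0 \<and> Rep_proj (snd (P :: 'k point)) = range (\<lambda>c. c *s w)"
    using Rep_projE by metis
  then obtain z :: "'k point \<Rightarrow> 'k^3" where z: "\<And>P. z P \<noteq> 0" "\<And>P. Rep_proj (snd P) = range (\<lambda>c. c *s z P)"
    by metis
  define p where "p P = [:w P $ 1, w P $ 2:]" for P
  define q where "q P = [:z P $ 1, z P $ 2, z P $ 3:]" for P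
  have "p P \<noteq> 0" for P using w(1)[of P] by (auto simp: p_def vec_eq_iff forall_2)
  moreover have "q P \<noteq> 0" for P using z(1)[of P] by (auto simp: q_def vec_eq_iff forall_3)
  ultimately have "finite (\<Union>P\<in>X. {c. poly (p P) c = 0} \<union> {c. poly (q P) c = 0})"
    using assms by (simp add: poly_roots_finite)
  then obtain c where c: "c \<notin> (\<Union>P\<in>X. {c. poly (p P) c = 0} \<union> {c. poly (q P) c = 0})"
    using ex_new_if_finite[OF infinite_alg_closed] by blast
  show ?thesis
  proof (rule that)
    fix P a assume P: "P \<in> X" "a \<in> coordinates P"
    obtain u v where uv: "u \<in> Rep_proj (fst P)" "u \<noteq> 0" "v \<in> Rep_proj (snd P)" "v \<noteq> 0"
      "\<forall>i. a (Inl i) = u $ i" "\<forall>j. a (Inr j) = v $ j"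
      by (rule coordinatesE[OF P(2)])
    obtain s t where s: "u = s *s w P" "v = t *s z P" using uv w z by auto
    then have nz: "s \<noteq> 0" "t \<noteq> 0" using uv by auto
    have "w P $ 1 + c * w P $ 2 \<noteq> 0" "z P $ 1 + c * (z P $ 2 + c * z P $ 3) \<noteq> 0"
      using c P(1) by (auto simp: p_def q_def)
    then have "s * (w P $ 1 + c * w P $ 2) \<noteq> 0" "t * (z P $ 1 + c * (z P $ 2 + c * z P $ 3)) \<noteq> 0"
      using nz by auto
    then show "eval_mpoly a (mvar (Inl 1) + mconst c * mvar (Inl 2)) \<noteq> 0"
      "eval_mpoly a (mvar (Inr 1) + (mconst c * mvar (Inr 2) + mconst (c^2) * mvar (Inr 3))) \<noteq> 0"
      by (simp_all add: eval_mpoly_add eval_mpoly_mult eval_mpoly_mvar eval_mpoly_mconst uv(5)[rule_format] uv(6)[rule_format] s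
          algebra_simps power2_eq_square)
  qed
qed

section \<open>Hilbert matrices\<close>

lemma subfield_mconst: "subfield (range mconst) (cox_ring :: 'k::field cox ring)"
proof (rule cox.subfieldI)
  have neg: "\<ominus>\<^bsub>cox_ring\<^esub> p = - p" for p :: "'k cox" by (rule cox.minus_equality) auto
  show "subcring (range mconst) (cox_ring :: 'k cox ring)"
  proof (rule cox.subcringI', rule cox.subringI)
    show "\<one>\<^bsub>cox_ring\<^esub> \<in> range (mconst :: 'k \<Rightarrow> 'k cox)"
      by (simp, rule range_eqI[of _ _ 1]) simp
  qed (auto simp: neg mconst_uminus[symmetric] mconst_mult[symmetric] mconst_add[symmetric])
  show "Units (cox_ring\<lparr>carrier := range mconst\<rparr>) = range mconst - {\<zero>\<^bsub>cox_ring :: 'k cox ring\<^esub>}"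
  proof (intro equalityI subsetI)
    fix p assume "p \<in> range mconst - {\<zero>\<^bsub>cox_ring :: 'k cox ring\<^esub>}"
    then obtain c :: 'k where c: "p = mconst c" "p \<noteq> 0" by auto
    then have "c \<noteq> 0" by auto
    with c have c: "p = mconst c" "c \<noteq> 0" by auto
    then have "mconst (1 / c) * p = 1" by (simp add: mconst_mult[symmetric])
    then show "p \<in> Units (cox_ring\<lparr>carrier := range mconst\<rparr>)"
      unfolding Units_def using c by (auto simp: mult.commute intro!: bexI[of _ "mconst (1 / c)"])
  next
    fix p :: "'k cox" assume "p \<in> Units (cox_ring\<lparr>carrier := range mconst\<rparr>)"
    then obtain q where "p \<in> range mconst" "p * q = 1" unfolding Units_def by auto
    then show "p \<in> range mconst - {\<zero>\<^bsub>cox_ring\<^esub>}" by auto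
  qed
qed

lemma coset_eq: "J +>\<^bsub>cox_ring\<^esub> p = {j + p | j. j \<in> J}"
  by (auto simp: a_r_coset_def')

lemma coset_eq_iff:
  assumes "is_ideal J"
  shows "J +>\<^bsub>cox_ring\<^esub> p = J +>\<^bsub>cox_ring\<^esub> q \<longleftrightarrow> p - q \<in> J"
proof
  assume *: "J +>\<^bsub>cox_ring\<^esub> p = J +>\<^bsub>cox_ring\<^esub> q"
  have "0 + p \<in> J +>\<^bsub>cox_ring\<^esub> p" using is_ideal_0[OF assms] unfolding coset_eq by blast
  then obtain j where "0 + p = j + q" "j \<in> J" unfolding * unfolding coset_eq by blast
  then show "p - q \<in> J" by simp
next
  assume pq: "p - q \<in> J"
  have "j + p = (j + (p - q)) + q" "j + q = (j - (p - q)) + p" for j by simp_all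
  then show "J +>\<^bsub>cox_ring\<^esub> p = J +>\<^bsub>cox_ring\<^esub> q"
    using pq is_ideal_add[OF assms] is_ideal_diff[OF assms] unfolding coset_eq by blast
qed

text \<open>Relates the inductively defined dimension in the quotient ring to vector space
  dimension. A basis of the part of V in J is extended to one of V, and the added vectors enter one
  at a time as line extensions. They stay independent modulo J, since a relation would put a
  combination of them into the span of \<open>B0\<close>.\<close>

lemma quotient_dim:
  fixes J V :: "'k::field cox set"
  assumes J: "is_ideal J" "1 \<notin> J" and V: "vc.subspace V" "fin_dim vc.span V"
  shows "ring.dim (cox_ring Quot J) (range (\<lambda>c. J +>\<^bsub>cox_ring\<^esub> mconst c)) ((\<lambda>p. J +>\<^bsub>cox_ring\<^esub> p) ` V)
    + vc.dim (V \<inter> J) = vc.dim V"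
proof -
  let ?R = "cox_ring Quot J" and ?\<pi> = "\<lambda>p. J +>\<^bsub>cox_ring\<^esub> p"
  let ?K = "range (\<lambda>c. ?\<pi> (mconst c))"
  interpret J: ideal J cox_ring by (rule is_ideal_imp_ideal[OF J(1)])
  interpret h: ring_hom_ring cox_ring ?R ?\<pi> by (rule J.rcos_ring_hom_ring)
  have K: "?K = ?\<pi> ` range mconst" by auto
  have "\<one>\<^bsub>?R\<^esub> \<noteq> \<zero>\<^bsub>?R\<^esub>"
    using coset_eq_iff[OF J(1), of 1 0] J(2) h.hom_one h.hom_zero by simp
  then have sub: "subfield ?K ?R" unfolding K by (rule h.img_is_subfield[OF subfield_mconst])
  obtain B0 where B0: "B0 \<subseteq> V \<inter> J" "vc.independent B0" "V \<inter> J \<subseteq> vc.span B0" "card B0 = vc.dim (V \<inter> J)"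
    by (rule vc.basis_exists)
  obtain B where B: "B0 \<subseteq> B" "B \<subseteq> V" "vc.independent B" "V \<subseteq> vc.span B"
    using vc.maximal_independent_subset_extend[of B0 V] B0 by blast
  have finB: "finite B" by (rule ck.independent_finite[OF V(2) B(3,2)])
  have spanV: "vc.span C \<subseteq> V" if "C \<subseteq> B" for C
    by (rule vc.span_minimal[OF _ V(1)]) (use that B(2) in auto)
  have *: "h.S.dimension (card C) ?K (?\<pi> ` vc.span C)" if "C \<subseteq> B - B0" for C
    using finite_subset[OF that finite_Diff[OF finB]] that
  proof (induction C)
    case empty
    have "?\<pi> ` vc.span {} = {\<zero>\<^bsub>?R\<^esub>}" using h.hom_zero by simp
    then show ?case using h.S.dimension.intros(1) by simp
  next
    case (insert c C)
    have "?\<pi> c \<notin> ?\<pi> ` vc.span C"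
    proof
      assume "?\<pi> c \<in> ?\<pi> ` vc.span C"
      then obtain s where s: "s \<in> vc.span C" "c - s \<in> J" using coset_eq_iff[OF J(1)] by blast
      have "c \<in> V" "s \<in> V" using insert.prems B(2) spanV[of C] s by auto
      then have "c - s \<in> vc.span B0" using s(2) V(1) vc.subspace_diff B0(3) by blast
      then have "(c - s) + s \<in> vc.span (B0 \<union> C)"
        using s(1) vc.span_mono[of B0 "B0 \<union> C"] vc.span_mono[of C "B0 \<union> C"] by (intro vc.span_add) auto
      moreover have "B0 \<union> C \<subseteq> B - {c}" using insert B(1) by auto
      ultimately have "c \<in> vc.span (B - {c})"
        using vc.span_mono[of "B0 \<union> C" "B - {c}"] unfolding diff_add_cancel by blast
      moreover have "c \<in> B" using insert.prems by auto
      ultimately show False using B(3) vc.dependent_def by blast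
    qed
    then have "h.S.dimension (Suc (card C)) ?K (h.S.line_extension ?K (?\<pi> c) (?\<pi> ` vc.span C))"
      using insert.prems \<open>?\<pi> c \<notin> ?\<pi> ` vc.span C\<close> insert.IH
      by (intro h.S.dimension.intros(2) h.hom_closed) simp_all
    moreover have "h.S.line_extension ?K (?\<pi> c) (?\<pi> ` vc.span C) = ?\<pi> ` vc.span (insert c C)"
    proof -
      have hom: "(?\<pi> (mconst k) \<otimes>\<^bsub>?R\<^esub> ?\<pi> c) \<oplus>\<^bsub>?R\<^esub> ?\<pi> s = ?\<pi> (mconst k * c + s)" for k s
        by (simp add: h.hom_mult[symmetric] h.hom_add[symmetric])
      have "h.S.line_extension ?K (?\<pi> c) (?\<pi> ` vc.span C) = {?\<pi> (mconst k * c + s) | k s. s \<in> vc.span C}"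
        unfolding h.S.line_extension_def set_add_def' r_coset_def by (auto simp: hom)
      also have "\<dots> = ?\<pi> ` vc.span (insert c C)"
      proof (intro equalityI subsetI)
        fix y assume "y \<in> ?\<pi> ` vc.span (insert c C)"
        then obtain x k where "y = ?\<pi> x" "x - mconst k * c \<in> vc.span C" by (auto simp: vc.span_insert)
        then show "y \<in> {?\<pi> (mconst k * c + s) | k s. s \<in> vc.span C}"
          by (intro CollectI exI[of _ k] exI[of _ "x - mconst k * c"]) simp
      next
        fix y assume "y \<in> {?\<pi> (mconst k * c + s) | k s. s \<in> vc.span C}"
        then obtain k s where "y = ?\<pi> (mconst k * c + s)" "s \<in> vc.span C" by blast
        then show "y \<in> ?\<pi> ` vc.span (insert c C)"
          by (intro image_eqI) (auto simp: vc.span_insert intro!: exI[of _ k])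
      qed
      finally show ?thesis .
    qed
    ultimately show ?case using insert by simp
  qed
  have "?\<pi> ` vc.span (B - B0) = ?\<pi> ` V"
  proof (intro equalityI subsetI)
    fix y assume "y \<in> ?\<pi> ` V"
    then obtain x where x: "y = ?\<pi> x" "x \<in> vc.span (B0 \<union> (B - B0))" using B(1,4) by (auto simp: Un_absorb1)
    then obtain s t where st: "s \<in> vc.span B0" "t \<in> vc.span (B - B0)" "x = s + t"
      unfolding vc.span_Un by blast
    have "vc.subspace J" using is_ideal_add[OF J(1)] is_ideal_mult[OF J(1)] is_ideal_0[OF J(1)]
      unfolding vc.subspace_def by blast
    then have "s \<in> J" using st(1) B0(1) vc.span_minimal[of B0 J] by auto
    then have "?\<pi> x = ?\<pi> t" by (simp add: coset_eq_iff[OF J(1)] st)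
    then show "y \<in> ?\<pi> ` vc.span (B - B0)" using x st by blast
  next
    fix y assume "y \<in> ?\<pi> ` vc.span (B - B0)"
    then show "y \<in> ?\<pi> ` V" using spanV[of "B - B0"] by blast
  qed
  then have "ring.dim ?R ?K (?\<pi> ` V) = card (B - B0)"
    using h.S.dimI[OF sub *[OF order_refl]] by (simp add: over_def)
  moreover have "vc.dim V = card B" using vc.basis_card_eq_dim[OF B(2,4,3)] by simp
  moreover have "card B = card B0 + card (B - B0)"
    using B(1) finB finite_subset by (metis card_Diff_subset card_mono le_add_diff_inverse)
  ultimately show ?thesis using B0(4) by simp
qed

lemma hilbert_matrix_dim:
  assumes "X \<noteq> {}"
  shows "hilbert_matrix X i j + int (vc.dim (cox_comp (i, j) \<inter> vanishing_ideal X)) = int (mono_count (i, j))"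
  using quotient_dim[OF is_ideal_vanishing_ideal one_notin_vanishing_ideal[OF assms]
      cox_comp_subspace cox_comp_fin_dim, of "(i, j)"]
  unfolding hilbert_matrix_def cox_comp_dim by linarith

interpretation cc: vector_space_pair "\<lambda>(c::'k::field) (p::'k cox). mconst c * p" "\<lambda>(c::'k::field) (p::'k cox). mconst c * p" ..

text \<open>Multiplication by \<open>s\<close> is injective from degree \<open>d - e\<close> to
  degree \<open>d\<close> of S/J, between spaces of equal finite dimension. The quotient in degree
  \<open>d\<close> is modelled by the linear map \<open>\<rho>\<close>, which kills a basis of the
  part in J and fixes a complement.\<close>

lemma nzd_surj:
  fixes J :: "'k::field cox set"
  assumes J: "is_ideal J" and s: "s \<in> cox_comp e" "nzd J s"
    and dim: "int (mono_count (d - e)) - int (vc.dim (cox_comp (d - e) \<inter> J))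
      = int (mono_count d) - int (vc.dim (cox_comp d \<inter> J))"
    and p: "p \<in> cox_comp d"
  shows "\<exists>g\<in>cox_comp (d - e). p - s * g \<in> J"
proof -
  obtain B0 where B0: "B0 \<subseteq> cox_comp d \<inter> J" "vc.independent B0" "cox_comp d \<inter> J \<subseteq> vc.span B0"
    by (rule vc.basis_exists)
  obtain B where B: "B0 \<subseteq> B" "B \<subseteq> cox_comp d" "vc.independent B" "cox_comp d \<subseteq> vc.span B"
    using vc.maximal_independent_subset_extend[of B0 "cox_comp d"] B0 by blast
  obtain \<rho> where lin: "Vector_Spaces.linear (\<lambda>c p. mconst c * p) (\<lambda>c p. mconst c * p) \<rho>"
    and \<rho>: "\<And>x. x \<in> B \<Longrightarrow> \<rho> x = (if x \<in> B0 then 0 else x)"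
    using cc.linear_independent_extend[OF B(3), of "\<lambda>x. if x \<in> B0 then 0 else x"] by blast
  interpret \<rho>: Vector_Spaces.linear "\<lambda>c p. mconst c * p" "\<lambda>c p. mconst c * p" \<rho> by (rule lin)
  have Jsub: "vc.subspace (cox_comp d \<inter> J)"
    using is_ideal_add[OF J] is_ideal_mult[OF J] is_ideal_0[OF J]
    unfolding vc.subspace_def by (blast intro: cox_comp_add cox_comp_mconst_mult cox_comp_0)
  have ker: "\<rho> x = 0 \<longleftrightarrow> x \<in> J" if x: "x \<in> cox_comp d" for x
  proof -
    have "x \<in> vc.span (B0 \<union> (B - B0))" using B(1,4) x by (auto simp: Un_absorb1)
    then obtain y z where yz: "y \<in> vc.span B0" "z \<in> vc.span (B - B0)" "x = y + z"
      unfolding vc.span_Un by blast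
    have "\<rho> y = (\<lambda>_. 0) y"
      by (rule cc.linear_eq_on[OF lin cc.linear_zero yz(1)]) (use \<rho> B(1) in auto)
    moreover have "\<rho> z = (\<lambda>z. z) z"
      by (rule cc.linear_eq_on[OF lin vc.linear_ident yz(2)]) (use \<rho> in auto)
    ultimately have \<rho>x: "\<rho> x = z" by (simp add: yz(3) \<rho>.add)
    have y: "y \<in> cox_comp d \<inter> J" using yz(1) B0(1) vc.span_minimal[OF B0(1) Jsub] by blast
    show ?thesis
    proof
      assume "\<rho> x = 0" then show "x \<in> J" using \<rho>x yz(3) y by simp
    next
      assume "x \<in> J"
      then have "x - y \<in> cox_comp d \<inter> J" using x y is_ideal_diff[OF J] cox_comp_diff by blast
      then have "z \<in> vc.span B0" using B0(3) yz(3) by auto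
      then show "\<rho> x = 0" using cc.span_Int_complement[OF B(3,1) _ yz(2)] \<rho>x by simp
    qed
  qed
  have sd: "s * g \<in> cox_comp d" if "g \<in> cox_comp (d - e)" for g
    using cox_comp_mult[OF s(1) that] by simp
  have lin_s: "Vector_Spaces.linear (\<lambda>c p. mconst c * p) (\<lambda>c p. mconst c * p) (\<lambda>g. \<rho> (s * g))"
  proof unfold_locales
    show "\<rho> (s * (a + b)) = \<rho> (s * a) + \<rho> (s * b)" for a b by (simp add: distrib_left \<rho>.add)
    show "\<rho> (s * (mconst c * b)) = mconst c * \<rho> (s * b)" for c b
      by (simp add: mult.left_commute[of s] \<rho>.scale)
  qed
  have fd: "fin_dim vc.span (f ` cox_comp d')"
    if "Vector_Spaces.linear (\<lambda>c p. mconst c * p) (\<lambda>c p. mconst c * p) f" for f :: "'k cox \<Rightarrow> 'k cox" and d'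
  proof -
    obtain A where "finite A" "cox_comp d' \<subseteq> vc.span (A :: 'k cox set)" using cox_comp_fin_dim unfolding fin_dim_def by blast
    then have "finite (f ` A)" "f ` cox_comp d' \<subseteq> vc.span (f ` A)"
      using cc.linear_span_image[OF that, of A] by auto
    then show ?thesis unfolding fin_dim_def by blast
  qed
  have "\<rho> (s * g) = 0 \<longleftrightarrow> g \<in> J" if "g \<in> cox_comp (d - e)" for g
    using ker[OF sd[OF that]] s(2) is_ideal_mult[OF J, of g s] unfolding nzd_def by blast
  then have k1: "{g \<in> cox_comp (d - e). \<rho> (s * g) = 0} = cox_comp (d - e) \<inter> J" by blast
  have "mono_count (d - e) = vc.dim (cox_comp (d - e) \<inter> J) + vc.dim ((\<lambda>g. \<rho> (s * g)) ` cox_comp (d - e))"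
    using cc.rank_nullity(2)[OF lin_s cox_comp_subspace _ fd[OF lin_s], of "d - e"]
      fin_dim_subset[OF cox_comp_fin_dim Int_lower1, of "d - e" J]
    unfolding k1 cox_comp_dim by blast
  moreover have k2: "{x \<in> cox_comp d. \<rho> x = 0} = cox_comp d \<inter> J" using ker by blast
  have "mono_count d = vc.dim (cox_comp d \<inter> J) + vc.dim (\<rho> ` cox_comp d)"
    using cc.rank_nullity(2)[OF lin cox_comp_subspace _ fd[OF lin], of d]
      fin_dim_subset[OF cox_comp_fin_dim Int_lower1, of d J]
    unfolding k2 cox_comp_dim by blast
  ultimately have le: "vc.dim (\<rho> ` cox_comp d) \<le> vc.dim ((\<lambda>g. \<rho> (s * g)) ` cox_comp (d - e))"
    using dim by linarith
  have "(\<lambda>g. \<rho> (s * g)) ` cox_comp (d - e) = \<rho> ` cox_comp d"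
  proof (rule cc.subspace_eqI_dim[OF fd[OF lin] _ _ le])
    show "vc.subspace ((\<lambda>g. \<rho> (s * g)) ` cox_comp (d - e))"
      by (rule cc.linear_subspace_image[OF lin_s cox_comp_subspace])
  qed (use sd in auto)
  then obtain g where g: "g \<in> cox_comp (d - e)" "\<rho> p = \<rho> (s * g)" using p by (metis image_iff)
  then have "\<rho> (p - s * g) = 0" by (simp add: \<rho>.diff)
  then have "p - s * g \<in> J" using ker[of "p - s * g"] p sd[OF g(1)] cox_comp_diff by blast
  then show ?thesis using g(1) by blast
qed

section \<open>Quotients of graded modules\<close>

text \<open>A weak form of module, an additive group with an additive action of scalars: what the
  formation of quotients by \<open>gsubm\<close> relies on.\<close>

definition gmod :: "('a, 'm) gmodule \<Rightarrow> bool"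
  where "gmod M \<longleftrightarrow> abelian_group M \<and> (\<forall>r. \<forall>u\<in>carrier M. r \<odot>\<^bsub>M\<^esub> u \<in> carrier M) \<and>
    (\<forall>r. \<forall>u\<in>carrier M. \<forall>v\<in>carrier M. r \<odot>\<^bsub>M\<^esub> (u \<oplus>\<^bsub>M\<^esub> v) = r \<odot>\<^bsub>M\<^esub> u \<oplus>\<^bsub>M\<^esub> r \<odot>\<^bsub>M\<^esub> v)"

definition gsubm :: "('a, 'm) gmodule \<Rightarrow> 'm set \<Rightarrow> bool"
  where "gsubm M N \<longleftrightarrow> N \<subseteq> carrier M \<and> \<zero>\<^bsub>M\<^esub> \<in> N \<and> (\<forall>u\<in>N. \<forall>v\<in>N. u \<oplus>\<^bsub>M\<^esub> v \<in> N) \<and>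
    (\<forall>u\<in>N. \<exists>v\<in>N. v \<oplus>\<^bsub>M\<^esub> u = \<zero>\<^bsub>M\<^esub>) \<and> (\<forall>r. \<forall>u\<in>N. r \<odot>\<^bsub>M\<^esub> u \<in> N)"

lemma gsubm_abelian_subgroup:
  assumes "gmod M" "gsubm M N"
  shows "abelian_subgroup N M"
proof -
  interpret abelian_group M using assms by (simp add: gmod_def)
  have "additive_subgroup N M"
  proof (rule additive_subgroup.intro, rule add.subgroupI)
    fix u assume u: "u \<in> N"
    then obtain v where v: "v \<in> N" "v \<oplus>\<^bsub>M\<^esub> u = \<zero>\<^bsub>M\<^esub>" using assms by (auto simp: gsubm_def)
    then have "\<ominus>\<^bsub>M\<^esub> u = v" using u assms by (intro minus_equality) (auto simp: gsubm_def)
    then show "\<ominus>\<^bsub>M\<^esub> u \<in> N" using v by simp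
  qed (use assms in \<open>auto simp: gsubm_def\<close>)
  then show ?thesis by (rule abelian_subgroupI3) (rule abelian_group_axioms)
qed

lemma gquot_simps:
  "carrier (gquot M N) = (\<lambda>u. N +>\<^bsub>M\<^esub> u) ` carrier M" "\<zero>\<^bsub>gquot M N\<^esub> = N"
  "gcomp (gquot M N) d = (\<lambda>u. N +>\<^bsub>M\<^esub> u) ` gcomp M d"
  by (auto simp: gquot_def A_RCOSETS_def')

lemma gquot_coset_eq_iff:
  assumes "gmod M" "gsubm M N" "u \<in> carrier M" "v \<in> carrier M"
  shows "N +>\<^bsub>M\<^esub> u = N +>\<^bsub>M\<^esub> v \<longleftrightarrow> (\<exists>n\<in>N. u = n \<oplus>\<^bsub>M\<^esub> v)"
proof -
  interpret abelian_subgroup N M by (rule gsubm_abelian_subgroup[OF assms(1,2)])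
  have "N +>\<^bsub>M\<^esub> u = N +>\<^bsub>M\<^esub> v \<longleftrightarrow> u \<in> N +>\<^bsub>M\<^esub> v"
    using a_rcos_self[OF assms(3)] a_repr_independence[OF _ assms(4) a_subgroup] by auto
  then show ?thesis by (auto simp: a_r_coset_def')
qed

lemma gquot_coset_zero:
  assumes "gmod M" "gsubm M N"
  shows "N +>\<^bsub>M\<^esub> \<zero>\<^bsub>M\<^esub> = N"
proof -
  interpret abelian_subgroup N M by (rule gsubm_abelian_subgroup[OF assms])
  show ?thesis by (rule a_coset_join2[OF _ a_subgroup]) auto
qed

lemma gquot_add:
  assumes "gmod M" "gsubm M N" "u \<in> carrier M" "v \<in> carrier M"
  shows "(N +>\<^bsub>M\<^esub> u) \<oplus>\<^bsub>gquot M N\<^esub> (N +>\<^bsub>M\<^esub> v) = N +>\<^bsub>M\<^esub> (u \<oplus>\<^bsub>M\<^esub> v)"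
proof -
  interpret abelian_subgroup N M by (rule gsubm_abelian_subgroup[OF assms(1,2)])
  show ?thesis using a_rcos_sum[OF assms(3,4)] by (simp add: gquot_def)
qed

text \<open>The union in the definition of the scalar action is one of equal cosets, as two
  representatives differ by an element of \<open>N\<close>.\<close>

lemma gquot_smult:
  assumes "gmod M" "gsubm M N" "u \<in> carrier M"
  shows "r \<odot>\<^bsub>gquot M N\<^esub> (N +>\<^bsub>M\<^esub> u) = N +>\<^bsub>M\<^esub> (r \<odot>\<^bsub>M\<^esub> u)"
proof -
  interpret abelian_subgroup N M by (rule gsubm_abelian_subgroup[OF assms(1,2)])
  have "N +>\<^bsub>M\<^esub> (r \<odot>\<^bsub>M\<^esub> v) = N +>\<^bsub>M\<^esub> (r \<odot>\<^bsub>M\<^esub> u)" if v: "v \<in> N +>\<^bsub>M\<^esub> u" for v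
  proof -
    obtain n where n: "n \<in> N" "v = n \<oplus>\<^bsub>M\<^esub> u" using v by (auto simp: a_r_coset_def')
    then have nc: "n \<in> carrier M" using a_Hcarr by auto
    have "r \<odot>\<^bsub>M\<^esub> v = r \<odot>\<^bsub>M\<^esub> n \<oplus>\<^bsub>M\<^esub> r \<odot>\<^bsub>M\<^esub> u" "r \<odot>\<^bsub>M\<^esub> n \<in> N"
      using assms nc n by (auto simp: gmod_def gsubm_def)
    moreover have "r \<odot>\<^bsub>M\<^esub> v \<in> carrier M" "r \<odot>\<^bsub>M\<^esub> u \<in> carrier M"
      using assms nc n by (auto simp: gmod_def)
    ultimately show ?thesis by (subst gquot_coset_eq_iff[OF assms(1,2)]) auto
  qed
  then have "(\<Union>v\<in>N +>\<^bsub>M\<^esub> u. N +>\<^bsub>M\<^esub> (r \<odot>\<^bsub>M\<^esub> v)) = (\<Union>v\<in>N +>\<^bsub>M\<^esub> u. N +>\<^bsub>M\<^esub> (r \<odot>\<^bsub>M\<^esub> u))"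
    by (rule SUP_cong[OF refl])
  also have "\<dots> = N +>\<^bsub>M\<^esub> (r \<odot>\<^bsub>M\<^esub> u)" using a_rcos_self[OF assms(3)] by blast
  finally show ?thesis by (simp add: gquot_def)
qed

lemma gmod_gquot:
  assumes "gmod M" "gsubm M N"
  shows "gmod (gquot M N)"
proof -
  interpret abelian_group M using assms by (simp add: gmod_def)
  note add = gquot_add[OF assms] and smult = gquot_smult[OF assms]
  have zero: "\<zero>\<^bsub>gquot M N\<^esub> = N +>\<^bsub>M\<^esub> \<zero>\<^bsub>M\<^esub>" by (simp add: gquot_simps gquot_coset_zero[OF assms])
  have sc: "r \<odot>\<^bsub>M\<^esub> u \<in> carrier M" if "u \<in> carrier M" for r u using assms that by (auto simp: gmod_def)
  have "abelian_group (gquot M N)"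
  proof (rule abelian_groupI)
    fix x assume "x \<in> carrier (gquot M N)"
    then obtain u where u: "u \<in> carrier M" "x = N +>\<^bsub>M\<^esub> u" by (auto simp: gquot_simps)
    have "(N +>\<^bsub>M\<^esub> (\<ominus>\<^bsub>M\<^esub> u)) \<oplus>\<^bsub>gquot M N\<^esub> x = \<zero>\<^bsub>gquot M N\<^esub>"
      using u by (simp add: add zero l_neg)
    then show "\<exists>y\<in>carrier (gquot M N). y \<oplus>\<^bsub>gquot M N\<^esub> x = \<zero>\<^bsub>gquot M N\<^esub>"
      using u by (intro bexI[of _ "N +>\<^bsub>M\<^esub> (\<ominus>\<^bsub>M\<^esub> u)"]) (auto simp: gquot_simps(1))
  next
    show "\<zero>\<^bsub>gquot M N\<^esub> \<in> carrier (gquot M N)" unfolding zero by (simp add: gquot_simps(1))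
  next
    fix x assume "x \<in> carrier (gquot M N)"
    then show "\<zero>\<^bsub>gquot M N\<^esub> \<oplus>\<^bsub>gquot M N\<^esub> x = x" unfolding zero by (auto simp: gquot_simps(1) add)
  next
    fix x y z assume "x \<in> carrier (gquot M N)" "y \<in> carrier (gquot M N)" "z \<in> carrier (gquot M N)"
    then obtain u v w where "u \<in> carrier M" "x = N +>\<^bsub>M\<^esub> u" "v \<in> carrier M" "y = N +>\<^bsub>M\<^esub> v"
      "w \<in> carrier M" "z = N +>\<^bsub>M\<^esub> w" unfolding gquot_simps(1) by blast
    then show "x \<oplus>\<^bsub>gquot M N\<^esub> y \<oplus>\<^bsub>gquot M N\<^esub> z = x \<oplus>\<^bsub>gquot M N\<^esub> (y \<oplus>\<^bsub>gquot M N\<^esub> z)"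
      by (simp add: add a_assoc)
  next
    fix x y assume "x \<in> carrier (gquot M N)" "y \<in> carrier (gquot M N)"
    then obtain u v where *: "u \<in> carrier M" "x = N +>\<^bsub>M\<^esub> u" "v \<in> carrier M" "y = N +>\<^bsub>M\<^esub> v"
      unfolding gquot_simps(1) by blast
    then show "x \<oplus>\<^bsub>gquot M N\<^esub> y = y \<oplus>\<^bsub>gquot M N\<^esub> x" by (simp add: add a_comm)
    show "x \<oplus>\<^bsub>gquot M N\<^esub> y \<in> carrier (gquot M N)" using * by (simp add: add gquot_simps(1))
  qed
  then show ?thesis using assms unfolding gmod_def[of "gquot M N"]
    by (auto simp: gquot_simps(1) add smult sc gmod_def)
qed

lemma gsub_simps [simp]:
  "carrier (gsub M N) = N" "\<zero>\<^bsub>gsub M N\<^esub> = \<zero>\<^bsub>M\<^esub>" "(\<oplus>\<^bsub>gsub M N\<^esub>) = (\<oplus>\<^bsub>M\<^esub>)"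
  "(\<odot>\<^bsub>gsub M N\<^esub>) = (\<odot>\<^bsub>M\<^esub>)" "gcomp (gsub M N) d = gcomp M d \<inter> N"
  by (simp_all add: gsub_def)

lemma gmod_gsub:
  assumes "gmod M" "gsubm M N"
  shows "gmod (gsub M N)"
proof -
  interpret abelian_group M using assms by (simp add: gmod_def)
  have sub: "u \<in> carrier M" if "u \<in> N" for u using assms that by (auto simp: gsubm_def)
  have "abelian_group (gsub M N)"
  proof (rule abelian_groupI; unfold gsub_simps)
    show "\<zero>\<^bsub>M\<^esub> \<in> N" "\<And>x y. x \<in> N \<Longrightarrow> y \<in> N \<Longrightarrow> x \<oplus>\<^bsub>M\<^esub> y \<in> N"
      "\<And>x. x \<in> N \<Longrightarrow> \<exists>y\<in>N. y \<oplus>\<^bsub>M\<^esub> x = \<zero>\<^bsub>M\<^esub>"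
      using assms(2) by (simp_all add: gsubm_def)
  qed (simp_all add: sub a_ac)
  moreover have "r \<odot>\<^bsub>M\<^esub> u \<in> N" if "u \<in> N" for r u using assms(2) that by (simp add: gsubm_def)
  ultimately show ?thesis using assms(1) sub by (simp add: gmod_def)
qed

text \<open>The first isomorphism theorem in graded form. The kernel enters through the condition
  that two values agree, so that no differences need to be formed.\<close>

lemma gmodule_isoI:
  assumes M: "gmod M" "gsubm M K"
    and add: "\<And>u v. u \<in> carrier M \<Longrightarrow> v \<in> carrier M \<Longrightarrow> \<phi> (u \<oplus>\<^bsub>M\<^esub> v) = \<phi> u \<oplus>\<^bsub>N\<^esub> \<phi> v"
    and smult: "\<And>r u. u \<in> carrier M \<Longrightarrow> \<phi> (r \<odot>\<^bsub>M\<^esub> u) = r \<odot>\<^bsub>N\<^esub> \<phi> u"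
    and surj: "\<phi> ` carrier M = carrier N"
    and ker: "\<And>u v. u \<in> carrier M \<Longrightarrow> v \<in> carrier M \<Longrightarrow> \<phi> u = \<phi> v \<longleftrightarrow> (\<exists>k\<in>K. u = k \<oplus>\<^bsub>M\<^esub> v)"
    and comp: "\<And>d. \<phi> ` gcomp M d = gcomp N d" "\<And>d. gcomp M d \<subseteq> carrier M"
  shows "gmodule_iso (gquot M K) N"
proof -
  interpret abelian_group M using M by (simp add: gmod_def)
  define f where "f C = \<phi> (SOME u. u \<in> carrier M \<and> C = K +>\<^bsub>M\<^esub> u)" for C
  have f: "f (K +>\<^bsub>M\<^esub> u) = \<phi> u" if u: "u \<in> carrier M" for u
  proof -
    let ?v = "SOME v. v \<in> carrier M \<and> K +>\<^bsub>M\<^esub> u = K +>\<^bsub>M\<^esub> v"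
    have v: "?v \<in> carrier M \<and> K +>\<^bsub>M\<^esub> u = K +>\<^bsub>M\<^esub> ?v" by (rule someI[of _ u]) (simp add: u)
    have "\<phi> u = \<phi> ?v"
      using ker[OF u conjunct1[OF v]] gquot_coset_eq_iff[OF M u conjunct1[OF v]] conjunct2[OF v] by simp
    then show ?thesis unfolding f_def by simp
  qed
  have sc: "r \<odot>\<^bsub>M\<^esub> u \<in> carrier M" if "u \<in> carrier M" for r u using M that by (auto simp: gmod_def)
  have inj: "inj_on f (carrier (gquot M K))"
  proof (rule inj_onI)
    fix x y assume "x \<in> carrier (gquot M K)" "y \<in> carrier (gquot M K)" and eq: "f x = f y"
    then obtain u v where *: "u \<in> carrier M" "x = K +>\<^bsub>M\<^esub> u" "v \<in> carrier M" "y = K +>\<^bsub>M\<^esub> v"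
      unfolding gquot_simps(1) by blast
    then have "\<phi> u = \<phi> v" using eq f by simp
    then show "x = y" using * ker gquot_coset_eq_iff[OF M] by simp
  qed
  have "f ` carrier (gquot M K) = carrier N" unfolding surj[symmetric] gquot_simps(1) image_image
    by (rule image_cong) (auto simp: f)
  then have "f \<in> iso (add_monoid (gquot M K)) (add_monoid N)"
    using inj surj by (auto simp: iso_def hom_def bij_betw_def gquot_simps(1) gquot_add[OF M] f add)
  moreover have "f ` gcomp (gquot M K) d = gcomp N d" for d
    unfolding comp(1)[symmetric] gquot_simps image_image
    by (rule image_cong[OF refl], rule f) (use comp(2)[of d] in blast)
  ultimately show ?thesis unfolding gmodule_iso_def
    by (intro bexI[of _ f]) (auto simp: gquot_simps(1) gquot_smult[OF M] f smult sc)
qed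

section \<open>Homology of a complex of free modules\<close>

lemma free_gmodule_simps [simp]:
  "\<zero>\<^bsub>free_gmodule F i\<^esub> = 0" "u \<oplus>\<^bsub>free_gmodule F i\<^esub> v = u + v" "r \<odot>\<^bsub>free_gmodule F i\<^esub> u = smf r u"
  by (auto simp: free_gmodule_def fun_eq_iff smf_def)

lemma elems_0 [simp]: "0 \<in> elems F i"
  by (simp add: mem_elems)

lemma elems_uminus: "u \<in> elems F i \<Longrightarrow> - u \<in> elems F i"
  by (simp add: mem_elems)

lemma gmod_free: "gmod (free_gmodule (F :: 'k::field gcomplex) i)"
proof -
  have "abelian_group (free_gmodule (F :: 'k gcomplex) i)"
    by (rule abelian_groupI)
      (auto simp: elems_add add.assoc add.commute intro!: bexI[of _ "- _"] elems_uminus)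
  then show ?thesis by (auto simp: gmod_def elems_smf fun_eq_iff distrib_left)
qed

context graded_cx
begin

lemma cycles_Suc: "cycles F (Suc i) = {u \<in> elems F (Suc i). differential F i u = 0}"
  by (simp add: cycles_def zero_fun_def)

lemma cycles_0: "cycles F 0 = elems F 0"
  by (simp add: cycles_def)

lemma differential_uminus: "differential F i (- u) = - differential F i u"
  using differential_diff[of F i 0 u] by (simp add: differential_0)

lemma smf_0 [simp]: "smf r 0 = 0"
  by (auto simp: fun_eq_iff)

lemma gsubm_cycles: "gsubm (free_gmodule F i) (cycles F i)"
proof (cases i)
  case 0
  then show ?thesis by (auto simp: cycles_0 gsubm_def elems_add elems_smf intro!: bexI[of _ "- _"] elems_uminus)
next
  case (Suc j)
  then show ?thesis
    by (auto simp: cycles_Suc gsubm_def elems_add elems_smf differential_add differential_smf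
        differential_0 differential_uminus intro!: bexI[of _ "- _"] elems_uminus)
qed

lemma boundaries_cycles: "boundaries F i \<subseteq> cycles F i"
proof (cases i)
  case (Suc j)
  then show ?thesis using differential_differential[of _ j] by (auto simp: boundaries_def cycles_Suc)
qed (auto simp: boundaries_def cycles_0)

lemma boundaries_smf: "u \<in> boundaries F i \<Longrightarrow> smf r u \<in> boundaries F i"
  by (auto simp: boundaries_def differential_smf[symmetric] elems_smf)

lemma boundaries_add: "u \<in> boundaries F i \<Longrightarrow> v \<in> boundaries F i \<Longrightarrow> u + v \<in> boundaries F i"
  by (auto simp: boundaries_def differential_add[symmetric] elems_add)

lemma boundaries_uminus: "u \<in> boundaries F i \<Longrightarrow> - u \<in> boundaries F i"
  by (auto simp: boundaries_def differential_uminus[symmetric] elems_uminus)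

lemma boundaries_zero: "0 \<in> boundaries F i"
  unfolding boundaries_def by (rule image_eqI[of _ _ 0]) (auto simp: differential_0)

lemma gmod_cycles: "gmod (gsub (free_gmodule F i) (cycles F i))"
  by (rule gmod_gsub[OF gmod_free gsubm_cycles])

lemma gsubm_boundaries: "gsubm (gsub (free_gmodule F i) (cycles F i)) (boundaries F i)"
  using boundaries_cycles[of i]
  by (auto simp: gsubm_def boundaries_add boundaries_smf boundaries_zero
      intro!: bexI[of _ "- _"] boundaries_uminus)

lemma gmod_homology: "gmod (homology F i)"
  unfolding homology_def by (rule gmod_gquot[OF gmod_cycles gsubm_boundaries])

definition hclass :: "nat \<Rightarrow> (nat \<Rightarrow> 'k cox) \<Rightarrow> (nat \<Rightarrow> 'k cox) set"
  where "hclass i u = boundaries F i +>\<^bsub>gsub (free_gmodule F i) (cycles F i)\<^esub> u"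

lemma homology_simps:
  "carrier (homology F i) = hclass i ` cycles F i" "\<zero>\<^bsub>homology F i\<^esub> = boundaries F i"
  "gcomp (homology F i) d = hclass i ` (elems_deg F i d \<inter> cycles F i)"
  by (auto simp: homology_def gquot_simps hclass_def[abs_def])

lemma hclass_add:
  "u \<in> cycles F i \<Longrightarrow> v \<in> cycles F i \<Longrightarrow> hclass i u \<oplus>\<^bsub>homology F i\<^esub> hclass i v = hclass i (u + v)"
  using gquot_add[OF gmod_cycles gsubm_boundaries] by (simp add: homology_def hclass_def)

lemma hclass_smult: "u \<in> cycles F i \<Longrightarrow> r \<odot>\<^bsub>homology F i\<^esub> hclass i u = hclass i (smf r u)"
  using gquot_smult[OF gmod_cycles gsubm_boundaries] by (simp add: homology_def hclass_def)

lemma hclass_eq_iff: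
  assumes "u \<in> cycles F i" "v \<in> cycles F i"
  shows "hclass i u = hclass i v \<longleftrightarrow> u - v \<in> boundaries F i"
proof -
  have "hclass i u = hclass i v \<longleftrightarrow> (\<exists>n\<in>boundaries F i. u = n + v)"
    using gquot_coset_eq_iff[OF gmod_cycles gsubm_boundaries, of u i v] assms by (simp add: hclass_def)
  also have "\<dots> \<longleftrightarrow> u - v \<in> boundaries F i" by (auto intro!: bexI[of _ "u - v"])
  finally show ?thesis .
qed

lemma hclass_zero: "hclass i 0 = boundaries F i"
  using gquot_coset_zero[OF gmod_cycles gsubm_boundaries] by (simp add: hclass_def)

lemma cycles_zero: "0 \<in> cycles F i"
  using boundaries_zero boundaries_cycles by blast

end

section \<open>Quotients of the Cox ring by an ideal\<close>

lemma cox_module_simps [simp]: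
  "carrier cox_module = UNIV" "\<zero>\<^bsub>cox_module\<^esub> = 0" "(\<oplus>\<^bsub>cox_module\<^esub>) = (+)"
  "(\<odot>\<^bsub>cox_module\<^esub>) = (*)" "gcomp cox_module = cox_comp"
  by (simp_all add: cox_module_def)

lemma gmod_cox_module: "gmod (cox_module :: ('k::comm_ring_1 cox, 'k cox) gmodule)"
proof -
  have "abelian_group (cox_module :: ('k cox, 'k cox) gmodule)"
    by (rule abelian_groupI) (auto simp: add.assoc add.commute intro: exI[of _ "- _"] add.right_inverse)
  then show ?thesis by (auto simp: gmod_def distrib_left)
qed

lemma gsubm_is_ideal: "is_ideal J \<Longrightarrow> gsubm cox_module J"
  unfolding gsubm_def using is_ideal_0[of J] is_ideal_add[of J] is_ideal_mult[of J] is_ideal_minus[of J]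
  by (auto intro!: bexI[of _ "- _"])

locale quotient_module =
  fixes J :: "'k::field cox set"
  assumes J: "is_ideal J"
begin

definition qclass :: "'k cox \<Rightarrow> 'k cox set"
  where "qclass p = J +>\<^bsub>cox_module\<^esub> p"

lemma q_simps:
  "carrier (gquot cox_module J) = range qclass" "\<zero>\<^bsub>gquot cox_module J\<^esub> = J"
  "gcomp (gquot cox_module J) d = qclass ` cox_comp d"
  by (auto simp: gquot_simps qclass_def[abs_def])

lemma qclass_add: "qclass p \<oplus>\<^bsub>gquot cox_module J\<^esub> qclass q = qclass (p + q)"
  using gquot_add[OF gmod_cox_module gsubm_is_ideal[OF J]] by (simp add: qclass_def)

lemma qclass_smult: "r \<odot>\<^bsub>gquot cox_module J\<^esub> qclass p = qclass (r * p)"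
  using gquot_smult[OF gmod_cox_module gsubm_is_ideal[OF J]] by (simp add: qclass_def)

lemma qclass_eq_iff: "qclass p = qclass q \<longleftrightarrow> p - q \<in> J"
proof -
  have "qclass p = qclass q \<longleftrightarrow> (\<exists>n\<in>J. p = n + q)"
    using gquot_coset_eq_iff[OF gmod_cox_module gsubm_is_ideal[OF J], of p q] by (simp add: qclass_def)
  also have "\<dots> \<longleftrightarrow> p - q \<in> J" by (auto intro!: bexI[of _ "p - q"])
  finally show ?thesis .
qed

lemma qclass_zero: "qclass 0 = J"
  using gquot_coset_zero[OF gmod_cox_module gsubm_is_ideal[OF J]] by (simp add: qclass_def)

lemma gmod_q: "gmod (gquot cox_module J)"
  by (rule gmod_gquot[OF gmod_cox_module gsubm_is_ideal[OF J]])

end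

text \<open>Nakayama's lemma for F_0. The isomorphism sends each basis element \<open>b\<close> to
  the class of a homogeneous \<open>g b\<close>, and these classes generate the class of 1. Hence
  some \<open>u b0 * g b0\<close> of degree 0 lies outside J, and \<open>g b0\<close> is a nonzero
  constant. Any further \<open>b\<close> would be a multiple of \<open>b0\<close> modulo boundaries,
  a relation with coefficient 1 that minimality forbids.\<close>

lemma minimal_free_resolution_min_res:
  fixes F :: "'k::field gcomplex"
  assumes res: "minimal_free_resolution F (gquot cox_module J)"
    and J: "is_ideal J" "\<And>p d. p \<in> J \<Longrightarrow> hc d p \<in> J" "1 \<notin> J"
  shows "\<exists>b0. min_res F J b0"
proof -
  interpret graded_cx F by unfold_locales (use res in \<open>simp add: minimal_free_resolution_def\<close>)
  interpret q: quotient_module J by unfold_locales (rule J(1))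
  let ?R = "gquot cox_module J"
  have min: "lookup (dmat F i r c) 0 = 0" if "r \<in> gens F i" "c \<in> gens F (Suc i)" for i r c
    using res that by (auto simp: minimal_free_resolution_def intro: maximal_ideal_lookup_0)
  have bd_0: "lookup (u b) 0 = 0" if "u \<in> boundaries F i" for u b i
    using that by (auto simp: boundaries_def differential_def lookup_sum lookup_mult_0 min intro!: sum.neutral)
  obtain f where f: "f \<in> iso (add_monoid (homology F 0)) (add_monoid ?R)"
    and fs: "\<And>r u. u \<in> carrier (homology F 0) \<Longrightarrow> f (r \<odot>\<^bsub>homology F 0\<^esub> u) = r \<odot>\<^bsub>?R\<^esub> f u"
    and fg: "\<And>d. f ` gcomp (homology F 0) d = gcomp ?R d"
  proof -
    have "gmodule_iso (homology F 0) ?R" using res by (simp add: minimal_free_resolution_def)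
    then show ?thesis unfolding gmodule_iso_def by (elim bexE conjE) (rule that; blast)
  qed
  have fhom: "f (u \<oplus>\<^bsub>homology F 0\<^esub> v) = f u \<oplus>\<^bsub>?R\<^esub> f v"
    if "u \<in> carrier (homology F 0)" "v \<in> carrier (homology F 0)" for u v
  proof -
    have "f \<in> hom (add_monoid (homology F 0)) (add_monoid ?R)" using f by (simp add: iso_def)
    from hom_mult[OF this] that show ?thesis by simp
  qed
  have fbij: "bij_betw f (carrier (homology F 0)) (carrier ?R)" using f by (simp add: iso_def)
  define \<psi> where "\<psi> u = f (hclass 0 u)" for u
  have hc0: "hclass 0 u \<in> carrier (homology F 0)" if "u \<in> elems F 0" for u
    using that by (simp add: homology_simps cycles_0)
  have \<psi>add: "\<psi> (u + v) = \<psi> u \<oplus>\<^bsub>?R\<^esub> \<psi> v" if "u \<in> elems F 0" "v \<in> elems F 0" for u v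
    using that by (simp add: \<psi>_def hclass_add[symmetric] cycles_0 fhom hc0)
  have \<psi>smf: "\<psi> (smf r u) = r \<odot>\<^bsub>?R\<^esub> \<psi> u" if "u \<in> elems F 0" for r u
    using that by (simp add: \<psi>_def hclass_smult[symmetric] cycles_0 fs hc0)
  have \<psi>deg: "\<psi> ` elems_deg F 0 d = q.qclass ` cox_comp d" for d
  proof -
    have "elems_deg F 0 d \<inter> cycles F 0 = elems_deg F 0 d" by (auto simp: cycles_0 mem_elems_deg)
    then show ?thesis using fg[of d] by (simp add: homology_simps q.q_simps \<psi>_def[abs_def] image_image)
  qed
  have "\<psi> (smf 0 0) = 0 \<odot>\<^bsub>?R\<^esub> \<psi> 0" by (rule \<psi>smf) simp
  moreover have "\<psi> 0 \<in> range q.qclass"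
    using hc0[of 0] fbij by (auto simp: \<psi>_def bij_betw_def q.q_simps)
  ultimately have \<psi>0: "\<psi> 0 = q.qclass 0" by (auto simp: q.qclass_smult)
  have \<psi>ker: "\<psi> u = q.qclass 0 \<longleftrightarrow> u \<in> boundaries F 0" if "u \<in> elems F 0" for u
  proof -
    have "\<psi> u = \<psi> 0 \<longleftrightarrow> hclass 0 u = hclass 0 0"
      using inj_on_eq_iff[OF bij_betw_imp_inj_on[OF fbij] hc0[OF that] hc0[of 0]] by (simp add: \<psi>_def)
    then show ?thesis using hclass_eq_iff[of u 0 0] that cycles_zero[of 0] by (simp add: \<psi>0 cycles_0)
  qed
  have "\<exists>p\<in>cox_comp (gdeg F 0 b). \<psi> (bas b) = q.qclass p" if "b \<in> gens F 0" for b
    using \<psi>deg[of "gdeg F 0 b"] bas_elems_deg[OF that] by blast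
  then obtain g where g: "\<And>b. b \<in> gens F 0 \<Longrightarrow> g b \<in> cox_comp (gdeg F 0 b)"
    "\<And>b. b \<in> gens F 0 \<Longrightarrow> \<psi> (bas b) = q.qclass (g b)" by metis
  have bas0: "smf r (bas b) \<in> elems F 0" if "b \<in> gens F 0" for r b
    using bas_elems_deg[OF that] by (intro elems_smf) (simp add: mem_elems_deg)
  have \<psi>g: "\<psi> (smf r (bas b)) = q.qclass (r * g b)" if "b \<in> gens F 0" for r b
    using \<psi>smf[of "bas b" r] bas0[OF that, of 1] g(2)[OF that] bas_elems_deg[OF that]
    by (simp add: q.qclass_smult mem_elems_deg)
  have \<psi>sum: "\<psi> (\<Sum>b\<in>A. smf (u b) (bas b)) = q.qclass (\<Sum>b\<in>A. u b * g b) \<and> (\<Sum>b\<in>A. smf (u b) (bas b)) \<in> elems F 0"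
    if "A \<subseteq> gens F 0" for A u
    using finite_subset[OF that finite_gens] that
  proof (induction A)
    case (insert b A)
    define w where "w = (\<Sum>b\<in>A. smf (u b) (bas b))"
    have eq: "(\<Sum>b\<in>insert b A. smf (u b) (bas b)) = smf (u b) (bas b) + w"
      unfolding w_def using insert.hyps by (rule sum.insert)
    have w: "\<psi> w = q.qclass (\<Sum>b\<in>A. u b * g b)" "w \<in> elems F 0"
      unfolding w_def using insert.IH insert.prems by blast+
    show ?case unfolding eq
      using insert.prems insert.hyps w \<psi>add[OF bas0[of b "u b"] w(2)] \<psi>g[of b "u b"] bas0[of b "u b"]
      by (simp add: q.qclass_add elems_add del: plus_fun_apply smf_apply)
  qed (use \<psi>0 in \<open>simp add: zero_fun_def[symmetric]\<close>)
  have expand: "u = (\<Sum>b\<in>gens F 0. smf (u b) (bas b))" if "u \<in> elems F 0" for u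
  proof
    fix r
    have "(\<Sum>b\<in>gens F 0. smf (u b) (bas b)) r = (\<Sum>b\<in>gens F 0. if b = r then u b else 0)"
      unfolding sum_fun_apply by (rule sum.cong) (auto simp: bas_def)
    then show "u r = (\<Sum>b\<in>gens F 0. smf (u b) (bas b)) r" using that by (simp add: mem_elems)
  qed
  have \<psi>u: "\<psi> u = q.qclass (\<Sum>b\<in>gens F 0. u b * g b)" if "u \<in> elems F 0" for u
    by (subst expand[OF that]) (rule conjunct1[OF \<psi>sum[OF order_refl]])
  obtain u where u: "u \<in> elems_deg F 0 0" "\<psi> u = q.qclass 1"
  proof -
    have "q.qclass 1 \<in> \<psi> ` elems_deg F 0 0" unfolding \<psi>deg by (intro imageI cox_comp_1)
    then show ?thesis using that by (elim imageE) simp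
  qed
  then have "(\<Sum>b\<in>gens F 0. u b * g b) - 1 \<in> J" using \<psi>u[of u] by (simp add: mem_elems_deg q.qclass_eq_iff)
  have "\<exists>b\<in>gens F 0. u b * g b \<notin> J"
  proof (rule ccontr)
    assume "\<not> ?thesis"
    then have "(\<Sum>b\<in>gens F 0. u b * g b) \<in> J" by (intro is_ideal_sum[OF J(1)]) auto
    then have "(\<Sum>b\<in>gens F 0. u b * g b) - ((\<Sum>b\<in>gens F 0. u b * g b) - 1) \<in> J"
      using \<open>(\<Sum>b\<in>gens F 0. u b * g b) - 1 \<in> J\<close> by (rule is_ideal_diff[OF J(1)])
    then show False using J(3) by simp
  qed
  then obtain b0 where b0: "b0 \<in> gens F 0" "u b0 * g b0 \<notin> J" by blast
  then have nz: "u b0 \<noteq> 0" "g b0 \<noteq> 0" using is_ideal_0[OF J(1)] by auto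
  \<comment> \<open>\<open>g b0\<close> has the degree of \<open>b0\<close> and \<open>u b0\<close>
    the negative of it; both polynomials are nonzero, so both degrees are nonnegative.\<close>
  have deg0: "gdeg F 0 b0 = 0"
  proof -
    have "0 \<le> 0 - gdeg F 0 b0" using cox_comp_eq_0[OF elems_degD[OF u(1), of b0]] nz by blast
    moreover have "0 \<le> gdeg F 0 b0" using cox_comp_eq_0[OF g(1)[OF b0(1)]] nz by blast
    ultimately show ?thesis by (auto simp: less_eq_prod_def prod_eq_iff)
  qed
  define \<gamma> where "\<gamma> = lookup (g b0) 0"
  have g0: "g b0 = mconst \<gamma>" using cox_comp_degree_0[of "g b0"] g(1)[OF b0(1)] deg0 by (simp add: \<gamma>_def)
  then have \<gamma>: "\<gamma> \<noteq> 0" using nz by auto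
  have \<gamma>inv: "mconst (1 / \<gamma>) * mconst \<gamma> = 1" using \<gamma> by (simp add: mconst_mult[symmetric])
  have single: "gens F 0 = {b0}"
  proof (rule ccontr)
    assume "gens F 0 \<noteq> {b0}"
    then obtain b where b: "b \<in> gens F 0" "b \<noteq> b0" using b0 by blast
    \<comment> \<open>\<open>w\<close> is killed by \<open>\<psi>\<close> and has coefficient 1 at
      \<open>b\<close>, while boundaries have no constant terms.\<close>
    define w where "w = smf 1 (bas b) + smf (- (g b * mconst (1 / \<gamma>))) (bas b0)"
    have w: "w \<in> elems F 0" unfolding w_def by (intro elems_add bas0 b b0(1))
    have "\<psi> w = q.qclass (1 * g b) \<oplus>\<^bsub>?R\<^esub> q.qclass (- (g b * mconst (1 / \<gamma>)) * g b0)"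
      unfolding w_def by (simp only: \<psi>add[OF bas0[OF b(1)] bas0[OF b0(1)]] \<psi>g[OF b(1)] \<psi>g[OF b0(1)])
    also have "\<dots> = q.qclass (g b - g b * (mconst (1 / \<gamma>) * mconst \<gamma>))"
      by (simp add: q.qclass_add g0 mult.assoc)
    also have "\<dots> = q.qclass 0" unfolding \<gamma>inv by simp
    finally have "w \<in> boundaries F 0" using \<psi>ker[OF w] by simp
    then have "lookup (w b) 0 = 0" by (rule bd_0)
    then show False using b by (simp add: w_def bas_def)
  qed
  have bd: "boundaries F 0 = {u \<in> elems F 0. u b0 \<in> J}"
  proof -
    have "u \<in> boundaries F 0 \<longleftrightarrow> u b0 \<in> J" if "u \<in> elems F 0" for u
    proof -
      have "u \<in> boundaries F 0 \<longleftrightarrow> mconst \<gamma> * u b0 \<in> J"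
        using \<psi>ker[OF that] \<psi>u[OF that] by (simp add: single q.qclass_eq_iff g0 mult.commute)
      also have "\<dots> \<longleftrightarrow> u b0 \<in> J"
      proof
        assume "mconst \<gamma> * u b0 \<in> J"
        then have "mconst (1 / \<gamma>) * (mconst \<gamma> * u b0) \<in> J" by (rule is_ideal_mult[OF J(1)])
        then show "u b0 \<in> J" by (simp only: mult.assoc[symmetric] \<gamma>inv mult_1_left)
      qed (rule is_ideal_mult[OF J(1)])
      finally show ?thesis .
    qed
    moreover have "boundaries F 0 \<subseteq> elems F 0" by (auto simp: boundaries_def)
    ultimately show ?thesis by blast
  qed
  have exact: "u \<in> boundaries F (Suc k)" if "u \<in> elems F (Suc k)" "differential F k u = 0" for u k
  proof -
    have "carrier (homology F (Suc k)) = {boundaries F (Suc k)}"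
      using res by (simp add: minimal_free_resolution_def homology_simps)
    moreover have uc: "u \<in> cycles F (Suc k)" using that by (simp add: cycles_Suc)
    ultimately have "hclass (Suc k) u = hclass (Suc k) 0" by (auto simp: homology_simps hclass_zero)
    then show ?thesis using hclass_eq_iff[OF uc cycles_zero] by simp
  qed
  show ?thesis
    by (intro exI[of _ b0], unfold_locales) (use J single deg0 bd exact min in blast)+
qed

section \<open>The first Betti numbers\<close>

text \<open>The product of \<open>J\<close> with the ideal m generated by all variables.\<close>

definition max_times :: "'k::field cox set \<Rightarrow> 'k cox set"
  where "max_times J = {\<Sum>v\<in>UNIV. mvar v * h v | h. \<forall>v. h v \<in> J}"

lemma mono_ideal_decomp:
  fixes p :: "('v, 'k::comm_ring_1) mpoly"
  assumes "p \<in> mono_ideal W" "finite W"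
  shows "\<exists>h. p = (\<Sum>v\<in>W. mvar v * h v)"
  using assms(2,1)
proof (induction W arbitrary: p)
  case (insert w W)
  obtain h' where "p - mvar w * h' \<in> mono_ideal W" by (rule mono_ideal_insertE[OF insert.prems])
  then obtain h where "p - mvar w * h' = (\<Sum>v\<in>W. mvar v * h v)" using insert.IH by blast
  then have "p = (\<Sum>v\<in>insert w W. mvar v * (h(w := h')) v)"
    using insert.hyps by (simp add: diff_eq_eq add.commute) (intro sum.cong, auto)
  then show ?case by blast
qed auto

lemma mono_ideal_UNIV_decomp:
  fixes p :: "'k::field cox"
  assumes "lookup p 0 = 0"
  shows "\<exists>h. p = (\<Sum>v\<in>UNIV. mvar v * h v)"
proof (rule mono_ideal_decomp[OF _ finite])
  show "p \<in> mono_ideal UNIV" unfolding mono_ideal_def mem_Collect_eq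
  proof
    fix m assume "m \<in> keys p"
    then have "m \<noteq> 0" using assms by (auto simp: in_keys_iff)
    then obtain v where "lookup m v \<noteq> 0" using poly_mapping_eqI[of m 0] by auto
    then show "\<exists>w\<in>UNIV. 0 < lookup m w" by auto
  qed
qed

lemma mono_count_0: "mono_count 0 = 1"
proof -
  have "{m :: 2 + 3 \<Rightarrow>\<^sub>0 nat. bideg m = 0} = {0}" using bideg_eq_0 by auto
  then show ?thesis by (simp add: mono_count_def)
qed

lemma lookup_mvar_mult_0: "lookup (mvar v * p :: 'k::field cox) 0 = 0"
  using mono_ideal_lookup_0[OF mvar_times_mono_ideal[OF UNIV_I]] .

context min_res
begin

text \<open>The degree \<open>d\<close> part of m F_1, where m is the ideal of all
  variables.\<close>

definition minimal_elems :: "int \<times> int \<Rightarrow> (nat \<Rightarrow> 'k cox) set"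
  where "minimal_elems d = {w \<in> elems_deg F 1 d. \<forall>c. lookup (w c) 0 = 0}"

lemma image_elems_deg_1: "(\<lambda>w. differential F 0 w b0) ` elems_deg F 1 d = cox_comp d \<inter> I"
proof (intro equalityI subsetI)
  fix p assume p: "p \<in> cox_comp d \<inter> I"
  define u where "u = (\<lambda>b. if b = b0 then p else 0)"
  have "u \<in> elems_deg F 0 d" using p by (auto simp: u_def mem_elems_deg mem_elems gens_0 gdeg_0)
  moreover have "u b0 \<in> I" using p by (simp add: u_def)
  ultimately obtain w where "w \<in> elems_deg F 1 d" "u = differential F 0 w" by (rule exact_deg_0)
  then show "p \<in> (\<lambda>w. differential F 0 w b0) ` elems_deg F 1 d"
    by (intro image_eqI[of _ _ w]) (auto simp: u_def dest: fun_cong[of _ _ b0])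
next
  fix p assume "p \<in> (\<lambda>w. differential F 0 w b0) ` elems_deg F 1 d"
  then obtain w where w: "w \<in> elems_deg F 1 d" "p = differential F 0 w b0" by blast
  have "differential F 0 w \<in> elems_deg F 0 d" by (rule differential_deg) (use w in simp)
  then have "p \<in> cox_comp d" using elems_degD[of "differential F 0 w" F 0 d b0] w gdeg_0 by simp
  then show "p \<in> cox_comp d \<inter> I" using w differential_0_in_I[of w] by (auto simp: mem_elems_deg)
qed

text \<open>The image of m F_1 is m I: a product of a variable with an element of I lifts through a
  preimage of that element, and conversely variables can be split off from coefficients without
  constant term.\<close>

lemma image_minimal_elems: "(\<lambda>w. differential F 0 w b0) ` minimal_elems d = cox_comp d \<inter> max_times I"
proof (intro equalityI subsetI)
  fix p assume p: "p \<in> cox_comp d \<inter> max_times I"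
  then obtain h where h: "p = (\<Sum>v\<in>UNIV. mvar v * h v)" "\<And>v. h v \<in> I" by (auto simp: max_times_def)
  have "\<exists>w\<in>elems F 1. differential F 0 w b0 = h v" for v
  proof -
    have "(\<lambda>b. if b = b0 then h v else 0) \<in> boundaries F 0"
      using h(2) by (auto simp: boundaries_0 mem_elems gens_0)
    then obtain w where w: "w \<in> elems F 1" "(\<lambda>b. if b = b0 then h v else 0) = differential F 0 w"
      by (auto simp: boundaries_def)
    show ?thesis using w(1) fun_cong[OF w(2), of b0] by (intro bexI[of _ w]) auto
  qed
  then obtain w where w: "\<And>v. w v \<in> elems F 1" "\<And>v. differential F 0 (w v) b0 = h v" by metis
  define z where "z = hcf F 1 d (\<Sum>v\<in>UNIV. smf (mvar v) (w v))"
  have "(\<Sum>v\<in>UNIV. smf (mvar v) (w v)) \<in> elems F 1"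
    using w(1) by (auto simp: mem_elems intro!: sum.neutral)
  then have "z \<in> elems_deg F 1 d" unfolding z_def by (rule hcf_elems_deg)
  moreover have "lookup (z c) 0 = 0" for c
    by (simp add: z_def hcf_def lookup_hc lookup_sum lookup_mvar_mult_0)
  ultimately have "z \<in> minimal_elems d" by (simp add: minimal_elems_def)
  moreover have "differential F 0 z b0 = hc d (\<Sum>v\<in>UNIV. mvar v * h v)"
    using differential_hcf[of 0 d "\<Sum>v\<in>UNIV. smf (mvar v) (w v)"]
    by (simp add: z_def hcf_def differential_sum differential_smf w(2) gdeg_0 del: sum_hc)
  then have "differential F 0 z b0 = p" using p h(1) by simp
  ultimately show "p \<in> (\<lambda>w. differential F 0 w b0) ` minimal_elems d" by blast
next
  fix p assume "p \<in> (\<lambda>w. differential F 0 w b0) ` minimal_elems d"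
  then obtain w where w: "w \<in> minimal_elems d" "p = differential F 0 w b0" by blast
  have "\<exists>h. w c = (\<Sum>v\<in>UNIV. mvar v * h v)" for c
    using w(1) mono_ideal_UNIV_decomp[of "w c"] by (auto simp: minimal_elems_def)
  then have "\<forall>c. \<exists>h. w c = (\<Sum>v\<in>UNIV. mvar v * h v)" by blast
  from choice[OF this] obtain h where h: "\<And>c. w c = (\<Sum>v\<in>UNIV. mvar v * h c v)" by blast
  define k where "k v = (\<lambda>c. if c \<in> gens F 1 then h c v else 0)" for v
  have "p = (\<Sum>v\<in>UNIV. mvar v * differential F 0 (k v) b0)"
    by (simp add: w(2) differential_def gens_0 h k_def sum_distrib_left mult.left_commute)
      (rule sum.swap)
  moreover have "differential F 0 (k v) b0 \<in> I" for v
    by (rule differential_0_in_I) (simp add: mem_elems k_def)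
  ultimately have "p \<in> max_times I" by (auto simp: max_times_def)
  moreover have "p \<in> cox_comp d" using image_elems_deg_1[of d] w by (auto simp: minimal_elems_def)
  ultimately show "p \<in> cox_comp d \<inter> max_times I" by simp
qed

lemma minimal_elems_subspace: "vf.subspace (minimal_elems d)"
  using elems_deg_subspace[of 1 d] by (auto simp: minimal_elems_def vf.subspace_def scf_def lookup_add)

text \<open>Both dimensions depend only on \<open>I\<close>, so all minimal resolutions have the same twists in step 1.\<close>

lemma count_twists_1:
  "count (twists F 1) d + vc.dim (cox_comp d \<inter> max_times I) = vc.dim (cox_comp d \<inter> I)"
proof -
  let ?L = "\<lambda>w. differential F 0 w b0" and ?W = "elems_deg F 1 d" and ?W' = "minimal_elems d"
  have lin: "Vector_Spaces.linear scf (\<lambda>c p. mconst c * p) ?L"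
    by unfold_locales (auto simp: scf_def differential_add differential_smf)
  \<comment> \<open>A cycle in F_1 is a boundary and so by minimality has no constant terms; hence
    the two kernels agree.\<close>
  have ker1: "{w \<in> ?W'. ?L w = 0} = {w \<in> ?W. ?L w = 0}"
  proof (intro equalityI subsetI)
    fix w assume "w \<in> {w \<in> ?W. ?L w = 0}"
    then have w: "w \<in> ?W" "?L w = 0" by auto
    have "differential F 0 w = 0"
    proof
      fix b show "differential F 0 w b = 0 b"
        using w(2) by (cases "b = b0") (auto simp: differential_def gens_0)
    qed
    then obtain z where "w = differential F 1 z" using exact_deg[of w 0 d] w(1) by auto
    then show "w \<in> {w \<in> ?W'. ?L w = 0}" using w by (auto simp: minimal_elems_def differential_lookup_0)
  qed (auto simp: minimal_elems_def)
  have fdW: "fin_dim vf.span V" if "V \<subseteq> ?W" for V by (rule fin_dim_subset[OF elems_deg_fin_dim that])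
  have fdI: "fin_dim vc.span (cox_comp d \<inter> A)" for A :: "'k cox set"
    by (rule fin_dim_subset[OF cox_comp_fin_dim Int_lower1])
  have "vf.dim ?W = vf.dim {w \<in> ?W. ?L w = 0} + vc.dim (cox_comp d \<inter> I)"
    using fc.rank_nullity(2)[OF lin elems_deg_subspace, of 1 d] fdW[of "{w \<in> ?W. ?L w = 0}"] fdI[of I]
    unfolding image_elems_deg_1 by blast
  moreover have "vf.dim ?W' = vf.dim {w \<in> ?W'. ?L w = 0} + vc.dim (cox_comp d \<inter> max_times I)"
    using fc.rank_nullity(2)[OF lin minimal_elems_subspace, of d] fdW[of "{w \<in> ?W'. ?L w = 0}"] fdI[of "max_times I"]
    unfolding image_minimal_elems by (auto simp: minimal_elems_def)
  ultimately have 1: "vf.dim ?W' + vc.dim (cox_comp d \<inter> I) = vf.dim ?W + vc.dim (cox_comp d \<inter> max_times I)"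
    unfolding ker1 by linarith
  \<comment> \<open>Taking constant terms maps the degree \<open>d\<close> part of F_1 onto the span
    of the generators of degree exactly \<open>d\<close>, with kernel
    \<open>minimal_elems d\<close>.\<close>
  define T where "T = {c \<in> gens F 1. gdeg F 1 c = d}"
  define V where "V = {u \<in> ?W. \<forall>b. b \<notin> T \<longrightarrow> u b = 0}"
  let ?f = "\<lambda>w :: nat \<Rightarrow> 'k cox. \<lambda>b. mconst (lookup (w b) 0)"
  have lin2: "Vector_Spaces.linear scf scf ?f"
    by unfold_locales (auto simp: scf_def lookup_add mconst_add mconst_mult fun_eq_iff)
  have inV: "?f w \<in> V" if w: "w \<in> ?W" for w
  proof -
    have z: "lookup (w b) 0 = 0" if "b \<notin> T" for b
    proof (cases "b \<in> gens F 1")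
      case True
      then have "d - gdeg F 1 b \<noteq> 0" using that by (simp add: T_def)
      then show ?thesis using elems_degD[OF w, of b] bideg_0 unfolding mem_cox_comp by metis
    next
      case False
      then have "w b = 0" using w unfolding mem_elems_deg mem_elems by blast
      then show ?thesis by simp
    qed
    then have "?f w b \<in> cox_comp (d - gdeg F 1 b)" for b
      by (cases "b \<in> T") (auto simp: T_def)
    then show ?thesis using z by (auto simp: V_def mem_elems_deg mem_elems T_def)
  qed
  have im: "?f ` ?W = V"
  proof (intro equalityI subsetI)
    fix w assume w: "w \<in> V"
    have "w b = mconst (lookup (w b) 0)" for b
    proof (cases "b \<in> T")
      case True
      then have "w b \<in> cox_comp 0" using w elems_degD[of w F 1 d b] by (simp add: V_def T_def)
      then show ?thesis by (rule cox_comp_degree_0)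
    qed (use w in \<open>simp add: V_def\<close>)
    then have "w = ?f w" by auto
    then show "w \<in> ?f ` ?W" using w by (auto simp: V_def)
  qed (use inV in auto)
  have "mconst c = 0 \<longleftrightarrow> c = 0" for c :: 'k
    using arg_cong[of "mconst c" 0 "\<lambda>p. lookup p 0"] by (auto simp: mconst_def)
  then have ker: "{w \<in> ?W. ?f w = 0} = ?W'"
    unfolding minimal_elems_def fun_eq_iff zero_fun_def by blast
  have "vf.dim V = (\<Sum>b\<in>T. mono_count (d - gdeg F 1 b))"
    unfolding V_def by (rule conjunct2[OF elems_deg_dim_aux]) (auto simp: T_def)
  also have "\<dots> = card T" by (simp add: T_def mono_count_0)
  finally have "vf.dim V = card T" .
  then have "vf.dim ?W = vf.dim ?W' + card T"
    using ff.rank_nullity(2)[OF lin2 elems_deg_subspace, of 1 d] fdW[of ?W'] fdW[of V] unfolding ker im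
    by (auto simp: minimal_elems_def V_def)
  moreover have "count (twists F 1) d = card T"
    unfolding twists_def T_def by (simp add: count_image_mset_eq_card_vimage)
  ultimately show ?thesis using 1 by linarith
qed

end

text \<open>By \<open>count_twists_1\<close> the number of summands is dim I_d - dim (m I)_d for
  every minimal resolution, so the description in \<open>betti\<close> has exactly one
  solution.\<close>

lemma betti_1_eq:
  fixes X :: "'k::field point set"
  assumes "minimal_free_resolution F (coordinate_module X)" "X \<noteq> {}"
  shows "betti (coordinate_module X) 1 d = count (twists F 1) d"
proof -
  let ?J = "vanishing_ideal X"
  have *: "count (twists F' 1) d + vc.dim (cox_comp d \<inter> max_times ?J) = vc.dim (cox_comp d \<inter> ?J)"
    if F': "minimal_free_resolution F' (coordinate_module X)" for F' :: "'k gcomplex"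
  proof -
    obtain b0 where "min_res F' ?J b0"
      using minimal_free_resolution_min_res[OF F'[unfolded coordinate_module_def] is_ideal_vanishing_ideal
          hc_vanishing_ideal one_notin_vanishing_ideal[OF assms(2)]] by blast
    then show ?thesis by (rule min_res.count_twists_1)
  qed
  show ?thesis unfolding betti_def
  proof (rule the_equality)
    show "\<exists>F'. minimal_free_resolution F' (coordinate_module X) \<and> count (twists F 1) d = count (twists F' 1) d"
      using assms(1) by blast
    fix n assume "\<exists>F'. minimal_free_resolution F' (coordinate_module X) \<and> n = count (twists F' 1) d"
    then show "n = count (twists F 1) d" using * assms(1) by (metis add_right_cancel)
  qed
qed

section \<open>Difference matrices\<close>

lemma diff_D_expand: "diff_D f i j =
    (f i j - 2 * f (i - 1) j + f (i - 2) j) - 3 * (f i (j - 1) - 2 * f (i - 1) (j - 1) + f (i - 2) (j - 1))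
    + 3 * (f i (j - 2) - 2 * f (i - 1) (j - 2) + f (i - 2) (j - 2))
    - (f i (j - 3) - 2 * f (i - 1) (j - 3) + f (i - 2) (j - 3))"
  by (simp add: diff_D_def diff_C_def diff_R_def numeral_2_eq_2 numeral_3_eq_3 algebra_simps)

text \<open>Row \<open>j\<close> of the difference matrix sees only rows up to \<open>j\<close>, so
  formulas valid for rows up to 2 may be substituted there.\<close>

lemma diff_D_cong:
  assumes "\<And>i' j'. j' \<le> j \<Longrightarrow> f i' j' = g i' j'"
  shows "diff_D f i j = diff_D g i j"
  by (simp add: diff_D_expand assms)

lemma diff_D_sum: "diff_D (\<lambda>i j. \<Sum>c\<in>A. f c i j) i j = (\<Sum>c\<in>A. diff_D (f c) i j)"
  by (simp add: diff_D_expand sum.distrib sum_subtractf sum_distrib_left)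

lemma diff_D_add: "diff_D (\<lambda>i j. f i j + g i j) i j = diff_D f i j + diff_D g i j"
  by (simp add: diff_D_expand)

lemma diff_D_minus: "diff_D (\<lambda>i j. f i j - g i j) i j = diff_D f i j - diff_D g i j"
  by (simp add: diff_D_expand)

text \<open>The number of monomials of degree \<open>j\<close> in three variables, correct for
  \<open>j \<le> 2\<close>, the range in which it is applied.\<close>

definition row_rank :: "int \<Rightarrow> int"
  where "row_rank j = (if j < 0 then 0 else if j = 0 then 1 else if j = 1 then 3 else 6)"

lemma mono_count_row:
  assumes "j \<le> 2"
  shows "int (mono_count (i, j)) = (if i < 0 then 0 else (i + 1) * row_rank j)"
proof (cases "0 \<le> i \<and> 0 \<le> j")
  case True
  then obtain a b where ab: "i = int a" "j = int b" by (metis zero_le_imp_eq_int)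
  have "b = 0 \<or> b = 1 \<or> b = 2" using assms ab by auto
  then show ?thesis unfolding ab mono_count
    by (auto simp: row_rank_def atMost_Suc numeral_2_eq_2 algebra_simps)
next
  case False
  then have "mono_count (i, j) = 0" by (intro mono_count_neg) (auto simp: less_eq_prod_def)
  then show ?thesis using False by (auto simp: row_rank_def)
qed

text \<open>On generating functions \<open>diff_D\<close> is multiplication by (1 - s)^2 (1 - t)^3,
  the inverse of the Hilbert series of S; of a shifted copy of S only the generator remains.\<close>

lemma diff_D_mono_count:
  assumes "j \<le> 2" "0 \<le> b"
  shows "diff_D (\<lambda>i j. int (mono_count (i - a, j - b))) i j = (if (i, j) = (a, b) then 1 else 0)"
proof -
  define A where "A i = (if i < 0 then 0 else i + 1)" for i :: int
  have mc: "int (mono_count (i - a, j' - b)) = A (i - a) * row_rank (j' - b)" if "j' \<le> 2" for i j'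
    using mono_count_row[of "j' - b" "i - a"] that assms(2) by (simp add: A_def)
  have "diff_D (\<lambda>i j. int (mono_count (i - a, j - b))) i j = diff_D (\<lambda>i j. A (i - a) * row_rank (j - b)) i j"
    by (rule diff_D_cong) (use mc assms(1) in simp)
  also have "\<dots> = (A (i - a) - 2 * A (i - a - 1) + A (i - a - 2)) *
        (row_rank (j - b) - 3 * row_rank (j - b - 1) + 3 * row_rank (j - b - 2) - row_rank (j - b - 3))"
    unfolding diff_D_expand by (simp add: algebra_simps)
  also have "A (i - a) - 2 * A (i - a - 1) + A (i - a - 2) = (if i = a then 1 else 0)"
    by (simp add: A_def)
  also have "row_rank (j - b) - 3 * row_rank (j - b - 1) + 3 * row_rank (j - b - 2) - row_rank (j - b - 3)
    = (if j = b then 1 else 0)"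
    using assms by (simp add: row_rank_def)
  finally show ?thesis by simp
qed

text \<open>A row of the generic Hilbert matrix, \<open>c\<close> being the number of y-monomials of
  the degree in question.\<close>

definition generic_row :: "int \<Rightarrow> int \<Rightarrow> int \<Rightarrow> int"
  where "generic_row N c i = (if i < 0 then 0 else min N (c * (i + 1)))"

lemma generic_row_1:
  assumes "N > 0"
  shows "generic_row N 1 i - 2 * generic_row N 1 (i - 1) + generic_row N 1 (i - 2)
    = (if i = 0 then 1 else 0) - (if i = N then 1 else 0)"
  using assms unfolding generic_row_def by (auto simp: min_def)

text \<open>The row is piecewise linear: it grows by 3 up to i = q - 1, by r at i = q, and then
  stays at N. The second difference records the changes of slope.\<close>

lemma generic_row_3:
  assumes "N = 3 * q + r" "0 \<le> r" "r < 3" "q > 0"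
  shows "generic_row N 3 i - 2 * generic_row N 3 (i - 1) + generic_row N 3 (i - 2)
    = (if i = 0 then 3 else 0) - (if i = q then 3 - r else 0) - (if i = q + 1 then r else 0)"
proof -
  have v: "generic_row N 3 i = (if i < 0 then 0 else if i < q then 3 * (i + 1) else N)" for i
    using assms by (auto simp: generic_row_def min_def)
  consider "i < 0" | "i = 0" | "0 < i" "i < q" | "i = q" | "i = q + 1" | "i > q + 1" by linarith
  then show ?thesis unfolding v using assms by cases auto
qed

lemma generic_row_6:
  assumes "N = 6 * q + r" "0 \<le> r" "r < 6" "q > 0"
  shows "generic_row N 6 i - 2 * generic_row N 6 (i - 1) + generic_row N 6 (i - 2)
    = (if i = 0 then 6 else 0) - (if i = q then 6 - r else 0) - (if i = q + 1 then r else 0)"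
proof -
  have v: "generic_row N 6 i = (if i < 0 then 0 else if i < q then 6 * (i + 1) else N)" for i
    using assms by (auto simp: generic_row_def min_def)
  consider "i < 0" | "i = 0" | "0 < i" "i < q" | "i = q" | "i = q + 1" | "i > q + 1" by linarith
  then show ?thesis unfolding v using assms by cases auto
qed

section \<open>Betti numbers of generic points\<close>

text \<open>The clause \<open>betti\<close> is supplied by \<open>betti_1_eq\<close>; it lets
  general position speak about the summands of this particular \<open>F\<close>.\<close>

locale generic_points = min_res F "vanishing_ideal X" b0
  for F :: "'k::alg_closed_field gcomplex" and X :: "'k point set" and b0 +
  fixes N q r q' r' :: nat
  assumes finX: "finite X" and cardX: "card X = N" and N12: "N \<ge> 12"
    and N6: "N = 6 * q + r" "r \<le> 5" and N3: "N = 3 * q' + r'" "r' \<le> 2"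
    and sgp: "sufficiently_general_position X"
    and betti: "betti (coordinate_module X) 1 d = count (twists F 1) d"
begin

abbreviation H where "H \<equiv> hilbert_matrix X"

text \<open>Separates the jumps of the Hilbert rows of y-degree 2, 1 and 0, located at q and q + 1,
  at q' and q' + 1, and at N. From N >= 12 comes q >= 2, and then q' >= 2 q > q + 1.\<close>

lemma q_bounds: "0 < q" "q + 1 < q'" "q' + 1 < N"
  using N12 N6 N3 by linarith+

lemma X_nonempty: "X \<noteq> {}"
  using cardX N12 by auto

lemma hilbert_dim: "H i j + int (vc.dim (cox_comp (i, j) \<inter> vanishing_ideal X)) = int (mono_count (i, j))"
  by (rule hilbert_matrix_dim[OF X_nonempty])

lemma hilbert_neg:
  assumes "i < 0 \<or> j < 0"
  shows "H i j = 0"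
proof -
  have "mono_count (i, j) = 0" using assms by (intro mono_count_neg) (auto simp: less_eq_prod_def)
  then show ?thesis using hilbert_dim[of i j] by (simp add: hilbert_matrix_def)
qed

lemma hilbert_generic: "H (int i) (int j) = int (min N ((i + 1) * ((j + 2) choose 2)))"
  using sgp unfolding sufficiently_general_position_def generic_hilbert_matrix_def cardX by blast

lemma hilbert_row:
  assumes "j \<le> 2"
  shows "H i j = (if j < 0 then 0 else generic_row N (row_rank j) i)"
proof (cases "i < 0 \<or> j < 0")
  case True
  then show ?thesis by (auto simp: hilbert_neg generic_row_def)
next
  case False
  then obtain a b where ab: "i = int a" "j = int b" by (metis linorder_not_le zero_le_imp_eq_int)
  have "b = 0 \<or> b = 1 \<or> b = 2" using assms ab by auto
  then show ?thesis unfolding ab hilbert_generic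
    by (auto simp: row_rank_def generic_row_def choose_two of_nat_min algebra_simps)
qed

abbreviation E where "E c i \<equiv> generic_row N c i - 2 * generic_row N c (i - 1) + generic_row N c (i - 2)"

lemma E1: "E 1 i = (if i = 0 then 1 else 0) - (if i = int N then 1 else 0)"
  by (rule generic_row_1) (use N12 in simp)

lemma E3: "E 3 i = (if i = 0 then 3 else 0) - (if i = int q' then 3 - int r' else 0) - (if i = int q' + 1 then int r' else 0)"
  by (rule generic_row_3) (use N3 q_bounds in simp_all)

lemma E6: "E 6 i = (if i = 0 then 6 else 0) - (if i = int q then 6 - int r else 0) - (if i = int q + 1 then int r else 0)"
  by (rule generic_row_6) (use N6 q_bounds in simp_all)

lemma DH_neg: "j < 0 \<Longrightarrow> diff_D H i j = 0"
  by (simp add: diff_D_expand hilbert_neg)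

lemma DH_0: "diff_D H i 0 = (if i = 0 then 1 else 0) - (if i = int N then 1 else 0)"
  using E1[of i] by (simp add: diff_D_expand hilbert_row row_rank_def)

lemma DH_1: "diff_D H i 1 = (if i = int N then 3 else 0)
    - (if i = int q' then 3 - int r' else 0) - (if i = int q' + 1 then int r' else 0)"
proof -
  have "diff_D H i 1 = E 3 i - 3 * E 1 i" by (simp add: diff_D_expand hilbert_row row_rank_def)
  then show ?thesis unfolding E1 E3 by simp
qed

lemma DH_2: "diff_D H i 2 = - (if i = int q then 6 - int r else 0) - (if i = int q + 1 then int r else 0)
    + (if i = int q' then 9 - 3 * int r' else 0) + (if i = int q' + 1 then 3 * int r' else 0)
    - (if i = int N then 3 else 0)"
proof -
  have "diff_D H i 2 = E 6 i - 3 * E 3 i + 3 * E 1 i" by (simp add: diff_D_expand hilbert_row row_rank_def)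
  then show ?thesis unfolding E1 E3 E6 by simp
qed

lemma j_cases:
  fixes j :: int
  assumes "j \<le> 2"
  obtains "j < 0" | "j = 0" | "j = 1" | "j = 2"
  using assms by linarith

section \<open>Generators of the ideal in y-degree at most 2\<close>

abbreviation n where "n k d \<equiv> count (twists F k) d"

lemma n_card: "n k d = card {c \<in> gens F k. gdeg F k c = d}"
  unfolding twists_def by (simp add: count_image_mset_eq_card_vimage)

lemma n_eq_0_iff: "n k d = 0 \<longleftrightarrow> (\<forall>c\<in>gens F k. gdeg F k c \<noteq> d)"
  by (auto simp: n_card)

lemma n_neg: "i < 0 \<or> j < 0 \<Longrightarrow> n k (i, j) = 0"
  using gdeg_nonneg[of _ k] by (fastforce simp: n_eq_0_iff less_eq_prod_def)

lemma n_0: "n 0 (i, j) = (if (i, j) = (0, 0) then 1 else 0)"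
  by (auto simp: n_card gens_0 gdeg_0 zero_prod_def Collect_conv_if)

lemma n_1_betti:
  assumes "0 \<le> i" "0 \<le> j" "(i, j) \<noteq> (0, 0)"
  shows "int (n 1 (i, j)) = (if predicted_generator_degree X i j then - diff_D H i j else 0)"
proof -
  have "0 < n 1 (i, j) \<longleftrightarrow> predicted_generator_degree X i j"
    "predicted_generator_degree X i j \<Longrightarrow> int (n 1 (i, j)) = - diff_D H i j"
    using sgp assms unfolding sufficiently_general_position_def betti by (auto simp: less_eq_prod_def)
  then show ?thesis by (cases "predicted_generator_degree X i j") (simp_all del: count_greater_zero_iff)
qed

lemma predicted_iff: "predicted_generator_degree X i j \<longleftrightarrow>
    diff_D H i j < 0 \<and> (\<forall>i' j'. i' \<le> i \<and> j' \<le> j \<and> (i', j') \<noteq> (0, 0) \<longrightarrow> diff_D H i' j' \<le> 0)"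
  by (auto simp: predicted_generator_degree_def less_eq_prod_def)

lemma predicted_0: "predicted_generator_degree X i 0 \<longleftrightarrow> i = int N"
proof -
  have "diff_D H i' j' \<le> 0" if "j' \<le> 0" "(i', j') \<noteq> (0, 0)" for i' j'
    using that DH_neg[of j' i'] DH_0[of i'] by (cases "j' = 0") auto
  moreover have "diff_D H i 0 < 0 \<longleftrightarrow> i = int N" unfolding DH_0 using N12 by auto
  ultimately show ?thesis by (auto simp: predicted_iff)
qed

text \<open>A negative entry of row 1 has x-degree below N, and there the rows up to 1 have no
  positive entry besides the one at (0, 0).\<close>

lemma predicted_1: "predicted_generator_degree X i 1 \<longleftrightarrow> diff_D H i 1 < 0"
proof
  assume D: "diff_D H i 1 < 0"
  then have i: "i < int N" using q_bounds N3 unfolding DH_1 by (auto split: if_splits)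
  have "diff_D H i' j' \<le> 0" if "i' \<le> i" "j' \<le> 1" "(i', j') \<noteq> (0, 0)" for i' j'
  proof -
    have "j' < 0 \<or> j' = 0 \<or> j' = 1" using that by linarith
    then consider "j' < 0" | "j' = 0" | "j' = 1" by blast
    then show ?thesis by cases (use that i N3 in \<open>auto simp: DH_neg DH_0 DH_1\<close>)
  qed
  then show "predicted_generator_degree X i 1" using D by (auto simp: predicted_iff)
qed (simp add: predicted_iff)

text \<open>The entry at (N, 2) is negative but no generator degree, as the entry 3 at (N, 1) lies
  below it. The other negative entries have x-degree below q', before any positive entry of rows 0
  to 2 apart from (0, 0).\<close>

lemma predicted_2: "predicted_generator_degree X i 2 \<longleftrightarrow> diff_D H i 2 < 0 \<and> i \<noteq> int N"
proof
  assume D: "diff_D H i 2 < 0 \<and> i \<noteq> int N"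
  then have i: "i < int q'" using q_bounds N3 N6 unfolding DH_2 by (auto split: if_splits)
  have "diff_D H i' j' \<le> 0" if "i' \<le> i" "j' \<le> 2" "(i', j') \<noteq> (0, 0)" for i' j'
    using \<open>j' \<le> 2\<close>
    by (cases rule: j_cases) (use that i q_bounds N3 N6 in \<open>auto simp: DH_neg DH_0 DH_1 DH_2\<close>)
  then show "predicted_generator_degree X i 2" using D by (auto simp: predicted_iff)
next
  assume *: "predicted_generator_degree X i 2"
  have "diff_D H (int N) 1 = 3" using q_bounds by (simp add: DH_1)
  moreover have "diff_D H i' 1 \<le> 0" if "i' \<le> i" for i'
    using * that unfolding predicted_iff by (metis one_le_numeral prod.inject zero_neq_one)
  ultimately have "i \<noteq> int N" by fastforce
  then show "diff_D H i 2 < 0 \<and> i \<noteq> int N" using * unfolding predicted_iff by blast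
qed

lemma n_1_0: "n 1 (i, 0) = (if i = int N then 1 else 0)"
proof (cases "i > 0")
  case True
  then show ?thesis using n_1_betti[of i 0] by (auto simp: predicted_0 DH_0 split: if_splits)
next
  case False
  \<comment> \<open>General position says nothing about (0, 0); there minimality rules out a
    generator.\<close>
  then have "n 1 (i, 0) = 0" using gdeg_nonneg[of _ 1] gdeg_1_nonzero
    by (fastforce simp: n_eq_0_iff less_eq_prod_def zero_prod_def)
  then show ?thesis using False N12 by auto
qed

lemma n_1_1: "int (n 1 (i, 1)) = (if i = int q' then 3 - int r' else 0) + (if i = int q' + 1 then int r' else 0)"
proof (cases "i \<ge> 0")
  case True
  then show ?thesis using n_1_betti[of i 1] q_bounds N3 by (auto simp: predicted_1 DH_1 split: if_splits)
qed (simp add: n_neg)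

lemma n_1_2: "int (n 1 (i, 2)) = (if i = int q then 6 - int r else 0) + (if i = int q + 1 then int r else 0)"
proof (cases "i \<ge> 0")
  case True
  then show ?thesis using n_1_betti[of i 2] q_bounds N3 N6 by (auto simp: predicted_2 DH_2 split: if_splits)
qed (simp add: n_neg)

lemma linear_forms:
  obtains c where "nzd (vanishing_ideal X) (mvar (Inl 1) + mconst c * mvar (Inl 2))"
    "nzd (vanishing_ideal X) (mvar (Inr 1) + (mconst c * mvar (Inr 2) + mconst (c^2) * mvar (Inr 3)))"
proof -
  obtain c :: 'k where c:
    "\<And>P a. P \<in> X \<Longrightarrow> a \<in> coordinates P \<Longrightarrow>
       eval_mpoly a (mvar (Inl 1) + mconst c * mvar (Inl 2)) \<noteq> 0"
    "\<And>P a. P \<in> X \<Longrightarrow> a \<in> coordinates P \<Longrightarrow>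
       eval_mpoly a (mvar (Inr 1) + (mconst c * mvar (Inr 2) + mconst (c^2) * mvar (Inr 3))) \<noteq> 0"
    using exists_nonvanishing_linear_forms[OF finX] by blast
  show ?thesis
  proof (rule that)
    show "nzd (vanishing_ideal X) (mvar (Inl 1) + mconst c * mvar (Inl 2))"
      by (rule nzd_vanishing_ideal[OF _ c(1)]) (rule cox_comp_add[OF cox_comp_x cox_comp_mconst_mult[OF cox_comp_x]])
    show "nzd (vanishing_ideal X) (mvar (Inr 1) + (mconst c * mvar (Inr 2) + mconst (c^2) * mvar (Inr 3)))"
      by (rule nzd_vanishing_ideal[OF _ c(2)])
        (rule cox_comp_add[OF cox_comp_y cox_comp_add[OF cox_comp_mconst_mult[OF cox_comp_y] cox_comp_mconst_mult[OF cox_comp_y]]])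
  qed
qed

section \<open>Lowest y-degrees of syzygies\<close>

lemma strand:
  assumes "c \<in> gens F (Suc (Suc k))"
  obtains a where "a \<in> gens F (Suc k)" "fst (gdeg F (Suc k) a) = fst (gdeg F (Suc (Suc k)) c)"
    "snd (gdeg F (Suc k) a) < snd (gdeg F (Suc (Suc k)) c)"
proof -
  obtain t where "nzd (vanishing_ideal X) (mvar (Inl 1) + mconst t * mvar (Inl 2))" by (rule linear_forms)
  from gdeg_strand[OF this assms] show ?thesis using that by blast
qed

lemma snd_gdeg_ge: "c \<in> gens F (Suc k) \<Longrightarrow> int k \<le> snd (gdeg F (Suc k) c)"
proof (induction k arbitrary: c)
  case 0
  then show ?case using gdeg_nonneg[of c 1] by (simp add: less_eq_prod_def)
next
  case (Suc k)
  obtain a where "a \<in> gens F (Suc k)" "snd (gdeg F (Suc k) a) < snd (gdeg F (Suc (Suc k)) c)"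
    by (rule strand[OF Suc.prems])
  then show ?case using Suc.IH by fastforce
qed

text \<open>Attaining the lowest y-degree forces each step of the strand down to F_1 to be as small
  as possible. The strand keeps the x-degree and ends at a generator of y-degree 0, whose only
  possible degree is (N, 0).\<close>

lemma fst_gdeg_lowest:
  "c \<in> gens F (Suc k) \<Longrightarrow> snd (gdeg F (Suc k) c) = int k \<Longrightarrow> fst (gdeg F (Suc k) c) = int N"
proof (induction k arbitrary: c)
  case 0
  then have "n 1 (fst (gdeg F 1 c), 0) \<noteq> 0" unfolding n_eq_0_iff by (auto simp: prod_eq_iff)
  then show ?case unfolding n_1_0 by (simp split: if_splits)
next
  case (Suc k)
  obtain a where a: "a \<in> gens F (Suc k)" "fst (gdeg F (Suc k) a) = fst (gdeg F (Suc (Suc k)) c)"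
    "snd (gdeg F (Suc k) a) < snd (gdeg F (Suc (Suc k)) c)"
    by (rule strand[OF Suc.prems(1)])
  then show ?case using Suc.IH[OF a(1)] snd_gdeg_ge[OF a(1)] Suc.prems(2) by simp
qed

lemma n_low: "j < int k \<Longrightarrow> n (Suc k) (i, j) = 0"
  using snd_gdeg_ge[of _ k] by (fastforce simp: n_eq_0_iff)

lemma n_lowest: "i \<noteq> int N \<Longrightarrow> n (Suc k) (i, int k) = 0"
  using fst_gdeg_lowest[of _ k] by (fastforce simp: n_eq_0_iff)

section \<open>The alternating sum of Betti numbers\<close>

lemma exact_cycles: "cycles_deg k d = differential F (Suc k) ` elems_deg F (Suc (Suc k)) d"
proof (intro equalityI subsetI)
  fix u assume "u \<in> cycles_deg k d"
  then obtain w where "w \<in> elems_deg F (Suc (Suc k)) d" "u = differential F (Suc k) w"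
    using exact_deg[of u k d] by (auto simp: cycles_deg_def)
  then show "u \<in> differential F (Suc k) ` elems_deg F (Suc (Suc k)) d" by blast
next
  fix u assume "u \<in> differential F (Suc k) ` elems_deg F (Suc (Suc k)) d"
  then obtain w where "w \<in> elems_deg F (Suc (Suc k)) d" "u = differential F (Suc k) w" by blast
  then show "u \<in> cycles_deg k d"
    using differential_deg differential_differential[OF elems_deg_elems] by (simp add: cycles_deg_def)
qed

definition Fdim :: "nat \<Rightarrow> int \<times> int \<Rightarrow> nat"
  where "Fdim k d = (\<Sum>b\<in>gens F k. mono_count (d - gdeg F k b))"

lemma Fdim_low:
  assumes "snd d < int k"
  shows "Fdim (Suc k) d = 0"
  unfolding Fdim_def
proof (rule sum.neutral, rule ballI, rule mono_count_neg)
  fix b assume "b \<in> gens F (Suc k)"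
  then show "\<not> 0 \<le> d - gdeg F (Suc k) b" using snd_gdeg_ge[of b k] assms by (auto simp: less_eq_prod_def)
qed

lemma Fdim_Suc: "Fdim (Suc k) d = vf.dim (cycles_deg k d) + vf.dim (differential F k ` elems_deg F (Suc k) d)"
  unfolding Fdim_def elems_deg_dim[symmetric] by (rule dim_cycles_deg)

text \<open>Exactness makes the alternating sum of dimensions telescope. It stops at F_3, because
  the generators of F_4 have y-degree at least 3.\<close>

lemma hilbert_Fdim:
  assumes "j \<le> 2"
  shows "H i j = int (mono_count (i, j)) - int (Fdim 1 (i, j)) + int (Fdim 2 (i, j)) - int (Fdim 3 (i, j))"
proof -
  let ?d = "(i, j)"
  \<comment> \<open>The coordinate at \<open>b0\<close>, the only one of F_0, carries the image of
    the differential isomorphically to the part of the ideal in this degree.\<close>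
  have "vf.dim (differential F 0 ` elems_deg F 1 ?d) = vc.dim (cox_comp ?d \<inter> vanishing_ideal X)"
  proof -
    let ?f = "\<lambda>u :: nat \<Rightarrow> 'k cox. u b0" and ?V = "differential F 0 ` elems_deg F 1 ?d"
    have lin: "Vector_Spaces.linear scf (\<lambda>c p. mconst c * p) ?f" by unfold_locales (auto simp: scf_def)
    have "u = 0" if "u \<in> ?V" "u b0 = 0" for u
    proof
      fix b show "u b = 0 b" using that by (cases "b = b0") (auto simp: differential_def gens_0)
    qed
    moreover have z: "0 \<in> ?V" by (rule image_eqI[of _ _ 0]) (auto simp: differential_0 elems_deg_0)
    ultimately have ker: "{u \<in> ?V. ?f u = 0} = vf.span {}" unfolding vf.span_empty by auto
    have fd: "fin_dim vf.span {u \<in> ?V. ?f u = 0}" unfolding ker by (auto simp: fin_dim_def)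
    have im: "?f ` ?V = cox_comp ?d \<inter> vanishing_ideal X"
      unfolding image_image by (rule image_elems_deg_1)
    have sub: "vf.subspace ?V" by (rule ff.linear_subspace_image[OF differential_linear elems_deg_subspace])
    have "fin_dim vc.span (?f ` ?V)" unfolding im by (rule fin_dim_subset[OF cox_comp_fin_dim Int_lower1])
    from fc.rank_nullity(2)[OF lin sub fd this] show ?thesis
      unfolding ker im vf.dim_span vf.dim_eq_card_independent[OF vf.independent_empty] by simp
  qed
  then have "Fdim 1 ?d = vf.dim (cycles_deg 0 ?d) + vc.dim (cox_comp ?d \<inter> vanishing_ideal X)"
    using Fdim_Suc[of 0 ?d] by simp
  moreover have "Fdim 2 ?d = vf.dim (cycles_deg 1 ?d) + vf.dim (cycles_deg 0 ?d)"
    using Fdim_Suc[of 1 ?d] exact_cycles[of 0 ?d] by (simp add: numeral_2_eq_2)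
  moreover have "Fdim 3 ?d = vf.dim (cycles_deg 2 ?d) + vf.dim (cycles_deg 1 ?d)"
    using Fdim_Suc[of 2 ?d] exact_cycles[of 1 ?d] by (simp add: numeral_2_eq_2 numeral_3_eq_3)
  moreover have "Fdim 4 ?d = vf.dim (cycles_deg 3 ?d) + vf.dim (cycles_deg 2 ?d)"
    using Fdim_Suc[of 3 ?d] exact_cycles[of 2 ?d] by (simp add: eval_nat_numeral)
  moreover have "Fdim 4 ?d = 0" using Fdim_low[of ?d 3] assms by (simp add: eval_nat_numeral)
  ultimately show ?thesis using hilbert_dim[of i j] by linarith
qed

text \<open>By linearity from \<open>diff_D_mono_count\<close>, each generator contributes 1 at its
  own degree and 0 elsewhere.\<close>

lemma diff_D_Fdim:
  assumes "j \<le> 2"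
  shows "diff_D (\<lambda>i j. int (Fdim k (i, j))) i j = int (n k (i, j))"
proof -
  have "diff_D (\<lambda>i j. int (Fdim k (i, j))) i j
    = (\<Sum>b\<in>gens F k. diff_D (\<lambda>i j. int (mono_count (i - fst (gdeg F k b), j - snd (gdeg F k b)))) i j)"
    by (simp add: Fdim_def diff_D_sum[symmetric] minus_prod_def)
  also have "\<dots> = (\<Sum>b\<in>gens F k. if (i, j) = (fst (gdeg F k b), snd (gdeg F k b)) then 1 else 0)"
    by (rule sum.cong[OF refl], rule diff_D_mono_count[OF assms])
      (use gdeg_nonneg[of _ k] in \<open>auto simp: less_eq_prod_def\<close>)
  also have "\<dots> = int (n k (i, j))"
    by (simp add: n_card sum.If_cases Int_def eq_commute[of "(i, j)"])
  finally show ?thesis .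
qed

lemma DH_n:
  assumes "j \<le> 2"
  shows "diff_D H i j = (if (i, j) = (0, 0) then 1 else 0) - int (n 1 (i, j)) + int (n 2 (i, j)) - int (n 3 (i, j))"
proof -
  have "diff_D H i j = diff_D (\<lambda>i j. int (mono_count (i - 0, j - 0)) - int (Fdim 1 (i, j)) + int (Fdim 2 (i, j)) - int (Fdim 3 (i, j))) i j"
    by (rule diff_D_cong) (use assms hilbert_Fdim in simp)
  also have "\<dots> = diff_D (\<lambda>i j. int (mono_count (i - 0, j - 0))) i j - diff_D (\<lambda>i j. int (Fdim 1 (i, j))) i j
      + diff_D (\<lambda>i j. int (Fdim 2 (i, j))) i j - diff_D (\<lambda>i j. int (Fdim 3 (i, j))) i j"
    unfolding diff_D_minus diff_D_add ..
  finally show ?thesis unfolding diff_D_Fdim[OF assms] using diff_D_mono_count[OF assms, of 0 0 i] by simp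
qed

lemma n_2_0: "n 2 (i, 0) = 0"
  using n_low[of 0 1 i] by (simp add: numeral_2_eq_2)

lemma n_3_1: "n 3 (i, 1) = 0"
  using n_low[of 1 2 i] by (simp add: numeral_3_eq_3)

text \<open>No cancellation is possible here, as F_3 starts in y-degree 2; so the second Betti
  number can be read off from the Hilbert matrix.\<close>

lemma n_2_1: "n 2 (i, 1) = (if i = int N then 3 else 0)"
proof -
  have "diff_D H i 1 = - int (n 1 (i, 1)) + int (n 2 (i, 1))" using DH_n[of 1 i] n_3_1 by simp
  then show ?thesis using q_bounds unfolding DH_1 n_1_1 by (auto split: if_splits)
qed

text \<open>Modulo the \<open>x\<close>-variables, the three generators of degree \<open>(N, 1)\<close> already surject onto the
  part of \<open>\<langle>y\<rangle>\<close> in degree \<open>(N, 2)\<close>, so a further generator of that degree would not be minimal.\<close>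

lemma n_2_2_N: "n 2 (int N, 2) = 0"
proof (rule ccontr)
  assume "n 2 (int N, 2) \<noteq> 0"
  then obtain c0 where c0: "c0 \<in> gens F 2" "gdeg F 2 c0 = (int N, 2)" by (auto simp: n_eq_0_iff)
  have "card {c \<in> gens F 1. gdeg F 1 c = (int N, 0)} = 1" using n_1_0[of "int N"] by (simp add: n_card)
  then obtain e where e: "{c \<in> gens F 1. gdeg F 1 c = (int N, 0)} = {e}" by (metis card_1_singletonE)
  then have e1: "e \<in> gens F 1" "gdeg F 1 e = (int N, 0)" by auto
  define C where "C = {c \<in> gens F 2. gdeg F 2 c = (int N, 1)}"
  have cardC: "card C = 3" using n_2_1[of "int N"] by (simp add: n_card C_def)
  obtain t where t: "nzd (vanishing_ideal X) (mvar (Inl 1) + mconst t * mvar (Inl 2))" by (rule linear_forms)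
  have ex: "exact_mod F (mono_ideal (range Inl)) 2 d" for d
    using exact_mod_x[OF t, of 0 d] by (simp add: numeral_2_eq_2)
  \<comment> \<open>Modulo the x-variables only the row of \<open>e\<close> matters: no other
    generator of F_1 of y-degree at most 2 has x-degree N.\<close>
  have other: "differential F 1 v a \<in> mono_ideal (range Inl)"
    if v: "v \<in> elems_deg F 2 (int N, j)" and "j \<le> 2" "a \<noteq> e" for v j a
  proof (cases "a \<in> gens F 1")
    case True
    have dv: "differential F 1 v \<in> elems_deg F 1 (int N, j)"
      using differential_deg[of v 1] v by (simp add: numeral_2_eq_2)
    note dva = elems_degD[OF dv, of a]
    obtain x y where xy: "gdeg F 1 a = (x, y)" by (cases "gdeg F 1 a")
    show ?thesis
    proof (cases "x < int N \<or> differential F 1 v a = 0")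
      case True
      then show ?thesis
        using cox_comp_mono_ideal_x[OF dva] xy is_ideal_0[OF is_ideal_mono_ideal] by auto
    next
      case False
      then have "0 \<le> (int N, j) - gdeg F 1 a" using cox_comp_eq_0[OF dva] by blast
      then have y: "x = int N" "y \<le> 2" using False that(2) xy by (auto simp: less_eq_prod_def)
      have "n 1 (int N, y) \<noteq> 0" unfolding n_eq_0_iff using \<open>a \<in> gens F 1\<close> xy y by blast
      moreover have "y \<noteq> 0" using e xy y \<open>a \<in> gens F 1\<close> that(3) by auto
      then have "n 1 (int N, y) = 0" using n_1_1[of "int N"] n_1_2[of "int N"] n_neg[of "int N" y 1] q_bounds
        by (cases rule: j_cases[OF y(2)]) (simp_all del: One_nat_def)
      ultimately show ?thesis by blast
    qed
  next
    case False
    then show ?thesis using is_ideal_0[OF is_ideal_mono_ideal] by (simp add: differential_def)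
  qed
  \<comment> \<open>If the entry at \<open>e\<close> vanishes too, then \<open>v\<close> is a cycle
    modulo the x-variables, hence a boundary there, and boundaries have no constant terms.\<close>
  have const: "lookup (v c) 0 = 0"
    if v: "v \<in> elems_deg F 2 (int N, j)" "j \<le> 2" "differential F 1 v e = 0" for v j c
  proof -
    have "differential F 1 v a \<in> mono_ideal (range Inl)" for a
      using other[OF v(1,2), of a] v(3) is_ideal_0[OF is_ideal_mono_ideal] by (cases "a = e") auto
    then obtain w where "v c - differential F 2 w c \<in> mono_ideal (range Inl)"
      using ex[of "(int N, j)"] v(1) unfolding exact_mod_def by (auto simp: numeral_2_eq_2) metis
    from mono_ideal_lookup_0[OF this] show ?thesis by (simp add: lookup_minus differential_lookup_0)
  qed
  define V where "V = {v \<in> elems_deg F 2 (int N, 1). \<forall>c. c \<notin> C \<longrightarrow> v c = 0}"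
  have V: "fin_dim vf.span V" "vf.dim V = 3"
    using elems_deg_dim_aux[of C 2 "(int N, 1)"] unfolding V_def
    by (auto simp: C_def mono_count_0 cardC[unfolded C_def])
  let ?f = "\<lambda>v. differential F 1 v e"
  have lin: "Vector_Spaces.linear scf (\<lambda>c p. mconst c * p) ?f"
    by unfold_locales (auto simp: scf_def differential_add differential_smf)
  have Vsub: "vf.subspace V"
    using elems_deg_subspace[of 2 "(int N, 1)"] by (auto simp: V_def vf.subspace_def scf_def)
  \<comment> \<open>Elements of \<open>V\<close> have constant coefficients, so \<open>const\<close>
    makes \<open>?f\<close> injective on \<open>V\<close>. As \<open>V\<close> and the space of
    linear forms in the y-variables both have dimension 3, every y-variable is a value of
    \<open>?f\<close>.\<close>
  have "v = 0" if v: "v \<in> V" "?f v = 0" for v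
  proof
    fix c
    show "v c = 0 c"
    proof (cases "c \<in> C")
      case True
      have "v c \<in> cox_comp 0" using v(1) elems_degD[of v F 2 "(int N, 1)" c] True by (simp add: V_def C_def)
      then have "v c = mconst (lookup (v c) 0)" by (rule cox_comp_degree_0)
      then show ?thesis using const[of v 1 c] v by (simp add: V_def)
    qed (use v in \<open>simp add: V_def\<close>)
  qed
  moreover have "0 \<in> V" by (simp add: V_def elems_deg_0)
  ultimately have ker: "{v \<in> V. ?f v = 0} = vf.span {}" unfolding vf.span_empty by (auto simp: differential_0)
  have fd: "fin_dim vf.span {v \<in> V. ?f v = 0}" unfolding ker by (auto simp: fin_dim_def)
  have im: "?f ` V \<subseteq> cox_comp (0, 1)"
  proof
    fix p assume "p \<in> ?f ` V"
    then obtain v where v: "v \<in> elems_deg F 2 (int N, 1)" "p = ?f v" by (auto simp: V_def)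
    have "differential F 1 v \<in> elems_deg F 1 (int N, 1)"
      using differential_deg[of v 1] v by (simp add: numeral_2_eq_2)
    from elems_degD[OF this, of e] show "p \<in> cox_comp (0, 1)" using v e1 by simp
  qed
  have fdim: "fin_dim vc.span (?f ` V)" by (rule fin_dim_subset[OF cox_comp_fin_dim im])
  have "vc.dim (?f ` V) = 3" using fc.rank_nullity(2)[OF lin Vsub fd fdim] V(2)
    unfolding ker vf.dim_span vf.dim_eq_card_independent[OF vf.independent_empty] by simp
  moreover have "int (mono_count (0, 1)) = 3" using mono_count_row[of 1 0] by (simp add: row_rank_def)
  ultimately have "?f ` V = cox_comp (0, 1)"
    by (intro cc.subspace_eqI_dim[OF cox_comp_fin_dim fc.linear_subspace_image[OF lin Vsub] im])
      (simp add: cox_comp_dim)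
  then have "\<forall>j. \<exists>v\<in>V. ?f v = mvar (Inr j)" using cox_comp_y by (metis image_iff)
  then obtain w where w: "\<And>j. w j \<in> V" "\<And>j. ?f (w j) = mvar (Inr j)" by metis
  have "dmat F 1 e c0 \<in> cox_comp (0, 2)" using dmat_deg[of e 1 c0] e1 c0 by (simp add: numeral_2_eq_2)
  moreover from this have "dmat F 1 e c0 \<in> mono_ideal (range Inr)" by (rule cox_comp_mono_ideal_y) simp
  then obtain h where "dmat F 1 e c0 = (\<Sum>v\<in>range Inr. mvar v * h v)" using mono_ideal_decomp[OF _ finite] by blast
  then have "dmat F 1 e c0 = (\<Sum>j\<in>UNIV. mvar (Inr j) * h (Inr j))" by (simp add: sum.reindex)
  then have "hc (0, 2) (dmat F 1 e c0) = (\<Sum>j\<in>UNIV. mvar (Inr j) * hc (0, 1) (h (Inr j)))"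
    by (simp add: hc_sum hc_mult[OF cox_comp_y])
  ultimately have dc0: "dmat F 1 e c0 = (\<Sum>j\<in>UNIV. mvar (Inr j) * hc (0, 1) (h (Inr j)))" by simp
  \<comment> \<open>The entry of \<open>c0\<close> at \<open>e\<close> is a combination of the
    y-variables. Subtracting the same combination of the \<open>w j\<close> leaves entry 0 at
    \<open>e\<close> but coefficient 1 at \<open>c0\<close>, against \<open>const\<close>.\<close>
  define v where "v = bas c0 - (\<Sum>j\<in>UNIV. smf (hc (0, 1) (h (Inr j))) (w j))"
  have "bas c0 \<in> elems_deg F 2 (int N, 2)" using bas_elems_deg[OF c0(1)] c0(2) by simp
  moreover have "smf (hc (0, 1) (h (Inr j))) (w j) \<in> elems_deg F 2 (int N, 2)" for j
    using elems_deg_smf[OF hc_in_cox_comp[of "(0, 1)"], of "w j" F 2 "(int N, 2)"] w(1)[of j] by (simp add: V_def)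
  ultimately have "v \<in> elems_deg F 2 (int N, 2)" unfolding v_def by (intro elems_deg_diff elems_deg_sum)
  moreover have "differential F 1 v e = 0"
    using e1 c0 differential_bas[of c0 1 e]
    by (simp add: v_def differential_diff differential_sum differential_smf w(2)[unfolded One_nat_def]
        dc0[unfolded One_nat_def] numeral_2_eq_2 mult.commute)
  ultimately have "lookup (v c0) 0 = 0" using const[of v 2 c0] by simp
  moreover have "c0 \<notin> C" using c0(2) by (simp add: C_def)
  then have "v c0 = 1" using w(1) by (simp add: v_def bas_def V_def)
  ultimately show False by simp
qed

text \<open>In degree (N, 2) neither F_1 nor F_2 has a generator, so the entry -3 of the difference
  matrix comes from F_3 alone.\<close>

lemma n_3_2: "n 3 (i, 2) = (if i = int N then 3 else 0)"
proof (cases "i = int N")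
  case True
  then show ?thesis using DH_n[of 2 i] n_2_2_N n_1_2[of i] q_bounds unfolding DH_2 by auto
next
  case False
  then show ?thesis using n_lowest[of i 2] by (simp add: numeral_3_eq_3)
qed

lemma n_2_2: "int (n 2 (i, 2)) = (if i = int q' then 9 - 3 * int r' else 0) + (if i = int q' + 1 then 3 * int r' else 0)"
  using DH_n[of 2 i] n_3_2[of i] n_1_2[of i] q_bounds unfolding DH_2 by (auto split: if_splits)

end

section \<open>Exactness of the truncation\<close>

lemma bideg_fst_0: "fst (bideg m) = 0 \<Longrightarrow> lookup m (Inl i) = 0"
  by (auto simp: bideg_def sum_nonneg_eq_0_iff)

lemma bideg_snd_0: "snd (bideg m) = 0 \<Longrightarrow> lookup m (Inr j) = 0"
  by (auto simp: bideg_def sum_nonneg_eq_0_iff)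

definition xpart :: "(2 + 3 \<Rightarrow>\<^sub>0 nat) \<Rightarrow> 2 + 3 \<Rightarrow>\<^sub>0 nat"
  where "xpart m = single (Inl 1) (lookup m (Inl 1)) + single (Inl 2) (lookup m (Inl 2))"

definition ypart :: "(2 + 3 \<Rightarrow>\<^sub>0 nat) \<Rightarrow> 2 + 3 \<Rightarrow>\<^sub>0 nat"
  where "ypart m = single (Inr 1) (lookup m (Inr 1)) + single (Inr 2) (lookup m (Inr 2))
    + single (Inr 3) (lookup m (Inr 3))"

lemma ypart_xpart: "ypart m + xpart m = m"
  by (rule exponents_eqI) (simp_all add: xpart_def ypart_def lookup_add lookup_single when_def)

lemma bideg_ypart: "bideg (ypart m) = (0, snd (bideg m))"
  by (simp add: bideg_eq ypart_def lookup_add lookup_single when_def)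

lemma bideg_xpart: "bideg (xpart m) = (fst (bideg m), 0)"
  by (simp add: bideg_eq xpart_def lookup_add lookup_single when_def)

text \<open>S is free over the polynomial ring in the x-variables, with the y-monomials as basis;
  \<open>h\<close> collects the coefficients.\<close>

lemma y_monomial_expansion:
  fixes p :: "'k::field cox"
  assumes "p \<in> cox_comp (i, l)"
  obtains h where "p = (\<Sum>\<mu> | bideg \<mu> = (0, l). single \<mu> 1 * h \<mu>)" "\<And>\<mu>. h \<mu> \<in> cox_comp (i, 0)"
proof -
  define h where "h \<mu> = (\<Sum>m | m \<in> keys p \<and> ypart m = \<mu>. single (xpart m) (lookup p m))" for \<mu>
  have "(\<Sum>\<mu> | bideg \<mu> = (0, l). single \<mu> 1 * h \<mu>)
    = (\<Sum>\<mu> | bideg \<mu> = (0, l). \<Sum>m | m \<in> keys p \<and> ypart m = \<mu>. single m (lookup p m))"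
  proof (rule sum.cong[OF refl])
    fix \<mu> assume "\<mu> \<in> {\<mu>. bideg \<mu> = (0, l)}"
    show "single \<mu> 1 * h \<mu> = (\<Sum>m | m \<in> keys p \<and> ypart m = \<mu>. single m (lookup p m))"
      unfolding h_def sum_distrib_left by (rule sum.cong) (auto simp: mult_single ypart_xpart)
  qed
  also have "\<dots> = (\<Sum>m\<in>keys p. single m (lookup p m))"
    by (rule sum.group) (use assms in \<open>auto simp: finite_monomials bideg_ypart cox_comp_def\<close>)
  also have "\<dots> = p" by (rule poly_sum_single)
  finally have "p = (\<Sum>\<mu> | bideg \<mu> = (0, l). single \<mu> 1 * h \<mu>)" ..
  moreover have "h \<mu> \<in> cox_comp (i, 0)" for \<mu>
    unfolding h_def
    by (rule cox_comp_sum) (use assms in \<open>auto simp: cox_comp_def bideg_xpart split: if_splits\<close>)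
  ultimately show ?thesis by (rule that)
qed

text \<open>Coefficients can be compared at \<open>\<mu> + m\<close>, since a monomial is a product
  of a y-monomial and an x-monomial in only one way.\<close>

lemma y_monomials_independent:
  fixes h :: "_ \<Rightarrow> 'k::field cox"
  assumes sum: "(\<Sum>\<mu> | bideg \<mu> = (0, l). single \<mu> 1 * h \<mu>) = 0"
    and h: "\<And>\<mu>. h \<mu> \<in> cox_comp (i, 0)" and \<mu>: "bideg \<mu> = (0, l)"
  shows "h \<mu> = 0"
proof (rule poly_mapping_eqI)
  fix m
  show "lookup (h \<mu>) m = lookup 0 m"
  proof (cases "bideg m = (i, 0)")
    case True
    have "lookup (single \<nu> 1 * h \<nu>) (\<mu> + m) = (if \<nu> = \<mu> then lookup (h \<mu>) m else 0)"
      if \<nu>: "bideg \<nu> = (0, l)" for \<nu>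
    proof (cases "\<nu> = \<mu>")
      case False
      have "lookup (single \<nu> 1 * h \<nu>) (\<mu> + m) = 0"
      proof (rule ccontr)
        assume "lookup (single \<nu> 1 * h \<nu>) (\<mu> + m) \<noteq> 0"
        then have "\<mu> + m \<in> keys (single \<nu> 1 * h \<nu>)" by (simp add: in_keys_iff)
        then obtain n where n: "\<mu> + m = \<nu> + n" "n \<in> keys (h \<nu>)"
          by (rule keys_multE) (auto split: if_splits)
        have bn: "bideg n = (i, 0)" using h[of \<nu>] n(2) by (simp add: cox_comp_def)
        have "lookup \<mu> (Inr j) = lookup \<nu> (Inr j)" for j
          using arg_cong[OF n(1), of "\<lambda>m. lookup m (Inr j)"] bn True bideg_snd_0[of n j] bideg_snd_0[of m j]
          by (simp add: lookup_add)
        moreover have "lookup \<mu> (Inl j) = lookup \<nu> (Inl j)" for j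
          using bideg_fst_0[of \<mu> j] bideg_fst_0[of \<nu> j] \<mu> \<nu> by simp
        ultimately have "\<mu> = \<nu>" by (intro exponents_eqI) auto
        then show False using False by simp
      qed
      then show ?thesis using False by simp
    qed (simp add: lookup_single_times)
    then have "lookup (\<Sum>\<nu> | bideg \<nu> = (0, l). single \<nu> 1 * h \<nu>) (\<mu> + m)
        = (\<Sum>\<nu> | bideg \<nu> = (0, l). if \<nu> = \<mu> then lookup (h \<mu>) m else 0)"
      unfolding lookup_sum by (intro sum.cong) auto
    also have "\<dots> = lookup (h \<mu>) m" using \<mu> by (simp add: finite_monomials)
    finally show ?thesis using sum by simp
  next
    case False
    then show ?thesis using h[of \<mu>] by (auto simp: mem_cox_comp)
  qed
qed

context generic_points
begin

lemma hilbert_N: "a \<ge> int N - 1 \<Longrightarrow> b \<ge> 0 \<Longrightarrow> H a b = int N"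
proof -
  assume a: "a \<ge> int N - 1" and b: "b \<ge> 0"
  have "a = int (nat a)" "b = int (nat b)" using a b N12 by simp_all
  then obtain i j where ij: "a = int i" "b = int j" by blast
  have "N \<le> i + 1" using a ij by linarith
  also have "\<dots> \<le> (i + 1) * ((j + 2) choose 2)"
  proof -
    have "0 < (j + 2) choose 2" by (rule zero_less_binomial) simp
    then have "1 \<le> (j + 2) choose 2" by linarith
    from mult_le_mono2[OF this, of "i + 1"] show ?thesis unfolding mult_1_right .
  qed
  finally show ?thesis unfolding ij hilbert_generic by (simp add: min_absorb1)
qed

text \<open>In these x-degrees the Hilbert matrix has the value N in all y-degrees from 0 on, so
  multiplication by the y-form, being injective on S/I_X, is surjective onto y-degree b once b >=
  1.\<close>

lemma exact_y:
  assumes a: "a \<ge> int N - 1" and b: "b \<ge> 3"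
  shows "exact_mod F (mono_ideal (range Inr)) k (a, b)"
proof -
  obtain c where c: "nzd (vanishing_ideal X) (mvar (Inr 1) + (mconst c * mvar (Inr 2) + mconst (c^2) * mvar (Inr 3)))"
    (is "nzd _ ?s") by (rule linear_forms)
  have s: "?s \<in> cox_comp (0, 1)" by (intro cox_comp_add cox_comp_mconst_mult cox_comp_y)
  show ?thesis
  proof (rule exact_mod_y[OF c _ b])
    fix b and p :: "'k cox" assume b: "b \<ge> (1 :: int)" and p: "p \<in> cox_comp (a, b)"
    have e: "(a, b) - (0, 1) = (a, b - 1)" by simp
    have "int (mono_count (a, b - 1)) - int (vc.dim (cox_comp (a, b - 1) \<inter> vanishing_ideal X)) = int N"
      using hilbert_dim[of a "b - 1"] hilbert_N[OF a, of "b - 1"] b by linarith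
    moreover have "int (mono_count (a, b)) - int (vc.dim (cox_comp (a, b) \<inter> vanishing_ideal X)) = int N"
      using hilbert_dim[of a b] hilbert_N[OF a, of b] b by linarith
    ultimately show "\<exists>g\<in>cox_comp (a, b - 1). p - ?s * g \<in> vanishing_ideal X"
      using nzd_surj[OF is_ideal_vanishing_ideal s c _ p] unfolding e by metis
  qed
qed

text \<open>The coefficients of the \<open>y\<close>-monomials in the part of \<open>u\<close> of top \<open>y\<close>-degree \<open>l\<close> are cycles modulo
  \<open>\<langle>y\<rangle>\<close>, so exactness modulo \<open>\<langle>y\<rangle>\<close> in \<open>y\<close>-degree \<open>l \<ge> 3\<close> pushes \<open>u\<close> into lower \<open>y\<close>-degree.\<close>

lemma truncate_step:
  assumes a: "a \<ge> int N - 1" and l: "l \<ge> 3"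
    and u: "u \<in> elems_deg F (Suc k) (a, b)" "\<And>c. u c \<noteq> 0 \<Longrightarrow> snd (gdeg F (Suc k) c) \<le> l"
    and du: "\<And>r. differential F k u r \<noteq> 0 \<Longrightarrow> snd (gdeg F k r) \<le> 2"
  obtains u' where "u' \<in> elems_deg F (Suc k) (a, b)" "\<And>c. u' c \<noteq> 0 \<Longrightarrow> snd (gdeg F (Suc k) c) \<le> l - 1"
    "differential F k u' = differential F k u"
proof -
  define Y where "Y = {\<mu> :: 2 + 3 \<Rightarrow>\<^sub>0 nat. bideg \<mu> = (0, b - l)}"
  define T where "T = {c \<in> gens F (Suc k). snd (gdeg F (Suc k) c) = l}"
  have "\<exists>h. u c = (\<Sum>\<mu>\<in>Y. single \<mu> 1 * h \<mu>) \<and> (\<forall>\<mu>. h \<mu> \<in> cox_comp (a - fst (gdeg F (Suc k) c), 0))"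
    if "c \<in> T" for c
  proof -
    have "u c \<in> cox_comp (a - fst (gdeg F (Suc k) c), b - l)"
      using elems_degD[OF u(1), of c] that by (cases "gdeg F (Suc k) c") (simp add: T_def)
    from y_monomial_expansion[OF this] show ?thesis unfolding Y_def by blast
  qed
  then have "\<forall>c\<in>T. \<exists>h. u c = (\<Sum>\<mu>\<in>Y. single \<mu> 1 * h \<mu>) \<and> (\<forall>\<mu>. h \<mu> \<in> cox_comp (a - fst (gdeg F (Suc k) c), 0))"
    by blast
  from bchoice[OF this] obtain h where h: "\<And>c. c \<in> T \<Longrightarrow> u c = (\<Sum>\<mu>\<in>Y. single \<mu> 1 * h c \<mu>)"
    "\<And>c \<mu>. c \<in> T \<Longrightarrow> h c \<mu> \<in> cox_comp (a - fst (gdeg F (Suc k) c), 0)" by blast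
  define v where "v \<mu> c = (if c \<in> T then h c \<mu> else 0)" for \<mu> c
  have v: "v \<mu> \<in> elems_deg F (Suc k) (a, l)" for \<mu>
  proof -
    have "v \<mu> c \<in> cox_comp ((a, l) - gdeg F (Suc k) c)" for c
      using h(2)[of c \<mu>] by (cases "gdeg F (Suc k) c") (auto simp: v_def T_def)
    then show ?thesis by (auto simp: mem_elems_deg mem_elems v_def T_def)
  qed
  define uT where "uT = (\<Sum>\<mu>\<in>Y. smf (single \<mu> 1) (v \<mu>))"
  have uT: "uT c = (if c \<in> T then u c else 0)" for c
    by (auto simp: uT_def v_def h(1))
  have dvJ: "differential F k (v \<mu>) r \<in> mono_ideal (range Inr)" if \<mu>: "\<mu> \<in> Y" for \<mu> r
  proof (cases "r \<in> gens F k")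
    case True
    obtain x y where xy: "gdeg F k r = (x, y)" by (cases "gdeg F k r")
    have dv: "differential F k (v \<nu>) r \<in> cox_comp (a - x, l - y)" for \<nu>
      using elems_degD[OF differential_deg[OF v[of \<nu>]], of r] xy by simp
    consider "y < l" | "y > l" | "y = l" by linarith
    then show ?thesis
    proof cases
      case 1
      then show ?thesis using cox_comp_mono_ideal_y[OF dv] by simp
    next
      case 2
      then have "differential F k (v \<mu>) r = 0" using cox_comp_eq_0[OF dv] by (simp add: less_eq_prod_def)
      then show ?thesis using is_ideal_0[OF is_ideal_mono_ideal] by simp
    next
      case 3
      \<comment> \<open>Generators of y-degree below \<open>l\<close> have zero entry in this row of
        y-degree \<open>l\<close>, so only \<open>uT\<close> contributes. As \<open>l\<close>
        exceeds 2, the differential of \<open>u\<close> vanishes at \<open>r\<close>, and then so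
        does the coefficient of each y-monomial.\<close>
      have "dmat F k r c * (u - uT) c = 0" if c: "c \<in> gens F (Suc k)" for c
      proof (cases "u c = 0 \<or> c \<in> T")
        case False
        then have "snd (gdeg F (Suc k) c) < l" using u(2)[of c] c by (auto simp: T_def)
        then have "dmat F k r c = 0" using cox_comp_eq_0[OF dmat_deg[OF True c]] xy 3
          by (auto simp: less_eq_prod_def)
        then show ?thesis by simp
      qed (auto simp: uT)
      then have "differential F k (u - uT) r = 0" by (auto simp: differential_def intro: sum.neutral)
      moreover have "differential F k u r = 0" using du[of r] xy 3 l by force
      ultimately have "differential F k uT r = 0" by (simp add: differential_diff)
      then have "(\<Sum>\<nu> | bideg \<nu> = (0, b - l). single \<nu> 1 * differential F k (v \<nu>) r) = 0"
        by (simp add: uT_def differential_sum differential_smf Y_def)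
      then have "differential F k (v \<mu>) r = 0"
        by (rule y_monomials_independent[where i = "a - x"]) (use dv 3 \<mu> in \<open>auto simp: Y_def\<close>)
      then show ?thesis using is_ideal_0[OF is_ideal_mono_ideal] by simp
    qed
  next
    case False
    then show ?thesis using is_ideal_0[OF is_ideal_mono_ideal] by (simp add: differential_def)
  qed
  have "\<exists>z\<in>elems_deg F (Suc (Suc k)) (a, l). \<forall>c. v \<mu> c - differential F (Suc k) z c \<in> mono_ideal (range Inr)"
    if "\<mu> \<in> Y" for \<mu>
    using exact_y[OF a l, of "Suc k"] v[of \<mu>] dvJ[OF that] unfolding exact_mod_def by blast
  then have "\<forall>\<mu>\<in>Y. \<exists>z. z \<in> elems_deg F (Suc (Suc k)) (a, l) \<and>
      (\<forall>c. v \<mu> c - differential F (Suc k) z c \<in> mono_ideal (range Inr))" by blast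
  from bchoice[OF this] obtain z where z: "\<And>\<mu>. \<mu> \<in> Y \<Longrightarrow> z \<mu> \<in> elems_deg F (Suc (Suc k)) (a, l)"
    "\<And>\<mu> c. \<mu> \<in> Y \<Longrightarrow> v \<mu> c - differential F (Suc k) (z \<mu>) c \<in> mono_ideal (range Inr)" by blast
  define Z where "Z = (\<Sum>\<mu>\<in>Y. smf (single \<mu> 1) (z \<mu>))"
  have Z: "Z \<in> elems_deg F (Suc (Suc k)) (a, b)"
    unfolding Z_def
  proof (rule elems_deg_sum)
    fix \<mu> assume \<mu>: "\<mu> \<in> Y"
    have "single \<mu> (1 :: 'k) \<in> cox_comp (0, b - l)" using \<mu> by (auto simp: cox_comp_def Y_def)
    moreover have "(a, b) - (0, b - l) = (a, l)" by simp
    ultimately show "smf (single \<mu> 1) (z \<mu>) \<in> elems_deg F (Suc (Suc k)) (a, b)"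
      using elems_deg_smf[of "single \<mu> 1" "(0, b - l)" "z \<mu>" F "Suc (Suc k)" "(a, b)"] z(1)[OF \<mu>] by simp
  qed
  have dZ: "differential F (Suc k) Z c = (\<Sum>\<mu>\<in>Y. single \<mu> 1 * differential F (Suc k) (z \<mu>) c)" for c
    by (simp add: Z_def differential_sum differential_smf)
  show ?thesis
  proof (rule that[of "u - differential F (Suc k) Z"])
    show "u - differential F (Suc k) Z \<in> elems_deg F (Suc k) (a, b)"
      using u(1) Z by (intro elems_deg_diff differential_deg)
    show "differential F k (u - differential F (Suc k) Z) = differential F k u"
      using differential_differential[OF elems_deg_elems[OF Z]] by (simp add: differential_diff)
    fix c assume nz: "(u - differential F (Suc k) Z) c \<noteq> 0"
    show "snd (gdeg F (Suc k) c) \<le> l - 1"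
    proof (rule ccontr)
      assume "\<not> ?thesis"
      then have ge: "snd (gdeg F (Suc k) c) \<ge> l" by simp
      obtain x y where xy: "gdeg F (Suc k) c = (x, y)" by (cases "gdeg F (Suc k) c")
      have dz: "differential F (Suc k) (z \<mu>) c \<in> cox_comp (a - x, l - y)" if "\<mu> \<in> Y" for \<mu>
        using elems_degD[OF differential_deg[OF z(1)[OF that]], of c] xy by simp
      have "c \<in> gens F (Suc k)"
        using nz u(1) by (cases "c \<in> gens F (Suc k)") (auto simp: mem_elems_deg mem_elems differential_def)
      \<comment> \<open>At generators of y-degree \<open>l\<close> the corrected coefficients have
        y-degree 0 and lie in the ideal of the y-variables, so they vanish. Above \<open>l\<close>
        there is nothing, since the elements \<open>z \<mu>\<close> have internal y-degree
        \<open>l\<close>.\<close>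
      show False
      proof (cases "y = l")
        case True
        then have cT: "c \<in> T" using \<open>c \<in> gens F (Suc k)\<close> xy by (simp add: T_def)
        have "v \<mu> c - differential F (Suc k) (z \<mu>) c = 0" if \<mu>: "\<mu> \<in> Y" for \<mu>
        proof (rule mono_ideal_y_eq_0[OF _ _ z(2)[OF \<mu>]])
          show "v \<mu> c - differential F (Suc k) (z \<mu>) c \<in> cox_comp (a - x, 0)"
            using dz[OF \<mu>] elems_degD[OF v[of \<mu>], of c] xy True by (intro cox_comp_diff) auto
        qed simp
        then have "u c = differential F (Suc k) Z c"
          unfolding dZ using h(1)[OF cT] cT by (simp add: v_def)
        then show False using nz by simp
      next
        case False
        then have "y > l" using ge xy by simp
        then have "differential F (Suc k) Z c = 0" unfolding dZ
          using cox_comp_eq_0[OF dz] by (intro sum.neutral) (auto simp: less_eq_prod_def)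
        moreover have "u c = 0" using u(2)[of c] xy \<open>y > l\<close> by force
        ultimately show False using nz by simp
      qed
    qed
  qed
qed

text \<open>The largest y-degree occurring in \<open>u\<close> is lowered one at a time; the sum of
  all y-degrees of generators serves as a starting bound.\<close>

lemma truncate:
  assumes a: "a \<ge> int N - 1" and u: "u \<in> elems_deg F (Suc k) (a, b)"
    and du: "\<And>r. differential F k u r \<noteq> 0 \<Longrightarrow> snd (gdeg F k r) \<le> 2"
  obtains u' where "u' \<in> elems_deg F (Suc k) (a, b)" "\<And>c. u' c \<noteq> 0 \<Longrightarrow> snd (gdeg F (Suc k) c) \<le> 2"
    "differential F k u' = differential F k u"
proof -
  have *: "\<exists>u'\<in>elems_deg F (Suc k) (a, b). (\<forall>c. u' c \<noteq> 0 \<longrightarrow> snd (gdeg F (Suc k) c) \<le> 2) \<and>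
      differential F k u' = differential F k u"
    if "u \<in> elems_deg F (Suc k) (a, b)" "\<And>c. u c \<noteq> 0 \<Longrightarrow> snd (gdeg F (Suc k) c) \<le> 2 + int m"
      "\<And>r. differential F k u r \<noteq> 0 \<Longrightarrow> snd (gdeg F k r) \<le> 2" for u m
    using that
  proof (induction m arbitrary: u)
    case (Suc m)
    obtain u1 where u1: "u1 \<in> elems_deg F (Suc k) (a, b)"
      "\<And>c. u1 c \<noteq> 0 \<Longrightarrow> snd (gdeg F (Suc k) c) \<le> 2 + int (Suc m) - 1"
      "differential F k u1 = differential F k u"
      by (rule truncate_step[OF a _ Suc.prems]) auto
    show ?case using Suc.IH[OF u1(1)] u1(2,3) Suc.prems(3) by simp
  qed auto
  define m where "m = (\<Sum>c\<in>gens F (Suc k). nat (snd (gdeg F (Suc k) c)))"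
  have "snd (gdeg F (Suc k) c) \<le> 2 + int m" if "u c \<noteq> 0" for c
  proof -
    have "c \<in> gens F (Suc k)" using that u by (auto simp: mem_elems_deg mem_elems)
    then have "nat (snd (gdeg F (Suc k) c)) \<le> m" unfolding m_def by (intro member_le_sum) auto
    then show ?thesis by linarith
  qed
  from *[OF u this du] show ?thesis using that by blast
qed

end

section \<open>The virtual resolution\<close>

lemma irrelevant_ideal_degree:
  fixes p :: "'k::comm_ring_1 cox"
  assumes "p \<in> irrelevant_ideal" "m \<in> keys p"
  shows "(1, 1) \<le> bideg m"
proof -
  have mv: "mvar v \<in> (mono_ideal W :: 'k cox set)" if "v \<in> W" for v W
    using mvar_times_mono_ideal[OF that, of 1] unfolding mult_1_right .
  have "range (\<lambda>i. mvar (Inl i)) \<subseteq> (mono_ideal (range Inl) :: 'k cox set)"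
    "range (\<lambda>j. mvar (Inr j)) \<subseteq> (mono_ideal (range Inr) :: 'k cox set)"
    by (rule image_subsetI, rule mv, simp)+
  then have "p \<in> mono_ideal (range Inl)" "p \<in> mono_ideal (range Inr)"
    using assms(1) genideal_subset[OF is_ideal_mono_ideal] unfolding irrelevant_ideal_def by blast+
  then obtain i j where ij: "lookup m (Inl i) > 0" "lookup m (Inr j) > 0"
    using assms(2) by (fastforce simp: mono_ideal_def)
  have "int (lookup m (Inl i)) \<le> (\<Sum>i\<in>UNIV. int (lookup m (Inl i)))"
    "int (lookup m (Inr j)) \<le> (\<Sum>j\<in>UNIV. int (lookup m (Inr j)))"
    by (intro member_le_sum; simp)+
  then show ?thesis using ij by (simp add: bideg_def)
qed

lemma ideal_power_degree:
  "p \<in> ideal_power cox_ring irrelevant_ideal t \<Longrightarrow> m \<in> keys (p :: 'k::comm_ring_1 cox) \<Longrightarrow> (int t, int t) \<le> bideg m"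
proof (induction t arbitrary: p m)
  case 0
  then show ?case using bideg_nonneg[of m] by (simp add: zero_prod_def)
next
  case (Suc t)
  have "p \<in> ideal_prod cox_ring irrelevant_ideal (ideal_power cox_ring irrelevant_ideal t)" using Suc.prems by simp
  then show ?case using Suc.prems(2)
  proof (induction arbitrary: m rule: ideal_prod.induct)
    case (prod i j)
    then obtain a b where ab: "m = a + b" "a \<in> keys i" "b \<in> keys j" by (auto elim: keys_multE)
    have "(1, 1) \<le> bideg a" "(int t, int t) \<le> bideg b"
      using irrelevant_ideal_degree prod ab Suc.IH by blast+
    then show ?case by (auto simp: ab(1) bideg_add less_eq_prod_def)
  next
    case (sum s1 s2)
    then show ?case using keys_add[of s1 s2] by auto
  qed
qed

lemma power_in_ideal_power:
  "p \<in> irrelevant_ideal \<Longrightarrow> p ^ t \<in> ideal_power cox_ring irrelevant_ideal t"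
proof (induction t)
  case (Suc t)
  then show ?case using ideal_prod.prod[of p irrelevant_ideal "p ^ t" _ cox_ring] by simp
qed simp

lemma prod_in_irrelevant_ideal:
  fixes s t :: "'k::comm_ring_1 cox"
  assumes "s \<in> genideal cox_ring (range (\<lambda>i. mvar (Inl i)))" "t \<in> genideal cox_ring (range (\<lambda>j. mvar (Inr j)))"
  shows "s * t \<in> irrelevant_ideal"
  unfolding irrelevant_ideal_def
  using is_ideal_mult[OF is_ideal_genideal assms(2), of s] is_ideal_mult[OF is_ideal_genideal assms(1), of t]
  by (simp add: mult.commute)

lemma nzd_mult: "nzd J s \<Longrightarrow> nzd J t \<Longrightarrow> nzd J (s * t)"
  unfolding nzd_def mult.assoc by blast

lemma nzd_power: "nzd J s \<Longrightarrow> nzd J (s ^ t)"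
proof (induction t)
  case (Suc t)
  then show ?case unfolding power_Suc by (intro nzd_mult)
qed (simp add: nzd_def)

lemma (in graded_cx) boundaries_sum:
  "(\<And>a. a \<in> A \<Longrightarrow> f a \<in> boundaries F i) \<Longrightarrow> sum f A \<in> boundaries F i"
proof (induction A rule: infinite_finite_induct)
  case (insert a A)
  have "sum f (insert a A) = f a + sum f A" using insert.hyps by (rule sum.insert)
  then show ?case using insert by (metis boundaries_add insertI1 insertI2)
qed (simp_all only: sum.infinite sum.empty boundaries_zero not_False_eq_True)

context generic_points
begin

section \<open>The truncated complex\<close>

definition G where "G = virtual_of_pair F (int N - 1, 0)"

lemma exists_irrelevant_nzd: "\<exists>s\<in>irrelevant_ideal. nzd (vanishing_ideal X) s"
proof -
  obtain c where c: "nzd (vanishing_ideal X) (mvar (Inl 1) + mconst c * mvar (Inl 2))" (is "nzd _ ?s")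
    "nzd (vanishing_ideal X) (mvar (Inr 1) + (mconst c * mvar (Inr 2) + mconst (c^2) * mvar (Inr 3)))" (is "nzd _ ?t")
    by (rule linear_forms)
  have "?s \<in> genideal cox_ring (range (\<lambda>i. mvar (Inl i)))"
    by (intro is_ideal_add is_ideal_mult is_ideal_genideal mem_genideal) auto
  moreover have "?t \<in> genideal cox_ring (range (\<lambda>j. mvar (Inr j)))"
    by (intro is_ideal_add is_ideal_mult is_ideal_genideal mem_genideal) auto
  ultimately show ?thesis using c by (intro bexI[of _ "?s * ?t"] nzd_mult prod_in_irrelevant_ideal)
qed

text \<open>The irrelevant ideal contains an element regular on S/I_X, the product of the x-form and
  the y-form; its t-th power lies in the t-th power of the ideal and can be cancelled.\<close>

lemma vanishing_ideal_saturated: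
  assumes "\<And>b. b \<in> ideal_power cox_ring irrelevant_ideal t \<Longrightarrow> b * p \<in> vanishing_ideal X"
  shows "p \<in> vanishing_ideal X"
proof -
  obtain s where s: "s \<in> irrelevant_ideal" "nzd (vanishing_ideal X) s" using exists_irrelevant_nzd by blast
  have "s ^ t * p \<in> vanishing_ideal X" by (rule assms[OF power_in_ideal_power[OF s(1)]])
  then show ?thesis using nzd_power[OF s(2), of t] by (simp add: nzd_def)
qed

text \<open>For k at least 4 there is no generator of y-degree at most 2, and for smaller k all
  degrees with that bound are known.\<close>

lemma fst_gdeg_le:
  assumes "c \<in> gens F k" "snd (gdeg F k c) \<le> 2"
  shows "fst (gdeg F k c) \<le> int N"
proof -
  obtain i j where ij: "gdeg F k c = (i, j)" by (cases "gdeg F k c")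
  have nz: "n k (i, j) \<noteq> 0" unfolding n_eq_0_iff using assms(1) ij by blast
  have j: "0 \<le> j" "j \<le> 2" using gdeg_nonneg[OF assms(1)] assms(2) ij by (auto simp: less_eq_prod_def)
  then have jc: "j = 0 \<or> j = 1 \<or> j = 2" by linarith
  consider "k = 0" | "k = 1" | "k = 2" | "k = 3" | k' where "k = Suc k'" "k' \<ge> 3"
    by (cases k) (auto, metis One_nat_def Suc_1 less_2_cases_iff not_less_eq_eq numeral_3_eq_3 le_antisym less_Suc_eq_le)
  then show ?thesis
  proof cases
    case 1
    then show ?thesis using assms(1) gens_0 gdeg_0 by auto
  next
    case 2
    have "int (n 1 (i, j)) = 0" if "i > int N"
      using that jc n_1_0[of i] n_1_1[of i] n_1_2[of i] q_bounds by (auto simp del: One_nat_def)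
    then have "\<not> i > int N" using nz unfolding 2 of_nat_eq_0_iff by blast
    then show ?thesis using ij unfolding 2 by simp
  next
    case 3
    have "int (n 2 (i, j)) = 0" if "i > int N"
      using that jc n_2_0[of i] n_2_1[of i] n_2_2[of i] q_bounds by auto
    then have "\<not> i > int N" using nz unfolding 3 of_nat_eq_0_iff by blast
    then show ?thesis using ij unfolding 3 by simp
  next
    case 4
    have "n 3 (i, 0) = 0" using n_low[of 0 2 i] by (simp add: numeral_3_eq_3)
    then have "int (n 3 (i, j)) = 0" if "i > int N"
      using that jc n_3_1[of i] n_3_2[of i] by auto
    then have "\<not> i > int N" using nz unfolding 4 of_nat_eq_0_iff by blast
    then show ?thesis using ij unfolding 4 by simp
  next
    case 5
    then show ?thesis using snd_gdeg_ge[of c k'] assms by simp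
  qed
qed

lemma G_simps:
  "gens G k = {b \<in> gens F k. snd (gdeg F k b) \<le> 2}" "gdeg G = gdeg F" "dmat G = dmat F"
proof -
  have "gens G k = {b \<in> gens F k. gdeg F k b \<le> (int N, 2)}" by (simp add: G_def virtual_of_pair_def)
  also have "\<dots> = {b \<in> gens F k. snd (gdeg F k b) \<le> 2}"
    using fst_gdeg_le[of _ k] by (auto simp: less_eq_prod_def)
  finally show "gens G k = {b \<in> gens F k. snd (gdeg F k b) \<le> 2}" .
qed (simp_all add: G_def virtual_of_pair_def)

lemma elems_G: "u \<in> elems G k \<longleftrightarrow> u \<in> elems F k \<and> (\<forall>c. u c \<noteq> 0 \<longrightarrow> snd (gdeg F k c) \<le> 2)"
  by (auto simp: mem_elems G_simps)

lemma elems_deg_G: "u \<in> elems_deg G k d \<longleftrightarrow> u \<in> elems_deg F k d \<and> (\<forall>c. u c \<noteq> 0 \<longrightarrow> snd (gdeg F k c) \<le> 2)"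
  by (auto simp: mem_elems_deg elems_G G_simps)

text \<open>A generator of y-degree at most 2 has zero entries in rows of larger y-degree, so the
  differential of \<open>F\<close> does not leave \<open>G\<close>.\<close>

lemma differential_G:
  assumes u: "u \<in> elems G (Suc k)"
  shows "differential G k u = differential F k u"
proof
  fix r
  have eq: "(\<Sum>c\<in>gens G (Suc k). dmat F k r c * u c) = (\<Sum>c\<in>gens F (Suc k). dmat F k r c * u c)"
  proof (rule sum.mono_neutral_left)
    show "\<forall>c\<in>gens F (Suc k) - gens G (Suc k). dmat F k r c * u c = 0"
      using u by (auto simp: mem_elems)
  qed (auto simp: G_simps)
  show "differential G k u r = differential F k u r"
  proof (cases "r \<in> gens F k \<and> r \<notin> gens G k")
    case True
    have "dmat F k r c * u c = 0" if c: "c \<in> gens F (Suc k)" for c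
    proof (cases "u c = 0")
      case False
      then have "snd (gdeg F (Suc k) c) \<le> 2" using u by (simp add: elems_G)
      then have "\<not> 0 \<le> gdeg F (Suc k) c - gdeg F k r" using True by (auto simp: G_simps less_eq_prod_def)
      then have "dmat F k r c = 0" using cox_comp_eq_0[OF dmat_deg[OF _ c]] True by blast
      then show ?thesis by simp
    qed simp
    then show ?thesis using True by (simp add: differential_def)
  next
    case False
    then show ?thesis using eq by (auto simp: differential_def G_simps)
  qed
qed

lemma graded_G: "graded_free_complex G"
  unfolding graded_free_complex_def
proof (intro conjI allI ballI)
  show "finite (gens G i)" for i by (simp add: G_simps)
  show "dmat G i a c \<in> cox_comp (gdeg G (Suc i) c - gdeg G i a)" if "a \<in> gens G i" "c \<in> gens G (Suc i)" for i a c
    using that dmat_deg by (simp add: G_simps)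
  fix i u assume u: "u \<in> elems G (Suc (Suc i))"
  have "differential G (Suc i) u \<in> elems G (Suc i)" by (rule differential_elems)
  then have "differential G i (differential G (Suc i) u) = differential F i (differential F (Suc i) u)"
    by (simp add: differential_G u)
  also have "\<dots> = 0" using u by (intro differential_differential) (simp add: elems_G)
  finally show "differential G i (differential G (Suc i) u) = (\<lambda>b. 0)" by (simp add: zero_fun_def)
qed

sublocale G: graded_cx G
  by unfold_locales (rule graded_G)

lemma boundaries_G_deg:
  assumes a: "a \<ge> int N - 1" and u: "u \<in> elems_deg G k (a, b)" "u \<in> boundaries F k"
  shows "u \<in> boundaries G k"
proof -
  have uF: "u \<in> elems_deg F k (a, b)" "\<And>c. u c \<noteq> 0 \<Longrightarrow> snd (gdeg F k c) \<le> 2" using u(1) by (auto simp: elems_deg_G)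
  obtain w where w: "w \<in> elems_deg F (Suc k) (a, b)" "u = differential F k w"
    using boundaries_deg[OF uF(1) u(2)] by blast
  obtain w' where w': "w' \<in> elems_deg F (Suc k) (a, b)" "\<And>c. w' c \<noteq> 0 \<Longrightarrow> snd (gdeg F (Suc k) c) \<le> 2"
    "differential F k w' = differential F k w"
    by (rule truncate[OF a w(1)]) (use uF(2) w(2) in auto)
  have "w' \<in> elems G (Suc k)" using w' by (auto simp: elems_G mem_elems_deg)
  then show ?thesis using w(2) w'(3) differential_G[of w' k] unfolding boundaries_def by (intro image_eqI[of _ _ w']) auto
qed

lemma hcf_in_boundaries:
  assumes "u \<in> boundaries F k"
  shows "hcf F k d u \<in> boundaries F k"
proof -
  obtain w where w: "w \<in> elems F (Suc k)" "u = differential F k w" using assms by (auto simp: boundaries_def)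
  have "hcf F k d u = differential F k (hcf F (Suc k) d w)" by (simp add: w(2) differential_hcf)
  then show ?thesis unfolding boundaries_def
    by (rule image_eqI[where x = "hcf F (Suc k) d w"]) (rule elems_deg_elems[OF hcf_elems_deg[OF w(1)]])
qed

text \<open>Each homogeneous component is covered by \<open>boundaries_G_deg\<close>: since
  generators have nonnegative degree, the internal x-degrees are at least those of the
  coefficients.\<close>

lemma boundaries_G:
  assumes u: "u \<in> elems G k" "u \<in> boundaries F k" and deg: "\<And>c m. m \<in> keys (u c) \<Longrightarrow> int N \<le> fst (bideg m)"
  shows "u \<in> boundaries G k"
proof -
  define D where "D = (\<Union>c\<in>gens G k. (\<lambda>m. bideg m + gdeg F k c) ` keys (u c))"
  have finD: "finite D" by (simp add: D_def)
  have "u = (\<Sum>d\<in>D. hcf F k d u)"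
  proof
    fix c
    show "u c = (\<Sum>d\<in>D. hcf F k d u) c"
    proof (cases "c \<in> gens G k")
      case True
      have inj: "inj_on (\<lambda>d. d - gdeg F k c) D" by (auto intro: inj_onI)
      have "(\<Sum>d\<in>D. hcf F k d u) c = (\<Sum>d\<in>(\<lambda>d. d - gdeg F k c) ` D. hc d (u c))"
        by (simp add: sum.reindex[OF inj] hcf_def)
      also have "\<dots> = u c"
      proof (rule sum_hc)
        show "bideg ` keys (u c) \<subseteq> (\<lambda>d. d - gdeg F k c) ` D"
        proof
          fix d assume "d \<in> bideg ` keys (u c)"
          then have "d + gdeg F k c \<in> D" using True by (auto simp: D_def)
          then show "d \<in> (\<lambda>d. d - gdeg F k c) ` D" by (intro image_eqI[of _ _ "d + gdeg F k c"]) auto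
        qed
      qed (simp add: finD)
      finally show ?thesis ..
    next
      case False
      then have "u c = 0" using u(1) by (simp add: mem_elems)
      then show ?thesis by (simp add: hcf_def)
    qed
  qed
  moreover have "hcf F k d u \<in> boundaries G k" if d: "d \<in> D" for d
  proof -
    obtain c m where cm: "c \<in> gens G k" "m \<in> keys (u c)" "d = bideg m + gdeg F k c"
      using d by (auto simp: D_def)
    have "fst d \<ge> int N - 1" using deg[OF cm(2)] gdeg_nonneg[of c k] cm(1,3) by (auto simp: G_simps less_eq_prod_def)
    moreover have "hcf F k d u \<in> elems_deg G k d"
      using hcf_elems_deg[of u G k d] u(1) by (simp add: hcf_def G_simps)
    ultimately show ?thesis
      using boundaries_G_deg[of "fst d" "hcf F k d u" k "snd d"] hcf_in_boundaries[OF u(2)] by simp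
  qed
  then have "(\<Sum>d\<in>D. hcf F k d u) \<in> boundaries G k" by (rule G.boundaries_sum)
  ultimately show ?thesis by metis
qed

lemma boundaries_G_subset: "boundaries G k \<subseteq> boundaries F k"
  using differential_G[of _ k] by (auto simp: boundaries_def elems_G)

text \<open>Every monomial of an element of the N-th power has x-degree at least N, which moves all
  components into the range where the truncation is exact.\<close>

lemma smf_boundaries_G:
  assumes "s \<in> ideal_power cox_ring irrelevant_ideal N" "u \<in> elems G k" "smf s u \<in> boundaries F k"
  shows "smf s u \<in> boundaries G k"
proof (rule boundaries_G[OF _ assms(3)])
  fix c m assume "m \<in> keys (smf s u c)"
  then obtain a b where ab: "m = a + b" "a \<in> keys s" by (auto elim: keys_multE)
  have "(int N, int N) \<le> bideg a" by (rule ideal_power_degree[OF assms(1) ab(2)])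
  then show "int N \<le> fst (bideg m)" using bideg_nonneg[of b] by (auto simp: ab(1) bideg_add less_eq_prod_def)
qed (rule elems_smf[OF assms(2)])

lemma homology_torsion:
  assumes "s \<in> ideal_power cox_ring irrelevant_ideal N" "h \<in> carrier (homology G (Suc k))"
  shows "s \<odot>\<^bsub>homology G (Suc k)\<^esub> h = \<zero>\<^bsub>homology G (Suc k)\<^esub>"
proof -
  obtain u where u: "u \<in> cycles G (Suc k)" "h = G.hclass (Suc k) u" using assms(2) by (auto simp: G.homology_simps)
  then have uG: "u \<in> elems G (Suc k)" "differential G k u = 0" by (auto simp: G.cycles_Suc)
  then have "u \<in> boundaries F (Suc k)" using exact[of u k] differential_G[OF uG(1)] by (simp add: elems_G)
  then have "smf s u \<in> boundaries G (Suc k)" using smf_boundaries_G[OF assms(1) uG(1)] boundaries_smf by blast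
  moreover from this have "smf s u \<in> cycles G (Suc k)" using G.boundaries_cycles by blast
  ultimately have "G.hclass (Suc k) (smf s u) = G.hclass (Suc k) 0"
    using G.hclass_eq_iff[OF _ G.cycles_zero] by simp
  then show ?thesis using u by (simp add: G.hclass_smult G.homology_simps G.hclass_zero)
qed

section \<open>Homology in degree 0 up to torsion\<close>

sublocale R: quotient_module "vanishing_ideal X"
  by unfold_locales (rule is_ideal_vanishing_ideal)

abbreviation TH where "TH \<equiv> irrelevant_torsion (homology G 0)"
abbreviation TR where "TR \<equiv> irrelevant_torsion (coordinate_module X)"

text \<open>A torsion class has its polynomial in the ideal by saturation. Conversely, if the
  polynomial lies in the ideal, all multiples of \<open>u\<close> are boundaries in
  \<open>F\<close>, and those by the N-th power of the irrelevant ideal are boundaries in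
  \<open>G\<close>.\<close>

lemma hclass_torsion_iff:
  assumes u: "u \<in> elems G 0"
  shows "G.hclass 0 u \<in> TH \<longleftrightarrow> u b0 \<in> vanishing_ideal X"
proof -
  have zero: "s \<odot>\<^bsub>homology G 0\<^esub> G.hclass 0 u = \<zero>\<^bsub>homology G 0\<^esub> \<longleftrightarrow> smf s u \<in> boundaries G 0" for s
    using u elems_smf[OF u, of s] G.hclass_eq_iff[of "smf s u" 0 0]
    by (simp add: G.hclass_smult G.homology_simps G.hclass_zero[symmetric] G.cycles_0)
  have iff: "G.hclass 0 u \<in> TH \<longleftrightarrow> (\<exists>t. \<forall>s\<in>ideal_power cox_ring irrelevant_ideal t. smf s u \<in> boundaries G 0)"
    by (simp add: irrelevant_torsion_def zero G.homology_simps(1) G.cycles_0 u)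
  show ?thesis
  proof
    assume "G.hclass 0 u \<in> TH"
    then obtain t where "\<forall>s\<in>ideal_power cox_ring irrelevant_ideal t. smf s u \<in> boundaries G 0"
      unfolding iff by blast
    then have "s * u b0 \<in> vanishing_ideal X" if "s \<in> ideal_power cox_ring irrelevant_ideal t" for s
      using that boundaries_G_subset[of 0] boundaries_0 by fastforce
    then show "u b0 \<in> vanishing_ideal X" by (rule vanishing_ideal_saturated)
  next
    assume I: "u b0 \<in> vanishing_ideal X"
    have uF: "u \<in> elems F 0" using u by (simp add: elems_G)
    then have "smf s u \<in> boundaries F 0" for s
      using elems_smf[OF uF] is_ideal_mult[OF is_ideal_vanishing_ideal I, of s] by (simp add: boundaries_0)
    then have "\<forall>s\<in>ideal_power cox_ring irrelevant_ideal N. smf s u \<in> boundaries G 0"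
      using smf_boundaries_G[OF _ u] by blast
    then show "G.hclass 0 u \<in> TH" unfolding iff by blast
  qed
qed

lemma TH_eq: "TH = G.hclass 0 ` {u \<in> elems G 0. u b0 \<in> vanishing_ideal X}"
proof -
  have "TH \<subseteq> G.hclass 0 ` elems G 0" by (auto simp: irrelevant_torsion_def G.homology_simps G.cycles_0)
  then show ?thesis using hclass_torsion_iff by blast
qed

lemma TR_eq: "TR = {R.qclass 0}"
proof -
  have zero: "s \<odot>\<^bsub>coordinate_module X\<^esub> R.qclass p = \<zero>\<^bsub>coordinate_module X\<^esub> \<longleftrightarrow> s * p \<in> vanishing_ideal X" for s p
    using R.qclass_eq_iff[of "s * p" 0] by (simp add: coordinate_module_def R.qclass_smult R.q_simps R.qclass_zero)
  have iff: "R.qclass p \<in> TR \<longleftrightarrow> (\<exists>t. \<forall>s\<in>ideal_power cox_ring irrelevant_ideal t. s * p \<in> vanishing_ideal X)" for p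
    unfolding irrelevant_torsion_def zero[symmetric] by (simp add: coordinate_module_def R.q_simps(1))
  have "R.qclass p \<in> TR \<longleftrightarrow> p \<in> vanishing_ideal X" for p
    unfolding iff using vanishing_ideal_saturated is_ideal_mult[OF is_ideal_vanishing_ideal] by blast
  moreover have "TR \<subseteq> range R.qclass" by (auto simp: irrelevant_torsion_def coordinate_module_def R.q_simps)
  moreover have "R.qclass p = R.qclass 0 \<longleftrightarrow> p \<in> vanishing_ideal X" for p by (simp add: R.qclass_eq_iff)
  ultimately show ?thesis by blast
qed

text \<open>Cosets of cosets: S/I_X has no torsion, but the definition of a virtual resolution still
  forms its quotient by the zero submodule.\<close>

definition \<gamma> where "\<gamma> p = TR +>\<^bsub>coordinate_module X\<^esub> R.qclass p"

lemma gmod_R: "gmod (coordinate_module X)"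
  unfolding coordinate_module_def by (rule R.gmod_q)

lemma gsubm_TR: "gsubm (coordinate_module X) TR"
proof -
  have zero: "\<zero>\<^bsub>coordinate_module X\<^esub> = R.qclass 0" by (simp add: coordinate_module_def R.q_simps R.qclass_zero)
  show ?thesis
    unfolding TR_eq gsubm_def zero
    by (simp add: coordinate_module_def R.q_simps(1) R.qclass_add R.qclass_smult)
qed

lemma R_carrier: "R.qclass p \<in> carrier (coordinate_module X)"
  by (simp add: coordinate_module_def R.q_simps)

lemma \<gamma>_simps:
  "\<gamma> p = \<gamma> p' \<longleftrightarrow> p - p' \<in> vanishing_ideal X"
  "\<gamma> p \<oplus>\<^bsub>gquot (coordinate_module X) TR\<^esub> \<gamma> p' = \<gamma> (p + p')"
  "s \<odot>\<^bsub>gquot (coordinate_module X) TR\<^esub> \<gamma> p = \<gamma> (s * p)"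
  "carrier (gquot (coordinate_module X) TR) = range \<gamma>"
  "gcomp (gquot (coordinate_module X) TR) d = \<gamma> ` cox_comp d"
proof -
  have "\<gamma> p = \<gamma> p' \<longleftrightarrow> (\<exists>k\<in>TR. R.qclass p = k \<oplus>\<^bsub>coordinate_module X\<^esub> R.qclass p')"
    unfolding \<gamma>_def by (rule gquot_coset_eq_iff[OF gmod_R gsubm_TR R_carrier R_carrier])
  then have "\<gamma> p = \<gamma> p' \<longleftrightarrow> R.qclass p = R.qclass 0 \<oplus>\<^bsub>coordinate_module X\<^esub> R.qclass p'"
    by (simp add: TR_eq)
  then show "\<gamma> p = \<gamma> p' \<longleftrightarrow> p - p' \<in> vanishing_ideal X"
    by (simp add: coordinate_module_def R.qclass_add R.qclass_eq_iff)
  show "\<gamma> p \<oplus>\<^bsub>gquot (coordinate_module X) TR\<^esub> \<gamma> p' = \<gamma> (p + p')"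
    unfolding \<gamma>_def gquot_add[OF gmod_R gsubm_TR R_carrier R_carrier]
    by (simp add: coordinate_module_def R.qclass_add)
  show "s \<odot>\<^bsub>gquot (coordinate_module X) TR\<^esub> \<gamma> p = \<gamma> (s * p)"
    unfolding \<gamma>_def gquot_smult[OF gmod_R gsubm_TR R_carrier]
    by (simp add: coordinate_module_def R.qclass_smult)
  show "carrier (gquot (coordinate_module X) TR) = range \<gamma>"
    unfolding gquot_simps \<gamma>_def[abs_def] by (simp add: coordinate_module_def R.q_simps image_image)
  show "gcomp (gquot (coordinate_module X) TR) d = \<gamma> ` cox_comp d"
    unfolding gquot_simps \<gamma>_def[abs_def] by (simp add: coordinate_module_def R.q_simps image_image)
qed

lemma gsubm_TH: "gsubm (homology G 0) TH"
proof -
  note I = is_ideal_vanishing_ideal[of X]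
  let ?U = "{u \<in> elems G 0. u b0 \<in> vanishing_ideal X}"
  have U: "0 \<in> ?U" "\<And>u v. u \<in> ?U \<Longrightarrow> v \<in> ?U \<Longrightarrow> u + v \<in> ?U" "\<And>u s. u \<in> ?U \<Longrightarrow> smf s u \<in> ?U" "\<And>u. u \<in> ?U \<Longrightarrow> - u \<in> ?U"
    using is_ideal_0[OF I] is_ideal_add[OF I] is_ideal_mult[OF I] is_ideal_minus[OF I]
    by (simp_all add: elems_add elems_smf elems_uminus)
  have add: "G.hclass 0 u \<oplus>\<^bsub>homology G 0\<^esub> G.hclass 0 v = G.hclass 0 (u + v)" if "u \<in> ?U" "v \<in> ?U" for u v
    using that by (intro G.hclass_add) (simp_all add: G.cycles_0)
  have smult: "s \<odot>\<^bsub>homology G 0\<^esub> G.hclass 0 u = G.hclass 0 (smf s u)" if "u \<in> ?U" for u s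
    using that by (intro G.hclass_smult) (simp_all add: G.cycles_0)
  have zero: "\<zero>\<^bsub>homology G 0\<^esub> = G.hclass 0 0" by (simp add: G.homology_simps G.hclass_zero)
  show ?thesis unfolding gsubm_def TH_eq zero
  proof (intro conjI ballI allI)
    show "G.hclass 0 ` ?U \<subseteq> carrier (homology G 0)" by (auto simp: G.homology_simps G.cycles_0)
    show "G.hclass 0 0 \<in> G.hclass 0 ` ?U" using U(1) by (rule imageI)
    fix x assume "x \<in> G.hclass 0 ` ?U"
    then obtain u where u: "u \<in> ?U" "x = G.hclass 0 u" by blast
    have "G.hclass 0 (- u) \<oplus>\<^bsub>homology G 0\<^esub> x = G.hclass 0 0"
      using add[OF U(4)[OF u(1)] u(1)] u(2) by simp
    then show "\<exists>y\<in>G.hclass 0 ` ?U. y \<oplus>\<^bsub>homology G 0\<^esub> x = G.hclass 0 0"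
      by (rule bexI[OF _ imageI[OF U(4)[OF u(1)]]])
    show "s \<odot>\<^bsub>homology G 0\<^esub> x \<in> G.hclass 0 ` ?U" for s
      unfolding u(2) smult[OF u(1)] by (rule imageI[OF U(3)[OF u(1)]])
    fix y assume "y \<in> G.hclass 0 ` ?U"
    then obtain v where v: "v \<in> ?U" "y = G.hclass 0 v" by blast
    show "x \<oplus>\<^bsub>homology G 0\<^esub> y \<in> G.hclass 0 ` ?U"
      unfolding u(2) v(2) add[OF u(1) v(1)] by (rule imageI[OF U(2)[OF u(1) v(1)]])
  qed
qed

text \<open>The isomorphism is induced by the coordinate at \<open>b0\<close>: as G_0 = S, a class
  in degree 0 is represented by a polynomial, and it is torsion exactly when that polynomial lies in
  the ideal.\<close>

lemma homology_0_iso: "gmodule_iso (gquot (homology G 0) TH) (gquot (coordinate_module X) TR)"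
proof -
  define \<phi> where "\<phi> C = \<gamma> ((SOME u. u \<in> elems G 0 \<and> C = G.hclass 0 u) b0)" for C
  have \<phi>: "\<phi> (G.hclass 0 u) = \<gamma> (u b0)" if u: "u \<in> elems G 0" for u
  proof -
    let ?v = "SOME v. v \<in> elems G 0 \<and> G.hclass 0 u = G.hclass 0 v"
    have v: "?v \<in> elems G 0 \<and> G.hclass 0 u = G.hclass 0 ?v" by (rule someI[of _ u]) (simp add: u)
    then have "?v - u \<in> boundaries G 0"
      using G.hclass_eq_iff[of ?v 0 u] u by (simp add: G.cycles_0)
    then have "(?v - u) b0 \<in> vanishing_ideal X" using boundaries_G_subset[of 0] boundaries_0 by blast
    then show ?thesis unfolding \<phi>_def \<gamma>_simps by simp
  qed
  have carrier: "carrier (homology G 0) = G.hclass 0 ` elems G 0" by (simp add: G.homology_simps G.cycles_0)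
  have lift: "\<exists>u\<in>elems_deg G 0 d. u b0 = p" if "p \<in> cox_comp d" for p d
  proof -
    have "(\<lambda>b. if b = b0 then p else 0) \<in> elems_deg F 0 d"
      using that by (auto simp: mem_elems_deg mem_elems gens_0 gdeg_0)
    then have "(\<lambda>b. if b = b0 then p else 0) \<in> elems_deg G 0 d" unfolding elems_deg_G by (simp add: gdeg_0)
    then show ?thesis by (rule bexI[rotated]) simp
  qed
  have lift': "\<exists>u\<in>elems G 0. u b0 = p" for p
  proof -
    have "(\<lambda>b. if b = b0 then p else 0) \<in> elems F 0" by (auto simp: mem_elems gens_0)
    then have "(\<lambda>b. if b = b0 then p else 0) \<in> elems G 0" unfolding elems_G by (simp add: gdeg_0)
    then show ?thesis by (rule bexI[rotated]) simp
  qed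
  show ?thesis
  proof (rule gmodule_isoI[of _ _ \<phi>])
    show "gmod (homology G 0)" by (rule G.gmod_homology)
    show "gsubm (homology G 0) TH" by (rule gsubm_TH)
    fix x y assume "x \<in> carrier (homology G 0)" "y \<in> carrier (homology G 0)"
    then obtain u v where u: "u \<in> elems G 0" "x = G.hclass 0 u" and v: "v \<in> elems G 0" "y = G.hclass 0 v"
      unfolding carrier by blast
    show "\<phi> (x \<oplus>\<^bsub>homology G 0\<^esub> y) = \<phi> x \<oplus>\<^bsub>gquot (coordinate_module X) TR\<^esub> \<phi> y"
      using u v by (simp add: G.hclass_add G.cycles_0 \<phi> elems_add \<gamma>_simps)
    show "\<phi> x = \<phi> y \<longleftrightarrow> (\<exists>k\<in>TH. x = k \<oplus>\<^bsub>homology G 0\<^esub> y)"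
    proof
      assume "\<phi> x = \<phi> y"
      then have "u b0 - v b0 \<in> vanishing_ideal X" using u v by (simp add: \<phi> \<gamma>_simps)
      then have "G.hclass 0 (u - v) \<in> TH" unfolding TH_eq using u v by (auto intro!: imageI elems_diff)
      moreover have "x = G.hclass 0 (u - v) \<oplus>\<^bsub>homology G 0\<^esub> y"
        using G.hclass_add[of "u - v" 0 v] u v by (simp add: G.cycles_0 elems_diff)
      ultimately show "\<exists>k\<in>TH. x = k \<oplus>\<^bsub>homology G 0\<^esub> y" by blast
    next
      assume "\<exists>k\<in>TH. x = k \<oplus>\<^bsub>homology G 0\<^esub> y"
      then obtain w where w: "w \<in> elems G 0" "w b0 \<in> vanishing_ideal X" "x = G.hclass 0 w \<oplus>\<^bsub>homology G 0\<^esub> y"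
        unfolding TH_eq by blast
      then have "x = G.hclass 0 (w + v)" using v G.hclass_add[of w 0 v] by (simp add: G.cycles_0)
      then show "\<phi> x = \<phi> y" using v w by (simp add: \<phi> elems_add \<gamma>_simps)
    qed
  next
    fix s x assume "x \<in> carrier (homology G 0)"
    then obtain u where u: "u \<in> elems G 0" "x = G.hclass 0 u" unfolding carrier by blast
    then show "\<phi> (s \<odot>\<^bsub>homology G 0\<^esub> x) = s \<odot>\<^bsub>gquot (coordinate_module X) TR\<^esub> \<phi> x"
      by (simp add: G.hclass_smult G.cycles_0 \<phi> elems_smf \<gamma>_simps)
  next
    show "\<phi> ` carrier (homology G 0) = carrier (gquot (coordinate_module X) TR)"
    proof (intro equalityI subsetI)
      fix z assume "z \<in> carrier (gquot (coordinate_module X) TR)"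
      then obtain p where "z = \<gamma> p" unfolding \<gamma>_simps by blast
      moreover obtain u where "u \<in> elems G 0" "u b0 = p" using lift' by blast
      ultimately show "z \<in> \<phi> ` carrier (homology G 0)" unfolding carrier using \<phi>[of u] by force
    qed (auto simp: carrier \<phi> \<gamma>_simps)
  next
    fix d
    have comp: "gcomp (homology G 0) d = G.hclass 0 ` elems_deg G 0 d"
    proof -
      have "elems_deg G 0 d \<inter> elems G 0 = elems_deg G 0 d" using elems_deg_elems by blast
      then show ?thesis by (simp add: G.homology_simps G.cycles_0)
    qed
    show "gcomp (homology G 0) d \<subseteq> carrier (homology G 0)"
      unfolding comp carrier using elems_deg_elems by blast
    show "\<phi> ` gcomp (homology G 0) d = gcomp (gquot (coordinate_module X) TR) d"
    proof (intro equalityI subsetI)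
      fix z assume "z \<in> gcomp (gquot (coordinate_module X) TR) d"
      then obtain p where p: "z = \<gamma> p" "p \<in> cox_comp d" unfolding \<gamma>_simps by blast
      then obtain u where "u \<in> elems_deg G 0 d" "u b0 = p" using lift by blast
      then show "z \<in> \<phi> ` gcomp (homology G 0) d" unfolding comp
        using \<phi>[OF elems_deg_elems] p by (metis imageI)
    next
      fix z assume "z \<in> \<phi> ` gcomp (homology G 0) d"
      then obtain u where u: "u \<in> elems_deg G 0 d" "z = \<phi> (G.hclass 0 u)" unfolding comp by blast
      then have "z = \<gamma> (u b0)" using \<phi> elems_deg_elems by blast
      moreover have "u b0 \<in> cox_comp d" using elems_degD[OF u(1), of b0] by (simp add: G_simps gdeg_0)
      ultimately show "z \<in> gcomp (gquot (coordinate_module X) TR) d" unfolding \<gamma>_simps by blast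
    qed
  qed
qed

lemma virtual_resolution_G: "virtual_resolution G (coordinate_module X)"
  unfolding virtual_resolution_def
proof (intro conjI allI impI)
  show "graded_free_complex G" by (rule graded_G)
  show "gmodule_iso (gquot (homology G 0) TH) (gquot (coordinate_module X) TR)" by (rule homology_0_iso)
  fix i :: nat assume "i > 0"
  then obtain k where "i = Suc k" by (metis Suc_pred)
  then show "\<exists>t. \<forall>s\<in>ideal_power cox_ring irrelevant_ideal t. \<forall>h\<in>carrier (homology G i).
      s \<odot>\<^bsub>homology G i\<^esub> h = \<zero>\<^bsub>homology G i\<^esub>" using homology_torsion by blast
qed

section \<open>The summands of the truncated complex\<close>

lemma count_twists_G: "count (twists G k) (i, j) = (if j \<le> 2 then n k (i, j) else 0)"
proof -
  have "{c \<in> gens G k. gdeg F k c = (i, j)} = (if j \<le> 2 then {c \<in> gens F k. gdeg F k c = (i, j)} else {})"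
    by (auto simp: G_simps)
  then show ?thesis unfolding n_card by (simp add: twists_def count_image_mset_eq_card_vimage G_simps(2) if_distrib)
qed

lemma twists_G_eqI:
  assumes "\<And>i. count M (i, 0) = n k (i, 0)" "\<And>i. count M (i, 1) = n k (i, 1)" "\<And>i. count M (i, 2) = n k (i, 2)"
    "\<And>i j. j < 0 \<or> j > 2 \<Longrightarrow> count M (i, j) = 0"
  shows "twists G k = M"
proof (rule multiset_eqI)
  fix d :: "int \<times> int"
  obtain i j where d: "d = (i, j)" by (cases d)
  consider "j < 0" | "j = 0" | "j = 1" | "j = 2" | "j > 2" by linarith
  then show "count (twists G k) d = count M d"
    unfolding d count_twists_G by cases (simp_all add: assms n_neg)
qed

lemma twists_G:
  "twists G 0 = {# (0, 0) #}"
  "twists G 1 =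
      replicate_mset (6 - r) (int q, 2) + replicate_mset r (int q + 1, 2) +
      replicate_mset (3 - r') (int q', 1) + replicate_mset r' (int q' + 1, 1) +
      {# (int N, 0) #}"
  "twists G 2 =
      replicate_mset (9 - 3 * r') (int q', 2) + replicate_mset (3 * r') (int q' + 1, 2) +
      replicate_mset 3 (int N, 1)"
  "twists G 3 = replicate_mset 3 (int N, 2)"
  "k \<ge> 4 \<Longrightarrow> twists G k = {#}"
proof -
  show "twists G 0 = {# (0, 0) #}"
    by (rule twists_G_eqI) (auto simp: n_0)
  show "twists G 1 =
      replicate_mset (6 - r) (int q, 2) + replicate_mset r (int q + 1, 2) +
      replicate_mset (3 - r') (int q', 1) + replicate_mset r' (int q' + 1, 1) +
      {# (int N, 0) #}" (is "_ = ?M")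
  proof (rule twists_G_eqI)
    fix i
    show "count ?M (i, 0) = n 1 (i, 0)" unfolding n_1_0 by simp
    have "int (count ?M (i, 1)) = int (n 1 (i, 1))" unfolding n_1_1 using N3 by simp
    then show "count ?M (i, 1) = n 1 (i, 1)" by linarith
    have "int (count ?M (i, 2)) = int (n 1 (i, 2))" unfolding n_1_2 using N6 by simp
    then show "count ?M (i, 2) = n 1 (i, 2)" by linarith
  qed auto
  show "twists G 2 =
      replicate_mset (9 - 3 * r') (int q', 2) + replicate_mset (3 * r') (int q' + 1, 2) +
      replicate_mset 3 (int N, 1)" (is "_ = ?M")
  proof (rule twists_G_eqI)
    fix i
    show "count ?M (i, 0) = n 2 (i, 0)" unfolding n_2_0 by simp
    show "count ?M (i, 1) = n 2 (i, 1)" unfolding n_2_1 by simp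
    have "int (count ?M (i, 2)) = int (n 2 (i, 2))" unfolding n_2_2 using N3 by simp
    then show "count ?M (i, 2) = n 2 (i, 2)" by linarith
  qed auto
  show "twists G 3 = replicate_mset 3 (int N, 2)" (is "_ = ?M")
  proof (rule twists_G_eqI)
    fix i
    have "n 3 (i, 0) = 0" using n_low[of 0 2 i] by (simp add: numeral_3_eq_3)
    then show "count ?M (i, 0) = n 3 (i, 0)" by simp
    show "count ?M (i, 1) = n 3 (i, 1)" unfolding n_3_1 by simp
    show "count ?M (i, 2) = n 3 (i, 2)" unfolding n_3_2 by simp
  qed auto
  assume "k \<ge> 4"
  then obtain k' where k': "k = Suc k'" "k' \<ge> 3" by (cases k) auto
  then have "n k (i, j) = 0" if "j \<le> 2" for i j using n_low[of j k' i] that by simp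
  then show "twists G k = {#}" by (intro twists_G_eqI) simp_all
qed

end

theorem theorem5p4:
  fixes X :: "'k::alg_closed_field point set"
    and F :: "'k gcomplex"
    and N q r q' r' :: nat
  assumes "weakened_MRC TYPE('k)"
    and "finite X"
    and "sufficiently_general_position X"
    and "N = card X"
    and "N \<ge> 12"
    and "N = 6 * q + r" and "r \<le> 5"
    and "N = 3 * q' + r'" and "r' \<le> 2"
    and "minimal_free_resolution F (coordinate_module X)"
  shows "let G = virtual_of_pair F (int N - 1, 0) in
    virtual_resolution G (coordinate_module X) \<and>
    twists G 0 = {# (0, 0) #} \<and>
    twists G 1 =
      replicate_mset (6 - r) (int q, 2) + replicate_mset r (int q + 1, 2) +
      replicate_mset (3 - r') (int q', 1) + replicate_mset r' (int q' + 1, 1) +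
      {# (int N, 0) #} \<and>
    twists G 2 =
      replicate_mset (9 - 3 * r') (int q', 2) + replicate_mset (3 * r') (int q' + 1, 2) +
      replicate_mset 3 (int N, 1) \<and>
    twists G 3 = replicate_mset 3 (int N, 2) \<and>
    (\<forall>k\<ge>4. twists G k = {#})"
proof -
  have X: "X \<noteq> {}" using assms(4,5) by auto
  obtain b0 where "min_res F (vanishing_ideal X) b0"
    using minimal_free_resolution_min_res[OF assms(10)[unfolded coordinate_module_def] is_ideal_vanishing_ideal
        hc_vanishing_ideal one_notin_vanishing_ideal[OF X]] by blast
  then interpret min_res F "vanishing_ideal X" b0 .
  interpret generic_points F X b0 N q r q' r'
    by unfold_locales (use assms betti_1_eq[OF assms(10) X] in \<open>simp_all\<close>)
  show ?thesis unfolding Let_def using virtual_resolution_G twists_G unfolding G_def by blast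
qed

end
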